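(* Let $V=\mathbb Z^g$ with the Euclidean distance and let $\Phi$ be a local interaction on $V$ with $\sup_{x\in V}\sum_{X\ni x}\|\Phi_X\|e^{\lambda|X|+\mu\operatorname{diam}(X)}\le\Delta$ for some $\lambda,\mu,\Delta>0$. Let $0<\beta<\lambda/(2\Delta)$ be such that: (a) $\Phi$ has weak local effective Hamiltonians at $\beta$, i.e. for every $L\subset V$ there is a local interaction $\widehat\Phi^{L,\beta}$ with (i) $\widehat\Phi^{L,\beta}_X$ supported in $X\cap L$ for every finite $X$, (ii) $\widehat\Phi^{L,\beta}_X=\widehat\Phi^{L',\beta}_X$ whenever $L'\subset V$ and $X\cap L'=X\cap L$, (iii) for every finite $\Lambda$, $-\frac1\beta\log(\operatorname{tr}_{\Lambda\setminus L}[e^{-\beta H_\Lambda}])+\frac1\beta\log(Z_{\Lambda\setminus L})\mathbb 1=\sum_{X\subset\Lambda,X\cap L\ne\emptyset}\widehat\Phi^{L,\beta}_X$; and for every $L$, $\sup_{x}\sum_{X\ni x}\|\widehat\Phi^{L,\beta}_X\|e^{\lambda|X|+\mu\operatorname{diam}(X)}\le\Delta$; (b) $H=(H_\Lambda)_\Lambda$ is $\epsilon(\ell)$-uniform clustering at $\beta$ with an exponentially decaying $\epsilon$. Then there exist constants $c',K_1,K_2>0$, independent of $\Lambda,A,C$, such that for every finite $\Lambda\subset\mathbb Z^g$ and every pair of disjoint nonempty subsets $A,C\subset\Lambda$, the Gibbs state $\rho=\rho^\Lambda_\beta$ satisfies $$\big\|\rho_{AC}\rho_A^{-1}\otimes\rho_C^{-1}-\mathbb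 1\big\|\le K_2\min\Big\{e^{K_1|\partial A|}\big(|\partial A|+|C|g(A)\big),\;e^{K_1|\partial C|}\big(|\partial C|+|A|g(C)\big)\Big\}e^{-c'\operatorname{dist}(A,C)}.$$
   Context: Each site of $\mathbb Z^g$ carries $\mathbb C^D$; $\mathfrak A_X=\mathcal B(\mathcal H_X)$, $\mathcal H_X=\bigotimes_{v\in X}\mathbb C^D$, embedded in larger algebras by tensoring with identity. A local interaction is a family $(\Phi_X)$ indexed by finite $X$ with $\Phi_X=\Phi_X^*\in\mathfrak A_X$; $H_\Lambda=\sum_{X\subset\Lambda}\Phi_X$; $Z_X=\operatorname{Tr}[e^{-\beta H_X}]$ ($Z_\emptyset=1$); $\operatorname{tr}_{\Lambda\setminus L}$ is the partial trace over $\Lambda\setminus L$; $\log$ is the self-adjoint logarithm. $\rho^\Lambda_\beta=e^{-\beta H_\Lambda}/Z_\Lambda$, $\rho_X=\operatorname{tr}_{\Lambda\setminus X}\rho^\Lambda_\beta$, and $\rho_{AC}\rho_A^{-1}\otimes\rho_C^{-1}$ is a product of operators on $\mathcal H_{A\cup C}$. Distances and diameters are Euclidean; $\partial A$ is the set of sites of $A$ at distance at most $1$ from $\mathbb Z^g\setminus A$. $\operatorname{Cov}_\rho(O_A,O_B)=|\operatorname{Tr}[\rho O_AO_B]-\operatorname{Tr}[\rho O_A]\operatorname{Tr}[\rho O_B]|$. $\epsilon(\ell)$-uniform clustering at $\beta$: there are $b\in\mathbb N$, a function $g$ from finite subsets to $[0,\infty)$, and $f(A,B)\le g(A)|B|^b$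 such that for all finite $\Lambda$, all $A,B\subset\Lambda$ with $\operatorname{dist}(A,B)\ge\ell$ and all $O_A\in\mathfrak A_A,O_B\in\mathfrak A_B$, $\operatorname{Cov}_{\rho^\Lambda_\beta}(O_A,O_B)\le f(A,B)\|O_A\|\|O_B\|\epsilon(\ell)$. Exponentially decaying: $\epsilon(\ell)\le C_\epsilon e^{-\alpha\ell}$ for some $C_\epsilon,\alpha>0$. *)

theory Defs
  imports "HOL-Analysis.Analysis"
begin

text \<open>Sites of Z^g are integer vectors indexed by a finite type 'g (so g = CARD('g)).
  A basis configuration of a region X assigns to each site of X a value in {0..<D}
  and the value 0 to every site outside X.  An operator on H_X (an element of
  the algebra A_X) is a matrix indexed by configurations of X; only its entries on
  configurations of X are meaningful.\<close>

type_synonym 'g site = "int ^ 'g"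
type_synonym 'g cfg = "'g site \<Rightarrow> nat"
type_synonym 'g op = "'g cfg \<Rightarrow> 'g cfg \<Rightarrow> complex"
type_synonym 'g vect = "'g cfg \<Rightarrow> complex"

definition rv :: "'g::finite site \<Rightarrow> real ^ 'g" where
  "rv x = (\<chi> i. real_of_int (x $ i))"

definition sdiam :: "'g::finite site set \<Rightarrow> real" where
  "sdiam X = diameter (rv ` X)"

definition sdist :: "'g::finite site set \<Rightarrow> 'g site set \<Rightarrow> real" where
  "sdist A B = setdist (rv ` A) (rv ` B)"

definition bdry :: "'g::finite site set \<Rightarrow> 'g site set" where
  "bdry A = {v \<in> A. \<exists>w. w \<notin> A \<and> dist (rv v) (rv w) \<le> 1}"

definition conf :: "nat \<Rightarrow> 'g site set \<Rightarrow> 'g cfg set" where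
  "conf D X = {\<sigma>. (\<forall>v\<in>X. \<sigma> v < D) \<and> (\<forall>v. v \<notin> X \<longrightarrow> \<sigma> v = 0)}"

definition restr :: "'g site set \<Rightarrow> 'g cfg \<Rightarrow> 'g cfg" where
  "restr X \<sigma> = (\<lambda>v. if v \<in> X then \<sigma> v else 0)"

definition canon :: "nat \<Rightarrow> 'g site set \<Rightarrow> 'g op \<Rightarrow> bool" where
  "canon D X A \<longleftrightarrow> (\<forall>\<sigma> \<tau>. \<sigma> \<notin> conf D X \<or> \<tau> \<notin> conf D X \<longrightarrow> A \<sigma> \<tau> = 0)"

definition op_eq :: "nat \<Rightarrow> 'g site set \<Rightarrow> 'g op \<Rightarrow> 'g op \<Rightarrow> bool" where
  "op_eq D X A B \<longleftrightarrow> (\<forall>\<sigma>\<in>conf D X. \<forall>\<tau>\<in>conf D X. A \<sigma> \<tau> = B \<sigma> \<tau>)"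

text \<open>Embedding of A in A_X into A_Y (X \<subseteq> Y) as A tensor identity.\<close>
definition emb :: "nat \<Rightarrow> 'g site set \<Rightarrow> 'g site set \<Rightarrow> 'g op \<Rightarrow> 'g op" where
  "emb D X Y A = (\<lambda>\<sigma> \<tau>. if \<sigma> \<in> conf D Y \<and> \<tau> \<in> conf D Y \<and> restr (Y - X) \<sigma> = restr (Y - X) \<tau>
                        then A (restr X \<sigma>) (restr X \<tau>) else 0)"

definition idop :: "nat \<Rightarrow> 'g site set \<Rightarrow> 'g op" where
  "idop D X = (\<lambda>\<sigma> \<tau>. if \<sigma> \<in> conf D X \<and> \<sigma> = \<tau> then 1 else 0)"

definition opadd :: "nat \<Rightarrow> 'g site set \<Rightarrow> 'g op \<Rightarrow> 'g op \<Rightarrow> 'g op" where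
  "opadd D X A B = (\<lambda>\<sigma> \<tau>. if \<sigma> \<in> conf D X \<and> \<tau> \<in> conf D X then A \<sigma> \<tau> + B \<sigma> \<tau> else 0)"

definition opsub :: "nat \<Rightarrow> 'g site set \<Rightarrow> 'g op \<Rightarrow> 'g op \<Rightarrow> 'g op" where
  "opsub D X A B = (\<lambda>\<sigma> \<tau>. if \<sigma> \<in> conf D X \<and> \<tau> \<in> conf D X then A \<sigma> \<tau> - B \<sigma> \<tau> else 0)"

definition opscale :: "nat \<Rightarrow> 'g site set \<Rightarrow> complex \<Rightarrow> 'g op \<Rightarrow> 'g op" where
  "opscale D X c A = (\<lambda>\<sigma> \<tau>. if \<sigma> \<in> conf D X \<and> \<tau> \<in> conf D X then c * A \<sigma> \<tau> else 0)"

definition opmult :: "nat \<Rightarrow> 'g site set \<Rightarrow> 'g op \<Rightarrow> 'g op \<Rightarrow> 'g op" where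
  "opmult D X A B = (\<lambda>\<sigma> \<tau>. if \<sigma> \<in> conf D X \<and> \<tau> \<in> conf D X
                         then (\<Sum>\<rho>\<in>conf D X. A \<sigma> \<rho> * B \<rho> \<tau>) else 0)"

fun oppow :: "nat \<Rightarrow> 'g site set \<Rightarrow> 'g op \<Rightarrow> nat \<Rightarrow> 'g op" where
  "oppow D X A 0 = idop D X"
| "oppow D X A (Suc n) = opmult D X A (oppow D X A n)"

definition mexp :: "nat \<Rightarrow> 'g site set \<Rightarrow> 'g op \<Rightarrow> 'g op" where
  "mexp D X A = (\<lambda>\<sigma> \<tau>. \<Sum>n. oppow D X A n \<sigma> \<tau> / of_nat (fact n))"

definition selfadj :: "nat \<Rightarrow> 'g site set \<Rightarrow> 'g op \<Rightarrow> bool" where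
  "selfadj D X A \<longleftrightarrow> (\<forall>\<sigma>\<in>conf D X. \<forall>\<tau>\<in>conf D X. A \<sigma> \<tau> = cnj (A \<tau> \<sigma>))"

definition oplog :: "nat \<Rightarrow> 'g site set \<Rightarrow> 'g op \<Rightarrow> 'g op" where
  "oplog D X M = (THE K. canon D X K \<and> selfadj D X K \<and> op_eq D X (mexp D X K) M)"

definition opinv :: "nat \<Rightarrow> 'g site set \<Rightarrow> 'g op \<Rightarrow> 'g op" where
  "opinv D X A = (THE B. canon D X B \<and> op_eq D X (opmult D X A B) (idop D X))"

definition optrace :: "nat \<Rightarrow> 'g site set \<Rightarrow> 'g op \<Rightarrow> complex" where
  "optrace D X A = (\<Sum>\<sigma>\<in>conf D X. A \<sigma> \<sigma>)"

definition ptrace :: "nat \<Rightarrow> 'g site set \<Rightarrow> 'g site set \<Rightarrow> 'g op \<Rightarrow> 'g op" where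
  "ptrace D Lam L A = (\<lambda>\<sigma> \<tau>. if \<sigma> \<in> conf D (Lam \<inter> L) \<and> \<tau> \<in> conf D (Lam \<inter> L)
      then (\<Sum>\<rho>\<in>conf D (Lam - L). A (\<lambda>v. if v \<in> L then \<sigma> v else \<rho> v)
                                       (\<lambda>v. if v \<in> L then \<tau> v else \<rho> v))
      else 0)"

definition vnorm :: "nat \<Rightarrow> 'g site set \<Rightarrow> 'g vect \<Rightarrow> real" where
  "vnorm D X v = sqrt (\<Sum>\<sigma>\<in>conf D X. (cmod (v \<sigma>))\<^sup>2)"

definition opapply :: "nat \<Rightarrow> 'g site set \<Rightarrow> 'g op \<Rightarrow> 'g vect \<Rightarrow> 'g vect" where
  "opapply D X A v = (\<lambda>\<sigma>. \<Sum>\<tau>\<in>conf D X. A \<sigma> \<tau> * v \<tau>)"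

definition opnorm :: "nat \<Rightarrow> 'g site set \<Rightarrow> 'g op \<Rightarrow> real" where
  "opnorm D X A = Sup {vnorm D X (opapply D X A v) | v. vnorm D X v \<le> 1}"

text \<open>A local interaction: Phi X \<in> A_X self-adjoint for every finite X
  (only nonempty X contribute to Hamiltonians).\<close>
definition local_interaction :: "nat \<Rightarrow> ('g site set \<Rightarrow> 'g op) \<Rightarrow> bool" where
  "local_interaction D Phi \<longleftrightarrow> (\<forall>X. finite X \<longrightarrow> selfadj D X (Phi X))"

definition ham :: "nat \<Rightarrow> ('g site set \<Rightarrow> 'g op) \<Rightarrow> 'g site set \<Rightarrow> 'g op" where
  "ham D Phi Lam = (\<lambda>\<sigma> \<tau>. \<Sum>X\<in>{X. X \<subseteq> Lam \<and> X \<noteq> {}}. emb D X Lam (Phi X) \<sigma> \<tau>)"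

definition bexp :: "nat \<Rightarrow> ('g site set \<Rightarrow> 'g op) \<Rightarrow> real \<Rightarrow> 'g site set \<Rightarrow> 'g op" where
  "bexp D Phi \<beta> Lam = mexp D Lam (opscale D Lam (complex_of_real (- \<beta>)) (ham D Phi Lam))"

text \<open>Partition function Z_X = Tr exp(-beta H_X) (equals 1 for X = {}).\<close>
definition Zpart :: "nat \<Rightarrow> ('g site set \<Rightarrow> 'g op) \<Rightarrow> real \<Rightarrow> 'g site set \<Rightarrow> real" where
  "Zpart D Phi \<beta> X = Re (optrace D X (bexp D Phi \<beta> X))"

definition gibbs :: "nat \<Rightarrow> ('g site set \<Rightarrow> 'g op) \<Rightarrow> real \<Rightarrow> 'g site set \<Rightarrow> 'g op" where
  "gibbs D Phi \<beta> Lam = opscale D Lam (complex_of_real (1 / Zpart D Phi \<beta> Lam)) (bexp D Phi \<beta> Lam)"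

definition decay_bound :: "nat \<Rightarrow> ('g::finite site set \<Rightarrow> 'g op) \<Rightarrow> real \<Rightarrow> real \<Rightarrow> real \<Rightarrow> bool" where
  "decay_bound D Phi lam mu Delta \<longleftrightarrow>
     (\<forall>x. (\<lambda>X. opnorm D X (Phi X) * exp (lam * real (card X) + mu * sdiam X))
             summable_on {X. finite X \<and> x \<in> X}
        \<and> (\<Sum>\<^sub>\<infinity>X\<in>{X. finite X \<and> x \<in> X}. opnorm D X (Phi X) * exp (lam * real (card X) + mu * sdiam X)) \<le> Delta)"

definition weak_local_eff_ham ::
  "nat \<Rightarrow> ('g site set \<Rightarrow> 'g op) \<Rightarrow> real \<Rightarrow> ('g site set \<Rightarrow> 'g site set \<Rightarrow> 'g op) \<Rightarrow> bool" where
  "weak_local_eff_ham D Phi \<beta> PhiH \<longleftrightarrow>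
     (\<forall>L. local_interaction D (PhiH L)
        \<and> (\<forall>X. finite X \<longrightarrow> (\<exists>B. op_eq D X (PhiH L X) (emb D (X \<inter> L) X B)))
        \<and> (\<forall>L' X. finite X \<and> X \<inter> L' = X \<inter> L \<longrightarrow> op_eq D X (PhiH L X) (PhiH L' X))
        \<and> (\<forall>Lam. finite Lam \<longrightarrow>
             op_eq D Lam
               (emb D (Lam \<inter> L) Lam
                  (opadd D (Lam \<inter> L)
                    (opscale D (Lam \<inter> L) (complex_of_real (- 1 / \<beta>))
                       (oplog D (Lam \<inter> L) (ptrace D Lam L (bexp D Phi \<beta> Lam))))
                    (opscale D (Lam \<inter> L) (complex_of_real (ln (Zpart D Phi \<beta> (Lam - L)) / \<beta>))
                       (idop D (Lam \<inter> L)))))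
               (\<lambda>\<sigma> \<tau>. \<Sum>X\<in>{X. X \<subseteq> Lam \<and> X \<inter> L \<noteq> {}}. emb D X Lam (PhiH L X) \<sigma> \<tau>)))"

definition cov :: "nat \<Rightarrow> 'g site set \<Rightarrow> 'g op \<Rightarrow> 'g site set \<Rightarrow> 'g op \<Rightarrow> 'g site set \<Rightarrow> 'g op \<Rightarrow> real" where
  "cov D Lam \<rho> A OA B OB =
     cmod (optrace D Lam (opmult D Lam \<rho> (opmult D Lam (emb D A Lam OA) (emb D B Lam OB)))
           - optrace D Lam (opmult D Lam \<rho> (emb D A Lam OA))
             * optrace D Lam (opmult D Lam \<rho> (emb D B Lam OB)))"

definition uniform_clustering ::
  "nat \<Rightarrow> ('g::finite site set \<Rightarrow> 'g op) \<Rightarrow> real \<Rightarrow> (real \<Rightarrow> real) \<Rightarrow> nat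
     \<Rightarrow> ('g site set \<Rightarrow> real) \<Rightarrow> ('g site set \<Rightarrow> 'g site set \<Rightarrow> real) \<Rightarrow> bool" where
  "uniform_clustering D Phi \<beta> \<epsilon> b gf f \<longleftrightarrow>
     (\<forall>A. finite A \<longrightarrow> gf A \<ge> 0)
   \<and> (\<forall>A B. finite A \<and> finite B \<longrightarrow> f A B \<le> gf A * real (card B) ^ b)
   \<and> (\<forall>Lam A B l OA OB. finite Lam \<and> A \<subseteq> Lam \<and> B \<subseteq> Lam \<and> l \<ge> 0 \<and> sdist A B \<ge> l \<longrightarrow>
        cov D Lam (gibbs D Phi \<beta> Lam) A OA B OB
          \<le> f A B * opnorm D A OA * opnorm D B OB * \<epsilon> l)"

definition exp_decaying :: "(real \<Rightarrow> real) \<Rightarrow> bool" where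
  "exp_decaying \<epsilon> \<longleftrightarrow> (\<exists>C \<alpha>. C > 0 \<and> \<alpha> > 0 \<and> (\<forall>l\<ge>0. \<epsilon> l \<le> C * exp (- \<alpha> * l)))"

definition red :: "nat \<Rightarrow> ('g site set \<Rightarrow> 'g op) \<Rightarrow> real \<Rightarrow> 'g site set \<Rightarrow> 'g site set \<Rightarrow> 'g op" where
  "red D Phi \<beta> Lam X = ptrace D Lam X (gibbs D Phi \<beta> Lam)"

end

theory Submission
  imports Defs
begin

text \<open>Write \<open>H L\<close> for the sum of the effective terms meeting \<open>L\<close>, so that the marginal on \<open>L\<close> is a
  positive multiple of \<open>exp (- \<beta> H L)\<close>. By locality of the effective interaction, the terms of
  \<open>W = H (A \<union> C) - H A - H C\<close> all meet both \<open>A\<close> and \<open>C\<close>; a lattice path from \<open>A\<close> to \<open>C\<close> leaves \<open>A\<close>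
  through its boundary, so their total weight is at most a constant times
  \<open>|\<partial>A| exp (- mu dist(A, C) / 2)\<close>. For \<open>\<beta> < lam / (2 Delta)\<close> the imaginary-time evolution
  \<open>exp (- s Z) W exp (s Z)\<close> generated by \<open>Z = H (A \<union> C)\<close> converges and is bounded by a multiple \<open>\<omega>\<close> of this
  weight, hence \<open>U = exp (- \<beta> Z) exp (\<beta> (Z - W))\<close> and its inverse differ from the identity by at most
  \<open>exp (\<beta> \<omega>) - 1\<close>. The operator in question is \<open>\<kappa> U\<close> for a scalar \<open>\<kappa>\<close>, which is the expectation of the
  inverse of \<open>U\<close> in the marginal on \<open>A \<union> C\<close> and therefore equally close to 1.\<close>

section \<open>Estimates in Banach algebras\<close>

lemma le_mult_exp_if_deriv_le:
  fixes \<phi> :: "real \<Rightarrow> real"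
  assumes "b \<ge> 0" "continuous_on {0..b} \<phi>"
    and deriv: "\<And>s. 0 < s \<Longrightarrow> s < b \<Longrightarrow> (\<phi> has_real_derivative \<phi>' s) (at s)"
    and growth: "\<And>s. 0 < s \<Longrightarrow> s < b \<Longrightarrow> \<phi>' s \<le> w * \<phi> s"
  shows "\<phi> b \<le> \<phi> 0 * exp (w * b)"
proof -
  have "\<phi> b * exp (- w * b) \<le> \<phi> 0 * exp (- w * 0)"
  proof (rule DERIV_nonpos_imp_decreasing_open[OF \<open>b \<ge> 0\<close>])
    fix s assume s: "0 < s" "s < b"
    have "((\<lambda>s. \<phi> s * exp (- w * s)) has_real_derivative (\<phi>' s - w * \<phi> s) * exp (- w * s)) (at s)"
      by (rule derivative_eq_intros deriv[OF s] refl)+ (simp add: algebra_simps)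
    moreover have "(\<phi>' s - w * \<phi> s) * exp (- w * s) \<le> 0"
      using growth[OF s] by (simp add: mult_nonpos_nonneg)
    ultimately show "\<exists>y. ((\<lambda>s. \<phi> s * exp (- w * s)) has_real_derivative y) (at s) \<and> y \<le> 0" by blast
  qed (intro continuous_intros assms)
  then show ?thesis by (simp add: exp_minus field_simps)
qed

lemma norm_diff_le_exp_if_norm_deriv_le:
  fixes u :: "real \<Rightarrow> 'a::real_normed_vector"
  assumes "b \<ge> 0"
    and deriv: "\<And>s. 0 \<le> s \<Longrightarrow> s \<le> b \<Longrightarrow> (u has_vector_derivative u' s) (at s)"
    and growth: "\<And>s. 0 \<le> s \<Longrightarrow> s \<le> b \<Longrightarrow> norm (u' s) \<le> w * norm (u s)"
    and "w \<ge> 0"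
  shows "norm (u b - u 0) \<le> norm (u 0) * (exp (w * b) - 1)"
proof -
  define \<phi> where "\<phi> s = norm (u 0) + integral {0..s} (\<lambda>x. w * norm (u x))" for s
  have \<phi>_0: "\<phi> 0 = norm (u 0)" by (simp add: \<phi>_def)
  have cont_u: "continuous_on {0..b} u"
    using deriv by (intro continuous_at_imp_continuous_on ballI)
      (auto dest: has_vector_derivative_continuous)
  have \<phi>_within: "(\<phi> has_real_derivative w * norm (u s)) (at s within {0..b})" if "s \<in> {0..b}" for s
    unfolding \<phi>_def using that cont_u
    by (auto intro!: derivative_eq_intros integral_has_real_derivative continuous_intros)
  then have cont_\<phi>: "continuous_on {0..b} \<phi>"
    by (meson DERIV_continuous_on)
  have \<phi>_deriv: "(\<phi> has_real_derivative w * norm (u s)) (at s)" if "0 < s" "s < b" for s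
    using \<phi>_within[of s] that by (simp add: at_within_Icc_at)
  have increment: "norm (u s - u 0) \<le> \<phi> s - \<phi> 0" if "0 < s" "s \<le> b" for s
  proof (rule differentiable_bound_general[OF that(1)])
    show "continuous_on {0..s} u" "continuous_on {0..s} \<phi>"
      using that cont_u cont_\<phi> by (auto intro: continuous_on_subset)
    show "(\<phi> has_vector_derivative w * norm (u x)) (at x)" if "0 < x" "x < s" for x
      using \<phi>_deriv[of x] that \<open>s \<le> b\<close> by (simp add: has_real_derivative_iff_has_vector_derivative)
    show "(u has_vector_derivative u' x) (at x)" "norm (u' x) \<le> w * norm (u x)" if "0 < x" "x < s" for x
      using deriv[of x] growth[of x] that \<open>s \<le> b\<close> by auto
  qed
  have norm_le: "norm (u s) \<le> \<phi> s" if "0 < s" "s \<le> b" for s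
    using increment[OF that] norm_triangle_ineq2[of "u s" "u 0"] by (simp add: \<phi>_0)
  have "\<phi> b \<le> \<phi> 0 * exp (w * b)"
    using norm_le \<open>w \<ge> 0\<close>
    by (intro le_mult_exp_if_deriv_le[OF \<open>b \<ge> 0\<close> cont_\<phi> \<phi>_deriv] mult_left_mono) auto
  then show ?thesis
    using increment[of b] \<open>b \<ge> 0\<close> by (cases "b = 0") (auto simp: \<phi>_0 algebra_simps)
qed

lemma has_vector_derivative_exp_times_exp:
  fixes X Y :: "'a::{real_normed_algebra_1,banach}"
  shows "((\<lambda>s. exp (s *\<^sub>R X) * exp (s *\<^sub>R Y)) has_vector_derivative
    exp (s *\<^sub>R X) * (X + Y) * exp (s *\<^sub>R Y)) (at s)"
proof -
  have "((\<lambda>s. exp (s *\<^sub>R X) * exp (s *\<^sub>R Y)) has_vector_derivative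
      exp (s *\<^sub>R X) * (Y * exp (s *\<^sub>R Y)) + exp (s *\<^sub>R X) * X * exp (s *\<^sub>R Y)) (at s)"
    by (intro has_vector_derivative_mult exp_scaleR_has_vector_derivative_left
        exp_scaleR_has_vector_derivative_right)
  then show ?thesis by (simp add: algebra_simps)
qed

lemma norm_exp_perturbation:
  fixes Z W :: "'a::{real_normed_algebra_1,banach}"
  assumes "b \<ge> 0" "\<omega> \<ge> 0"
    and conj_le: "\<And>s. 0 \<le> s \<Longrightarrow> s \<le> b \<Longrightarrow> norm (exp (s *\<^sub>R (- Z)) * W * exp (s *\<^sub>R Z)) \<le> \<omega>"
  shows "norm (exp (b *\<^sub>R (- Z)) * exp (b *\<^sub>R (Z - W)) - 1) \<le> exp (\<omega> * b) - 1"
    and "norm (exp (b *\<^sub>R (- (Z - W))) * exp (b *\<^sub>R Z) - 1) \<le> exp (\<omega> * b) - 1"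
proof -
  define a where "a s = exp (s *\<^sub>R (- Z)) * W * exp (s *\<^sub>R Z)" for s
  define u where "u s = exp (s *\<^sub>R (- Z)) * exp (s *\<^sub>R (Z - W))" for s
  define v where "v s = exp (s *\<^sub>R (- (Z - W))) * exp (s *\<^sub>R Z)" for s
  have cancel: "exp (s *\<^sub>R Z) * exp (s *\<^sub>R (- Z)) = 1" for s
    using exp_minus_inverse[of "s *\<^sub>R Z"] by simp
  have "a s * u s = exp (s *\<^sub>R (- Z)) * W * exp (s *\<^sub>R (Z - W))" for s
    unfolding a_def u_def by (metis cancel mult.assoc mult_1)
  then have deriv_u: "(u has_vector_derivative - (a s * u s)) (at s)" for s
    using has_vector_derivative_exp_times_exp[of "- Z" "Z - W" s] by (simp add: u_def[abs_def])
  have "v s * a s = exp (s *\<^sub>R (- (Z - W))) * W * exp (s *\<^sub>R Z)" for s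
    unfolding a_def v_def by (metis cancel mult.assoc mult_1)
  then have deriv_v: "(v has_vector_derivative v s * a s) (at s)" for s
    using has_vector_derivative_exp_times_exp[of "- (Z - W)" Z s] by (simp add: v_def[abs_def])
  have norm_a: "norm (a s) \<le> \<omega>" if "0 \<le> s" "s \<le> b" for s
    using conj_le[OF that] by (simp add: a_def)
  have "norm (u b - u 0) \<le> norm (u 0) * (exp (\<omega> * b) - 1)"
  proof (rule norm_diff_le_exp_if_norm_deriv_le[OF \<open>b \<ge> 0\<close> deriv_u _ \<open>\<omega> \<ge> 0\<close>])
    show "norm (- (a s * u s)) \<le> \<omega> * norm (u s)" if "0 \<le> s" "s \<le> b" for s
      using norm_a[OF that] by (simp add: order_trans[OF norm_mult_ineq] mult_right_mono)
  qed
  then show "norm (exp (b *\<^sub>R (- Z)) * exp (b *\<^sub>R (Z - W)) - 1) \<le> exp (\<omega> * b) - 1"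
    by (simp add: u_def)
  have "norm (v b - v 0) \<le> norm (v 0) * (exp (\<omega> * b) - 1)"
  proof (rule norm_diff_le_exp_if_norm_deriv_le[OF \<open>b \<ge> 0\<close> deriv_v _ \<open>\<omega> \<ge> 0\<close>])
    show "norm (v s * a s) \<le> \<omega> * norm (v s)" if "0 \<le> s" "s \<le> b" for s
      using norm_a[OF that]
      by (simp add: order_trans[OF norm_mult_ineq] mult_left_mono mult.commute[of \<omega>])
  qed
  then show "norm (exp (b *\<^sub>R (- (Z - W))) * exp (b *\<^sub>R Z) - 1) \<le> exp (\<omega> * b) - 1"
    by (simp add: v_def)
qed

definition exp_term :: "'a::real_normed_algebra_1 \<Rightarrow> nat \<Rightarrow> 'a" where
  "exp_term x n = x ^ n /\<^sub>R fact n"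

lemma exp_term_0 [simp]: "exp_term x 0 = 1"
  by (simp add: exp_term_def)

lemma times_exp_term: "x * exp_term x n = real (Suc n) *\<^sub>R exp_term x (Suc n)"
  by (simp add: exp_term_def del: mult_Suc of_nat_Suc)

lemma exp_term_times: "exp_term x n * x = real (Suc n) *\<^sub>R exp_term x (Suc n)"
  using times_exp_term[of x n] by (simp add: exp_term_def power_commutes)

primrec adpow :: "'a::ring \<Rightarrow> nat \<Rightarrow> 'a \<Rightarrow> 'a" where
  "adpow Z 0 W = W"
| "adpow Z (Suc n) W = Z * adpow Z n W - adpow Z n W * Z"

lemma adpow_Suc_right: "adpow Z (Suc n) W = adpow Z n (Z * W - W * Z)"
  by (induction n) simp_all

lemma adpow_sum: "adpow Z n (\<Sum>i\<in>I. W i) = (\<Sum>i\<in>I. adpow Z n (W i))"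
  by (induction n) (simp_all add: sum_distrib_left sum_distrib_right sum_subtractf)

lemma adpow_scaleR: "adpow (s *\<^sub>R Z) n W = s ^ n *\<^sub>R adpow Z n W"
  for Z W :: "'a::real_algebra"
  by (induction n) (simp_all add: scaleR_diff_right)

lemma adpow_eq_convolution:
  fixes Z W :: "'a::real_normed_algebra_1"
  shows "adpow Z n W /\<^sub>R fact n = (\<Sum>i\<le>n. exp_term Z i * W * exp_term (- Z) (n - i))"
proof (induction n)
  case 0
  then show ?case by simp
next
  case (Suc n)
  define T where "T i = exp_term Z i * W * exp_term (- Z) (Suc n - i)" for i
  have "real (Suc n) *\<^sub>R (adpow Z (Suc n) W /\<^sub>R fact (Suc n))
      = Z * (adpow Z n W /\<^sub>R fact n) + adpow Z n W /\<^sub>R fact n * (- Z)"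
    by (simp add: scaleR_diff_right del: of_nat_Suc flip: mult.assoc)
  also have "\<dots> = (\<Sum>i\<le>n. (Z * exp_term Z i) * W * exp_term (- Z) (n - i))
      + (\<Sum>i\<le>n. exp_term Z i * W * (exp_term (- Z) (n - i) * (- Z)))"
    unfolding Suc.IH sum_distrib_left sum_distrib_right by (simp only: mult.assoc)
  also have "\<dots> = (\<Sum>i\<le>n. real (Suc i) *\<^sub>R T (Suc i)) + (\<Sum>i\<le>n. real (Suc n - i) *\<^sub>R T i)"
    unfolding times_exp_term exp_term_times by (simp add: T_def Suc_diff_le)
  also have "(\<Sum>i\<le>n. real (Suc i) *\<^sub>R T (Suc i)) = (\<Sum>i\<le>Suc n. real i *\<^sub>R T i)"
    by (subst sum.atMost_Suc_shift) simp
  also have "(\<Sum>i\<le>n. real (Suc n - i) *\<^sub>R T i) = (\<Sum>i\<le>Suc n. real (Suc n - i) *\<^sub>R T i)"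
    by simp
  also have "(\<Sum>i\<le>Suc n. real i *\<^sub>R T i) + (\<Sum>i\<le>Suc n. real (Suc n - i) *\<^sub>R T i)
      = real (Suc n) *\<^sub>R (\<Sum>i\<le>Suc n. T i)"
    by (simp only: scaleR_right.sum) (simp flip: sum.distrib scaleR_add_left of_nat_add)
  finally show ?case
    by (simp only: scaleR_cancel_left of_nat_eq_0_iff nat.simps simp_thms T_def)
qed

lemma exp_conjugation_sums_adpow:
  fixes Z W :: "'a::{real_normed_algebra_1,banach}"
  shows "(\<lambda>n. adpow Z n W /\<^sub>R fact n) sums (exp Z * W * exp (- Z))"
proof -
  have summable_W: "summable (\<lambda>k. norm (exp_term Z k * W))"
  proof (rule summable_comparison_test')
    show "summable (\<lambda>k. norm (exp_term Z k) * norm W)"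
      unfolding exp_term_def by (intro summable_mult2 summable_norm_exp)
    show "norm (norm (exp_term Z k * W)) \<le> norm (exp_term Z k) * norm W" for k
      by (simp add: norm_mult_ineq)
  qed
  have "(\<lambda>n. \<Sum>i\<le>n. exp_term Z i * W * exp_term (- Z) (n - i))
      sums ((\<Sum>k. exp_term Z k * W) * (\<Sum>k. exp_term (- Z) k))"
    by (rule Cauchy_product_sums[OF summable_W]) (unfold exp_term_def, rule summable_norm_exp)
  moreover have "(\<Sum>k. exp_term Z k * W) = exp Z * W"
    unfolding exp_term_def exp_def by (rule suminf_mult2[symmetric]) (rule summable_exp_generic)
  ultimately show ?thesis by (simp add: adpow_eq_convolution exp_def exp_term_def)
qed

lemma power_self_le_fact_exp: "real n ^ n \<le> fact n * exp (real n)"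
proof -
  have "real n ^ n / fact n \<le> exp (real n)"
    using sum_le_suminf[OF summable_exp[of "real n"], of "{n}"]
    by (simp add: exp_def divide_inverse mult.commute)
  then show ?thesis by (simp add: field_simps)
qed

lemma le_exp_mult_divide:
  fixes d x :: real
  assumes "d > 0"
  shows "x \<le> exp (d * x) / (exp 1 * d)"
proof -
  have "d * x \<le> exp (d * x - 1)"
    using exp_ge_add_one_self[of "d * x - 1"] by simp
  then show ?thesis using assms by (simp add: exp_diff field_simps)
qed

lemma sum_meeting_le:
  fixes F :: "'v set \<Rightarrow> real"
  assumes "finite I" "finite S" "\<And>Y. Y \<in> I \<Longrightarrow> F Y \<ge> 0"
  shows "(\<Sum>Y\<in>{Y\<in>I. Y \<inter> S \<noteq> {}}. F Y) \<le> (\<Sum>x\<in>S. \<Sum>Y\<in>{Y\<in>I. x \<in> Y}. F Y)"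
proof -
  have "(\<Sum>Y\<in>{Y\<in>I. Y \<inter> S \<noteq> {}}. F Y) \<le> (\<Sum>Y\<in>{Y\<in>I. Y \<inter> S \<noteq> {}}. \<Sum>x\<in>{x\<in>S. x \<in> Y}. F Y)"
  proof (rule sum_mono)
    fix Y assume Y: "Y \<in> {Y\<in>I. Y \<inter> S \<noteq> {}}"
    then obtain x where "x \<in> {x\<in>S. x \<in> Y}" by auto
    then show "F Y \<le> (\<Sum>x\<in>{x\<in>S. x \<in> Y}. F Y)"
      using assms Y by (intro member_le_sum[of x]) auto
  qed
  also have "\<dots> \<le> (\<Sum>Y\<in>I. \<Sum>x\<in>{x\<in>S. x \<in> Y}. F Y)"
    using assms by (intro sum_mono2) (auto intro: sum_nonneg)
  also have "\<dots> = (\<Sum>x\<in>S. \<Sum>Y\<in>{Y\<in>I. x \<in> Y}. F Y)"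
    using assms by (intro sum.swap_restrict)
  finally show ?thesis .
qed

lemma norm_commutator_le:
  fixes x y :: "'a::real_normed_algebra"
  shows "norm (x * y - y * x) \<le> 2 * norm x * norm y"
  using norm_triangle_ineq4[of "x * y" "y * x"] norm_mult_ineq[of x y] norm_mult_ineq[of y x]
  by (simp add: mult.commute[of "norm y"])

lemma exp_card_Un_le:
  fixes c lam :: real
  assumes "0 \<le> c" "c \<le> lam"
  shows "exp (c * card (S \<union> Y)) \<le> exp (c * card S) * exp (lam * card Y)"
proof -
  have "c * card (S \<union> Y) \<le> c * (real (card S) + real (card Y))"
    using assms card_Un_le[of S Y] by (intro mult_left_mono) auto
  also have "\<dots> \<le> c * card S + lam * card Y"
    using assms by (simp add: distrib_left mult_right_mono)
  finally show ?thesis by (simp flip: exp_add)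
qed

locale local_hamiltonian =
  fixes I :: "'v set set" and h :: "'v set \<Rightarrow> 'a::{real_normed_algebra_1,banach}"
    and lam Delta :: real
  assumes finite_I: "finite I" and finite_mem: "\<And>Y. Y \<in> I \<Longrightarrow> finite Y"
    and commute: "\<And>X Y. X \<in> I \<Longrightarrow> Y \<in> I \<Longrightarrow> X \<inter> Y = {} \<Longrightarrow> h X * h Y = h Y * h X"
    and lam_pos: "lam > 0" and Delta_pos: "Delta > 0"
    and decay: "\<And>x. (\<Sum>Y\<in>{Y\<in>I. x \<in> Y}. norm (h Y) * exp (lam * card Y)) \<le> Delta"
begin

definition supported :: "'v set \<Rightarrow> 'a \<Rightarrow> bool" where
  "supported S W \<longleftrightarrow> (\<forall>Y\<in>I. Y \<inter> S = {} \<longrightarrow> h Y * W = W * h Y)"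

lemma supported_commutator:
  assumes "supported S W" "Y \<in> I"
  shows "supported (S \<union> Y) (h Y * W - W * h Y)"
  unfolding supported_def
proof (intro ballI impI)
  fix X assume X: "X \<in> I" "X \<inter> (S \<union> Y) = {}"
  then have XW: "h X * W = W * h X" using assms by (auto simp: supported_def)
  have XY: "h X * h Y = h Y * h X" using commute[of X Y] X assms by blast
  have "h X * (h Y * W) = h Y * W * h X" "h X * (W * h Y) = W * h Y * h X"
    by (metis XW XY mult.assoc)+
  then show "h X * (h Y * W - W * h Y) = (h Y * W - W * h Y) * h X"
    by (simp add: algebra_simps)
qed

lemma commutator_eq_sum_meeting:
  assumes "supported S W"
  shows "(\<Sum>Y\<in>I. h Y) * W - W * (\<Sum>Y\<in>I. h Y) = (\<Sum>Y\<in>{Y\<in>I. Y \<inter> S \<noteq> {}}. h Y * W - W * h Y)"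
proof -
  have "(\<Sum>Y\<in>I. h Y) * W - W * (\<Sum>Y\<in>I. h Y) = (\<Sum>Y\<in>I. h Y * W - W * h Y)"
    by (simp add: sum_distrib_left sum_distrib_right sum_subtractf)
  also have "\<dots> = (\<Sum>Y\<in>{Y\<in>I. Y \<inter> S \<noteq> {}}. h Y * W - W * h Y)"
    by (rule sum.mono_neutral_right) (use finite_I assms in \<open>auto simp: supported_def\<close>)
  finally show ?thesis .
qed

lemma sum_meeting_le_card:
  assumes "finite S"
  shows "(\<Sum>Y\<in>{Y\<in>I. Y \<inter> S \<noteq> {}}. norm (h Y) * exp (lam * card Y)) \<le> card S * Delta"
proof -
  have "(\<Sum>Y\<in>{Y\<in>I. Y \<inter> S \<noteq> {}}. norm (h Y) * exp (lam * card Y))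
      \<le> (\<Sum>x\<in>S. \<Sum>Y\<in>{Y\<in>I. x \<in> Y}. norm (h Y) * exp (lam * card Y))"
    using finite_I assms by (intro sum_meeting_le) auto
  also have "\<dots> \<le> card S * Delta" using decay by (rule sum_bounded_above)
  finally show ?thesis .
qed

text \<open>Each commutator enlarges the support by some \<open>Y\<close> and costs a factor \<open>2 |S| Delta\<close>; trading
  \<open>|S|\<close> for \<open>exp (d |S|) / (e d)\<close> makes the recursion close as long as \<open>n d \<le> lam\<close>.\<close>

lemma norm_adpow_le_power_exp:
  assumes "d > 0" "real n * d \<le> lam" "finite S" "supported S W"
  shows "norm (adpow (\<Sum>Y\<in>I. h Y) n W)
    \<le> norm W * (2 * Delta / (exp 1 * d)) ^ n * exp (real n * d * card S)"
  using assms(2-)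
proof (induction n arbitrary: S W)
  case 0
  then show ?case by simp
next
  case (Suc n)
  define J where "J = {Y\<in>I. Y \<inter> S \<noteq> {}}"
  define q where "q = 2 * Delta / (exp 1 * d)"
  define c where "c = 2 * norm W * q ^ n * exp (real n * d * card S)"
  have "q \<ge> 0" using Delta_pos assms(1) by (simp add: q_def)
  then have "c \<ge> 0" by (simp add: c_def)
  have nd: "real n * d \<le> lam"
    using Suc.prems(1) assms(1) by (simp add: algebra_simps)
  have term_le: "norm (adpow (\<Sum>Y\<in>I. h Y) n (h Y * W - W * h Y)) \<le> c * (norm (h Y) * exp (lam * card Y))"
    if "Y \<in> J" for Y
  proof -
    have Y: "Y \<in> I" using that by (simp add: J_def)
    have "norm (adpow (\<Sum>Y\<in>I. h Y) n (h Y * W - W * h Y))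
      \<le> norm (h Y * W - W * h Y) * q ^ n * exp (real n * d * card (S \<union> Y))"
      unfolding q_def using Suc.prems finite_mem[OF Y] Y nd
      by (intro Suc.IH supported_commutator) auto
    also have "\<dots> \<le> (2 * norm (h Y) * norm W) * q ^ n * (exp (real n * d * card S) * exp (lam * card Y))"
      using nd assms(1) \<open>q \<ge> 0\<close> by (intro mult_mono norm_commutator_le exp_card_Un_le) auto
    finally show ?thesis by (simp add: c_def mult_ac)
  qed
  have "adpow (\<Sum>Y\<in>I. h Y) (Suc n) W = (\<Sum>Y\<in>J. adpow (\<Sum>Y\<in>I. h Y) n (h Y * W - W * h Y))"
    by (simp only: adpow_Suc_right commutator_eq_sum_meeting[OF Suc.prems(3)] adpow_sum J_def)
  then have "norm (adpow (\<Sum>Y\<in>I. h Y) (Suc n) W) \<le> c * (\<Sum>Y\<in>J. norm (h Y) * exp (lam * card Y))"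
    using term_le by (simp add: sum_norm_le sum_distrib_left)
  also have "\<dots> \<le> c * (exp (d * card S) / (exp 1 * d) * Delta)"
    using sum_meeting_le_card[OF Suc.prems(2)] le_exp_mult_divide[OF assms(1), of "card S"] Delta_pos
    unfolding J_def by (intro mult_left_mono[OF _ \<open>c \<ge> 0\<close>])
      (meson mult_right_mono less_imp_le order_trans)
  also have "\<dots> = norm W * q ^ Suc n * (exp (real n * d * card S) * exp (d * card S))"
    by (simp add: c_def q_def)
  also have "exp (real n * d * card S) * exp (d * card S) = exp (real (Suc n) * d * card S)"
    by (simp add: algebra_simps flip: exp_add)
  finally show ?case by (simp add: q_def)
qed

lemma norm_adpow_le:
  assumes "finite S" "supported S W"
  shows "norm (adpow (\<Sum>Y\<in>I. h Y) n W) \<le> norm W * exp (lam * card S) * (fact n * (2 * Delta / lam) ^ n)"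
proof (cases "n = 0")
  case True
  then show ?thesis using lam_pos by (simp add: mult_le_cancel_left1)
next
  case False
  define d where "d = lam / n"
  have d: "d > 0" "real n * d = lam" using False lam_pos by (auto simp: d_def)
  have "norm (adpow (\<Sum>Y\<in>I. h Y) n W) \<le> norm W * (2 * Delta / (exp 1 * d)) ^ n * exp (lam * card S)"
    using norm_adpow_le_power_exp[OF d(1) _ assms, of n] d by simp
  also have "(2 * Delta / (exp 1 * d)) ^ n = real n ^ n / exp (real n) * (2 * Delta / lam) ^ n"
    using False lam_pos
    by (simp add: d_def power_divide power_mult_distrib exp_of_nat_mult[of n 1, simplified] field_simps)
  also have "norm W * (real n ^ n / exp (real n) * (2 * Delta / lam) ^ n) * exp (lam * card S)
    \<le> norm W * (fact n * (2 * Delta / lam) ^ n) * exp (lam * card S)"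
    using power_self_le_fact_exp[of n] Delta_pos lam_pos
    by (intro mult_right_mono mult_left_mono) (auto simp: field_simps)
  finally show ?thesis by (simp add: mult_ac)
qed

lemma norm_exp_conjugation_le:
  assumes "finite S" "supported S W" "\<bar>s\<bar> \<le> b" "2 * Delta * b < lam"
  shows "norm (exp (s *\<^sub>R (\<Sum>Y\<in>I. h Y)) * W * exp (- (s *\<^sub>R (\<Sum>Y\<in>I. h Y))))
    \<le> norm W * exp (lam * card S) / (1 - 2 * Delta * b / lam)"
proof -
  define Z where "Z = (\<Sum>Y\<in>I. h Y)"
  define c where "c = norm W * exp (lam * card S)"
  define r where "r = 2 * Delta * b / lam"
  have r: "0 \<le> r" "r < 1"
    using assms Delta_pos lam_pos by (auto simp: r_def)
  have term_le: "norm (adpow (s *\<^sub>R Z) n W /\<^sub>R fact n) \<le> c * r ^ n" for n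
  proof -
    have "norm (adpow (s *\<^sub>R Z) n W /\<^sub>R fact n) = \<bar>s\<bar> ^ n * norm (adpow Z n W) / fact n"
      by (simp add: adpow_scaleR power_abs field_simps)
    also have "\<dots> \<le> b ^ n * (c * (fact n * (2 * Delta / lam) ^ n)) / fact n"
      using norm_adpow_le[OF assms(1,2), of n] assms(3) lam_pos Delta_pos
      by (intro divide_right_mono mult_mono power_mono) (auto simp: Z_def c_def)
    also have "\<dots> = c * r ^ n"
      by (simp add: r_def power_divide power_mult_distrib)
    finally show ?thesis .
  qed
  have "(\<lambda>n. c * r ^ n) sums (c * (1 / (1 - r)))"
    using r by (intro sums_mult geometric_sums) auto
  then have "norm (\<Sum>n. adpow (s *\<^sub>R Z) n W /\<^sub>R fact n) \<le> c / (1 - r)"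
    using norm_suminf_le[of "\<lambda>n. adpow (s *\<^sub>R Z) n W /\<^sub>R fact n", OF term_le] by (simp add: sums_iff)
  then show ?thesis
    using exp_conjugation_sums_adpow[of "s *\<^sub>R Z" W] by (simp add: sums_iff Z_def c_def r_def)
qed

lemma norm_exp_local_perturbation:
  assumes "finite J" "\<And>X. X \<in> J \<Longrightarrow> finite X" "\<And>X. X \<in> J \<Longrightarrow> supported X (w X)"
    and b: "0 \<le> b" "2 * Delta * b < lam"
    and omega: "(\<Sum>X\<in>J. norm (w X) * exp (lam * card X)) / (1 - 2 * Delta * b / lam) \<le> \<omega>"
  defines "Z \<equiv> (\<Sum>Y\<in>I. h Y)" and "W \<equiv> (\<Sum>X\<in>J. w X)"
  shows "norm (exp (b *\<^sub>R (- Z)) * exp (b *\<^sub>R (Z - W)) - 1) \<le> exp (\<omega> * b) - 1"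
    and "norm (exp (b *\<^sub>R (- (Z - W))) * exp (b *\<^sub>R Z) - 1) \<le> exp (\<omega> * b) - 1"
proof -
  have "1 - 2 * Delta * b / lam > 0" using b lam_pos by simp
  then have "0 \<le> (\<Sum>X\<in>J. norm (w X) * exp (lam * card X)) / (1 - 2 * Delta * b / lam)"
    by (intro divide_nonneg_pos sum_nonneg) auto
  then have "\<omega> \<ge> 0" using omega by linarith
  moreover have "norm (exp (s *\<^sub>R (- Z)) * W * exp (s *\<^sub>R Z)) \<le> \<omega>" if "0 \<le> s" "s \<le> b" for s
  proof -
    have "exp (s *\<^sub>R (- Z)) * W * exp (s *\<^sub>R Z)
      = (\<Sum>X\<in>J. exp ((- s) *\<^sub>R Z) * w X * exp (- ((- s) *\<^sub>R Z)))"
      by (simp add: W_def sum_distrib_left sum_distrib_right)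
    also have "norm \<dots> \<le> (\<Sum>X\<in>J. norm (w X) * exp (lam * card X) / (1 - 2 * Delta * b / lam))"
      unfolding Z_def using that assms(1-3) b by (intro sum_norm_le norm_exp_conjugation_le) auto
    also have "\<dots> \<le> \<omega>" using omega by (simp add: sum_divide_distrib)
    finally show ?thesis .
  qed
  ultimately show "norm (exp (b *\<^sub>R (- Z)) * exp (b *\<^sub>R (Z - W)) - 1) \<le> exp (\<omega> * b) - 1"
    and "norm (exp (b *\<^sub>R (- (Z - W))) * exp (b *\<^sub>R Z) - 1) \<le> exp (\<omega> * b) - 1"
    using norm_exp_perturbation[OF b(1), of \<omega> Z W] by blast+
qed

end

lemma norm_exp_minus_id_le:
  fixes x :: "'a::{real_normed_algebra_1,banach}"
  shows "norm (exp x - 1 - x) \<le> (norm x)\<^sup>2 * exp (norm x)"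
proof -
  have term_le: "norm (inverse (fact (n + 2)) *\<^sub>R x ^ (n + 2))
      \<le> (norm x)\<^sup>2 * (norm x ^ n /\<^sub>R fact n)" for n
  proof -
    have "norm (inverse (fact (n + 2)) *\<^sub>R x ^ (n + 2)) \<le> norm x ^ (n + 2) / fact (n + 2)"
      using norm_power_ineq[of x "n + 2"] by (simp add: divide_inverse mult.commute mult_left_mono)
    also have "\<dots> \<le> norm x ^ (n + 2) / fact n"
      by (intro divide_left_mono fact_mono) auto
    finally show ?thesis by (simp add: power2_eq_square divide_inverse mult_ac)
  qed
  have dominating: "(\<lambda>n. (norm x)\<^sup>2 * (norm x ^ n /\<^sub>R fact n)) sums ((norm x)\<^sup>2 * exp (norm x))"
    by (intro sums_mult exp_converges)
  have "exp x - 1 - x = (\<Sum>n. inverse (fact (n + 2)) *\<^sub>R x ^ (n + 2))"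
    by (subst exp_first_two_terms) (simp only: add_diff_cancel_left' add.assoc)
  also have "norm \<dots> \<le> (\<Sum>n. (norm x)\<^sup>2 * (norm x ^ n /\<^sub>R fact n))"
    by (rule norm_suminf_le[OF term_le sums_summable[OF dominating]])
  also have "\<dots> = (norm x)\<^sup>2 * exp (norm x)"
    by (rule sums_unique[OF dominating, symmetric])
  finally show ?thesis .
qed

lemma exp_has_derivative_at_0:
  "((exp :: 'a::{real_normed_algebra_1,banach} \<Rightarrow> 'a) has_derivative (\<lambda>x. x)) (at 0)"
proof (rule has_derivativeI_sandwich[of 1])
  fix y :: 'a assume y: "y \<noteq> 0" "dist y 0 < 1"
  have "norm (exp y - 1 - y) \<le> (norm y)\<^sup>2 * exp (norm y)" by (rule norm_exp_minus_id_le)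
  also have "\<dots> \<le> (norm y)\<^sup>2 * exp 1" using y by (intro mult_left_mono) auto
  finally show "norm ((exp y - exp 0) - (y - 0)) / norm (y - 0) \<le> norm y * exp 1"
    using y by (simp add: power2_eq_square field_simps)
next
  have "((\<lambda>y::'a. norm y * exp 1) \<longlongrightarrow> norm (0::'a) * exp 1) (at 0)"
    by (intro tendsto_intros)
  then show "((\<lambda>y::'a. norm y * exp 1) \<longlongrightarrow> 0) (at 0)" by simp
qed auto

lemma has_vector_derivative_exp_commuting:
  fixes l :: "real \<Rightarrow> 'a::{real_normed_algebra_1,banach}"
  assumes "\<And>t. t \<in> S \<Longrightarrow> l t * l s = l s * l t" and "(l has_vector_derivative l') (at s within S)"
    and "s \<in> S"
  shows "((\<lambda>t. exp (l t)) has_vector_derivative exp (l s) * l') (at s within S)"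
proof -
  have "((\<lambda>t. l t - l s) has_derivative (\<lambda>t. t *\<^sub>R l')) (at s within S)"
    using assms(2) by (auto simp: has_vector_derivative_def intro!: derivative_eq_intros)
  from has_derivative_compose[OF this, of exp "\<lambda>x. x"] exp_has_derivative_at_0
  have "((\<lambda>t. exp (l t - l s)) has_derivative (\<lambda>t. t *\<^sub>R l')) (at s within S)" by simp
  then have "((\<lambda>t. exp (l s) * exp (l t - l s)) has_vector_derivative exp (l s) * l') (at s within S)"
    by (intro has_vector_derivative_mult_right) (simp add: has_vector_derivative_def)
  moreover have "exp (l t) = exp (l s) * exp (l t - l s)" if "t \<in> S" for t
    using assms(1)[OF that]
    by (subst exp_add_commuting[symmetric]) (auto simp: algebra_simps)
  ultimately show ?thesis
    by (rule has_vector_derivative_transform[OF assms(3), rotated])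
qed

lemma exp_add_scaleR_one:
  fixes x :: "'a::{real_normed_algebra_1,banach}"
  shows "exp (x + c *\<^sub>R 1) = exp c *\<^sub>R exp x"
proof -
  have "exp (x + c *\<^sub>R 1) = exp x * exp (c *\<^sub>R 1)"
    by (rule exp_add_commuting) simp
  also have "exp (c *\<^sub>R (1 :: 'a)) = exp c *\<^sub>R 1"
    using exp_of_real[of c, where 'a = 'a] by (simp add: of_real_def)
  finally show ?thesis by simp
qed

definition log_series :: "'a::{real_normed_algebra_1,banach} \<Rightarrow> 'a" where
  "log_series R = (\<Sum>n. R ^ Suc n /\<^sub>R real (Suc n))"

lemma log_series_sums:
  fixes R :: "'a::{real_normed_algebra_1,banach}"
  assumes "norm R < 1"
  shows "(\<lambda>n. R ^ Suc n /\<^sub>R real (Suc n)) sums log_series R"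
proof -
  have "summable (\<lambda>n. R ^ Suc n /\<^sub>R real (Suc n))"
  proof (rule summable_comparison_test')
    show "summable (\<lambda>n. norm R ^ Suc n)"
      using assms by (simp add: summable_mult summable_geometric)
    show "norm (R ^ Suc n /\<^sub>R real (Suc n)) \<le> norm R ^ Suc n" for n
    proof -
      have "norm (R ^ Suc n /\<^sub>R real (Suc n)) \<le> norm (R ^ Suc n)"
        by (simp add: field_simps del: power_Suc)
      then show ?thesis using norm_power_ineq[of R "Suc n"] by (rule order_trans)
    qed
  qed
  then show ?thesis unfolding log_series_def by (rule summable_sums)
qed

lemma log_series_commutes:
  fixes R X :: "'a::{real_normed_algebra_1,banach}"
  assumes "norm R < 1" "R * X = X * R"
  shows "log_series R * X = X * log_series R"
proof -
  have "(R ^ Suc n /\<^sub>R real (Suc n)) * X = X * (R ^ Suc n /\<^sub>R real (Suc n))" for n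
    using power_commuting_commutes[OF assms(2), of "Suc n"] by (simp del: power_Suc of_nat_Suc)
  then have "(\<lambda>n. R ^ Suc n /\<^sub>R real (Suc n) * X) sums (X * log_series R)"
    using sums_mult[OF log_series_sums[OF assms(1)], of X] by simp
  then show ?thesis
    using sums_mult2[OF log_series_sums[OF assms(1)], of X] sums_unique2 by blast
qed

lemma has_vector_derivative_series_M_test:
  fixes f :: "nat \<Rightarrow> real \<Rightarrow> 'a::banach"
  assumes "convex S" "s\<^sub>0 \<in> S" "(\<lambda>n. f n s\<^sub>0) sums l"
    and deriv: "\<And>n s. s \<in> S \<Longrightarrow> (f n has_vector_derivative f' n s) (at s within S)"
    and "\<And>n s. s \<in> S \<Longrightarrow> norm (f' n s) \<le> M n" "summable M"
  shows "\<exists>g. \<forall>s\<in>S. (\<lambda>n. f n s) sums g s \<and> (g has_vector_derivative (\<Sum>n. f' n s)) (at s within S)"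
proof -
  have uniform: "uniform_limit S (\<lambda>n s. \<Sum>i<n. f' i s) (\<lambda>s. \<Sum>n. f' n s) sequentially"
    by (rule Weierstrass_m_test) (use assms in auto)
  show ?thesis
    unfolding has_vector_derivative_def
  proof (rule has_derivative_series)
    show "(f n has_derivative (\<lambda>h. h *\<^sub>R f' n s)) (at s within S)" if "s \<in> S" for n s
      using deriv[OF that] by (simp add: has_vector_derivative_def)
    show "\<forall>\<^sub>F n in sequentially. \<forall>s\<in>S. \<forall>h.
        norm ((\<Sum>i<n. h *\<^sub>R f' i s) - h *\<^sub>R (\<Sum>n. f' n s)) \<le> e * norm h" if "e > 0" for e
      by (rule eventually_mono[OF uniform_limitD[OF uniform that]])
        (auto simp: dist_norm mult.commute[of e] simp flip: scaleR_right.sum scaleR_diff_right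
          intro!: mult_left_mono intro: order_less_imp_le)
  qed (rule assms)+
qed

lemma norm_scaleR_le_norm:
  fixes x :: "'a::real_normed_vector"
  assumes "s \<in> {0..1}"
  shows "norm (s *\<^sub>R x) \<le> norm x"
  using assms by (simp add: mult_left_le_one_le)

lemma has_vector_derivative_log_series:
  fixes R :: "'a::{real_normed_algebra_1,banach}"
  assumes R: "norm R < 1" and s: "s \<in> {0..1}"
  shows "((\<lambda>s. log_series (s *\<^sub>R R)) has_vector_derivative
    R * (\<Sum>n. (s *\<^sub>R R) ^ n)) (at s within {0..1})"
proof -
  define f where "f n s = (s ^ Suc n / real (Suc n)) *\<^sub>R R ^ Suc n" for n s
  define f' where "f' n s = R * (s *\<^sub>R R) ^ n" for n s
  have norm_f': "norm (f' n s) \<le> norm R * norm R ^ n" if "s \<in> {0..1}" for n s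
  proof -
    have "norm ((s *\<^sub>R R) ^ n) \<le> norm R ^ n"
      using norm_scaleR_le_norm[OF that] by (meson norm_ge_zero norm_power_ineq order_trans power_mono)
    then show ?thesis
      unfolding f'_def by (intro order_trans[OF norm_mult_ineq] mult_left_mono) auto
  qed
  have "\<exists>g. \<forall>s\<in>{0..1}. (\<lambda>n. f n s) sums g s \<and>
      (g has_vector_derivative (\<Sum>n. f' n s)) (at s within {0..1})"
  proof (rule has_vector_derivative_series_M_test[OF _ _ _ _ norm_f'])
    show "(f n has_vector_derivative f' n s) (at s within {0..1})" for n s
      unfolding f_def f'_def has_vector_derivative_def
      by (rule derivative_eq_intros refl | simp add: field_simps del: of_nat_Suc)+
    show "(\<lambda>n. f n 0) sums 0" by (simp add: f_def)
  qed (use R in \<open>auto intro: summable_mult summable_geometric\<close>)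
  then obtain g where g: "(\<lambda>n. f n s) sums g s"
    "(g has_vector_derivative (\<Sum>n. f' n s)) (at s within {0..1})" if "s \<in> {0..1}" for s
    by blast
  have norm_s: "norm (s *\<^sub>R R) < 1" if "s \<in> {0..1}" for s
    using norm_scaleR_le_norm[OF that] R by (rule order.strict_trans1)
  have "log_series (s *\<^sub>R R) = g s" if "s \<in> {0..1}" for s
  proof (rule sums_unique2[OF _ g(1)[OF that]])
    show "(\<lambda>n. f n s) sums log_series (s *\<^sub>R R)"
      using log_series_sums[OF norm_s[OF that]]
      by (simp only: f_def scaleR_power scaleR_scaleR divide_inverse mult.commute)
  qed
  then have "((\<lambda>s. log_series (s *\<^sub>R R)) has_vector_derivative (\<Sum>n. f' n s)) (at s within {0..1})"
    by (rule has_vector_derivative_transform[OF s _ g(2)[OF s]])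
  also have "(\<Sum>n. f' n s) = R * (\<Sum>n. (s *\<^sub>R R) ^ n)"
    unfolding f'_def by (rule suminf_mult[OF complete_algebra_summable_geometric[OF norm_s[OF s]]])
  finally show ?thesis .
qed

lemma suminf_geometric_mult:
  fixes x :: "'a::{real_normed_algebra_1,banach}"
  assumes "norm x < 1"
  shows "(\<Sum>n. x ^ n) * (1 - x) = 1"
proof -
  note summable = complete_algebra_summable_geometric[OF assms]
  have "(\<Sum>n. x ^ n) * x = (\<Sum>n. x ^ Suc n)"
    using suminf_mult2[OF summable, of x] by (simp add: power_commutes)
  also have "\<dots> = (\<Sum>n. x ^ n) - 1"
    using suminf_split_head[OF summable] by simp
  finally show ?thesis by (simp add: algebra_simps)
qed

lemma exp_log_series:
  fixes R :: "'a::{real_normed_algebra_1,banach}"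
  assumes R: "norm R < 1"
  shows "exp (- log_series R) = 1 - R"
proof -
  define l where "l s = log_series (s *\<^sub>R R)" for s
  have norm_s: "norm (s *\<^sub>R R) < 1" if "s \<in> {0..1}" for s
    using norm_scaleR_le_norm[OF that] R by (rule order.strict_trans1)
  have l_commutes: "l s * l t = l t * l s" if "s \<in> {0..1}" "t \<in> {0..1}" for s t
    unfolding l_def using that norm_s log_series_commutes[of "t *\<^sub>R R" "s *\<^sub>R R"]
    by (intro log_series_commutes) auto
  have "((\<lambda>s. exp (l s) * (1 - s *\<^sub>R R)) has_vector_derivative 0) (at s within {0..1})"
    if "s \<in> {0..1}" for s
  proof -
    have exp_l: "((\<lambda>t. exp (l t)) has_vector_derivative
      exp (l s) * (R * (\<Sum>n. (s *\<^sub>R R) ^ n))) (at s within {0..1})"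
      using has_vector_derivative_log_series[OF R that, folded l_def]
      by (intro has_vector_derivative_exp_commuting l_commutes that)
    have line: "((\<lambda>s. 1 - s *\<^sub>R R) has_vector_derivative - R) (at s within {0..1})"
      by (auto intro!: derivative_eq_intros simp: has_vector_derivative_def)
    have "exp (l s) * (R * (\<Sum>n. (s *\<^sub>R R) ^ n)) * (1 - s *\<^sub>R R) = exp (l s) * R"
      by (simp only: mult.assoc suminf_geometric_mult[OF norm_s[OF that]] mult_1_right)
    then show ?thesis using has_vector_derivative_mult[OF exp_l line] by simp
  qed
  then obtain c where "\<And>s. s \<in> {0..1} \<Longrightarrow> exp (l s) * (1 - s *\<^sub>R R) = c"
    by (rule has_vector_derivative_zero_constant[rotated]) auto
  then have "exp (l 1) * (1 - R) = exp (l 0) * (1 - 0 *\<^sub>R R)"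
    by (metis atLeastAtMost_iff order_refl scaleR_one zero_le_one)
  then have "exp (log_series R) * (1 - R) = 1"
    by (simp add: l_def log_series_def)
  then have "exp (- log_series R) * (exp (log_series R) * (1 - R)) = exp (- log_series R)" by simp
  then show ?thesis
    using exp_minus_inverse[of "- log_series R"] by (simp flip: mult.assoc)
qed

lemma exp_mult_diff_one_le:
  fixes x e :: real
  assumes "x \<ge> 0" "0 \<le> e" "e \<le> 1"
  shows "exp (x * e) - 1 \<le> x * e * exp x"
proof -
  have "1 - x * e \<le> exp (- (x * e))" using exp_ge_add_one_self[of "- (x * e)"] by simp
  then have "(1 - x * e) * exp (x * e) \<le> exp (- (x * e)) * exp (x * e)"
    by (intro mult_right_mono) auto
  then have "exp (x * e) - 1 \<le> x * e * exp (x * e)" by (simp add: algebra_simps flip: exp_add)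
  also have "\<dots> \<le> x * e * exp x"
    using assms by (intro mult_left_mono) (auto simp: mult_left_le)
  finally show ?thesis .
qed

lemma norm_scaleR_diff_one_le:
  fixes u :: "'a::real_normed_algebra_1"
  assumes "\<bar>\<kappa> - 1\<bar> \<le> B" "norm (u - 1) \<le> B"
  shows "norm (\<kappa> *\<^sub>R u - 1) \<le> (1 + B)\<^sup>2 - 1"
proof -
  have "norm (\<kappa> *\<^sub>R u - 1) = norm ((\<kappa> - 1) *\<^sub>R u + (u - 1))" by (simp add: algebra_simps)
  also have "\<dots> \<le> \<bar>\<kappa> - 1\<bar> * norm u + norm (u - 1)"
    using norm_triangle_ineq[of "(\<kappa> - 1) *\<^sub>R u" "u - 1"] by simp
  also have "\<dots> \<le> B * (1 + B) + B"
  proof (intro add_mono mult_mono assms)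
    show "norm u \<le> 1 + B" using norm_triangle_ineq[of "u - 1" 1] assms(2) by simp
  qed (use assms in auto)
  finally show ?thesis by (simp add: power2_eq_square algebra_simps)
qed

section \<open>The operator norm on a finite region\<close>

lemma finite_conf [simp]: "finite X \<Longrightarrow> finite (conf D X)"
proof -
  assume "finite X"
  have "conf D X \<subseteq> (\<lambda>f v. if v \<in> X then f v else 0) ` (X \<rightarrow>\<^sub>E {..<D})"
  proof
    fix \<sigma> assume "\<sigma> \<in> conf D X"
    then have "\<sigma> = (\<lambda>v. if v \<in> X then restrict \<sigma> X v else 0)" "restrict \<sigma> X \<in> X \<rightarrow>\<^sub>E {..<D}"
      by (auto simp: conf_def)
    then show "\<sigma> \<in> (\<lambda>f v. if v \<in> X then f v else 0) ` (X \<rightarrow>\<^sub>E {..<D})" by blast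
  qed
  then show ?thesis using \<open>finite X\<close> by (meson finite_PiE finite_imageI finite_lessThan finite_subset)
qed

lemma conf_nonempty: "D > 0 \<Longrightarrow> conf D X \<noteq> {}"
  unfolding conf_def by (auto intro!: exI[of _ "\<lambda>_. 0"])

lemma vnorm_eq_L2_set: "vnorm D X v = L2_set (\<lambda>\<sigma>. cmod (v \<sigma>)) (conf D X)"
  by (simp add: vnorm_def L2_set_def)

lemma vnorm_nonneg [simp]: "vnorm D X v \<ge> 0"
  by (simp add: vnorm_def sum_nonneg)

lemma vnorm_power2: "(vnorm D X v)\<^sup>2 = (\<Sum>\<sigma>\<in>conf D X. (cmod (v \<sigma>))\<^sup>2)"
  by (simp add: vnorm_def sum_nonneg)

lemma vnorm_cong: "(\<And>\<sigma>. \<sigma> \<in> conf D X \<Longrightarrow> v \<sigma> = w \<sigma>) \<Longrightarrow> vnorm D X v = vnorm D X w"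
  by (simp add: vnorm_def)

lemma vnorm_zero [simp]: "vnorm D X (\<lambda>_. 0) = 0"
  by (simp add: vnorm_def)

lemma vnorm_add_le: "vnorm D X (\<lambda>\<sigma>. v \<sigma> + w \<sigma>) \<le> vnorm D X v + vnorm D X w"
proof -
  have "vnorm D X (\<lambda>\<sigma>. v \<sigma> + w \<sigma>) \<le> L2_set (\<lambda>\<sigma>. cmod (v \<sigma>) + cmod (w \<sigma>)) (conf D X)"
    unfolding vnorm_eq_L2_set by (intro L2_set_mono norm_triangle_ineq) auto
  also have "\<dots> \<le> vnorm D X v + vnorm D X w"
    unfolding vnorm_eq_L2_set by (rule L2_set_triangle_ineq)
  finally show ?thesis .
qed

lemma vnorm_scale: "vnorm D X (\<lambda>\<sigma>. c * v \<sigma>) = cmod c * vnorm D X v"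
  by (simp add: vnorm_eq_L2_set norm_mult L2_set_right_distrib)

lemma cmod_le_vnorm: "finite X \<Longrightarrow> \<sigma> \<in> conf D X \<Longrightarrow> cmod (v \<sigma>) \<le> vnorm D X v"
  unfolding vnorm_eq_L2_set by (rule member_le_L2_set) auto

lemma opapply_scale: "opapply D X A (\<lambda>\<sigma>. c * v \<sigma>) = (\<lambda>\<sigma>. c * opapply D X A v \<sigma>)"
  by (simp add: opapply_def sum_distrib_left mult_ac)

lemma opapply_idop:
  assumes "finite X" "\<sigma> \<in> conf D X"
  shows "opapply D X (idop D X) v \<sigma> = v \<sigma>"
  using assms by (simp add: opapply_def idop_def if_distrib[of "\<lambda>x. x * _"] cong: if_cong)

lemma opapply_opadd:
  "\<sigma> \<in> conf D X \<Longrightarrow> opapply D X (opadd D X A B) v \<sigma> = opapply D X A v \<sigma> + opapply D X B v \<sigma>"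
  by (simp add: opapply_def opadd_def distrib_right sum.distrib)

lemma opapply_opsub:
  "\<sigma> \<in> conf D X \<Longrightarrow> opapply D X (opsub D X A B) v \<sigma> = opapply D X A v \<sigma> - opapply D X B v \<sigma>"
  by (simp add: opapply_def opsub_def left_diff_distrib sum_subtractf)

lemma opapply_opscale:
  "\<sigma> \<in> conf D X \<Longrightarrow> opapply D X (opscale D X c A) v \<sigma> = c * opapply D X A v \<sigma>"
  by (simp add: opapply_def opscale_def sum_distrib_left mult.assoc)

lemma opapply_opmult:
  "\<sigma> \<in> conf D X \<Longrightarrow> opapply D X (opmult D X A B) v \<sigma> = opapply D X A (opapply D X B v) \<sigma>"
  unfolding opapply_def opmult_def
  by (simp add: sum_distrib_right sum_distrib_left mult.assoc) (rule sum.swap)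

lemma opnorm_cong:
  assumes "op_eq D X A B"
  shows "opnorm D X A = opnorm D X B"
proof -
  have "vnorm D X (opapply D X A v) = vnorm D X (opapply D X B v)" for v
    using assms by (intro vnorm_cong) (simp add: opapply_def op_eq_def)
  then show ?thesis by (simp add: opnorm_def)
qed

lemma vnorm_opapply_le_sum:
  assumes "finite X"
  shows "vnorm D X (opapply D X A v) \<le> (\<Sum>\<sigma>\<in>conf D X. \<Sum>\<tau>\<in>conf D X. cmod (A \<sigma> \<tau>)) * vnorm D X v"
proof -
  have "vnorm D X (opapply D X A v) \<le> (\<Sum>\<sigma>\<in>conf D X. cmod (opapply D X A v \<sigma>))"
    unfolding vnorm_eq_L2_set by (rule L2_set_le_sum) auto
  also have "\<dots> \<le> (\<Sum>\<sigma>\<in>conf D X. (\<Sum>\<tau>\<in>conf D X. cmod (A \<sigma> \<tau>)) * vnorm D X v)"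
    unfolding opapply_def sum_distrib_right
    by (intro sum_mono sum_norm_le) (auto simp: norm_mult intro!: mult_left_mono cmod_le_vnorm assms)
  finally show ?thesis by (simp add: sum_distrib_right)
qed

lemma bdd_above_opnorm:
  assumes "finite X"
  shows "bdd_above {vnorm D X (opapply D X A v) | v. vnorm D X v \<le> 1}"
proof (rule bdd_aboveI, clarify)
  fix v assume "vnorm D X v \<le> 1"
  then have "(\<Sum>\<sigma>\<in>conf D X. \<Sum>\<tau>\<in>conf D X. cmod (A \<sigma> \<tau>)) * vnorm D X v
      \<le> (\<Sum>\<sigma>\<in>conf D X. \<Sum>\<tau>\<in>conf D X. cmod (A \<sigma> \<tau>)) * 1"
    by (intro mult_left_mono) (auto intro!: sum_nonneg)
  then show "vnorm D X (opapply D X A v) \<le> (\<Sum>\<sigma>\<in>conf D X. \<Sum>\<tau>\<in>conf D X. cmod (A \<sigma> \<tau>))"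
    using vnorm_opapply_le_sum[OF assms, of D A v] by simp
qed

lemma vnorm_opapply_le_opnorm:
  "finite X \<Longrightarrow> vnorm D X v \<le> 1 \<Longrightarrow> vnorm D X (opapply D X A v) \<le> opnorm D X A"
  unfolding opnorm_def by (rule cSup_upper[OF _ bdd_above_opnorm]) auto

lemma opnorm_nonneg: "finite X \<Longrightarrow> opnorm D X A \<ge> 0"
  by (rule order_trans[OF vnorm_nonneg vnorm_opapply_le_opnorm[of X D "\<lambda>_. 0"]]) simp_all

lemma vnorm_opapply_le:
  assumes "finite X"
  shows "vnorm D X (opapply D X A v) \<le> opnorm D X A * vnorm D X v"
proof (cases "vnorm D X v = 0")
  case True
  then show ?thesis using vnorm_opapply_le_sum[OF assms, of D A v] by simp
next
  case False
  define n where "n = vnorm D X v"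
  have n: "n > 0" using False vnorm_nonneg[of D X v] unfolding n_def by linarith
  define w where "w = (\<lambda>\<sigma>. complex_of_real (1 / n) * v \<sigma>)"
  have "vnorm D X w = 1" using n unfolding w_def vnorm_scale by (simp add: n_def norm_divide)
  then have "vnorm D X (opapply D X A w) \<le> opnorm D X A"
    by (intro vnorm_opapply_le_opnorm assms) simp
  moreover have "vnorm D X (opapply D X A w) = vnorm D X (opapply D X A v) / n"
    using n unfolding w_def opapply_scale vnorm_scale by (simp add: norm_divide)
  ultimately show ?thesis using n by (simp add: n_def field_simps)
qed

lemma opnorm_leI:
  assumes "c \<ge> 0" "\<And>v. vnorm D X (opapply D X A v) \<le> c * vnorm D X v"
  shows "opnorm D X A \<le> c"
  unfolding opnorm_def
proof (rule cSup_least)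
  show "{vnorm D X (opapply D X A v) |v. vnorm D X v \<le> 1} \<noteq> {}"
    by (auto intro!: exI[of _ "\<lambda>_. 0"])
  fix x assume "x \<in> {vnorm D X (opapply D X A v) |v. vnorm D X v \<le> 1}"
  then obtain v where "x = vnorm D X (opapply D X A v)" "vnorm D X v \<le> 1" by auto
  then show "x \<le> c" using assms(2)[of v] mult_left_mono[OF _ assms(1), of "vnorm D X v" 1] by simp
qed

lemma opnorm_opadd_le:
  assumes "finite X"
  shows "opnorm D X (opadd D X A B) \<le> opnorm D X A + opnorm D X B"
proof (rule opnorm_leI)
  fix v
  have "vnorm D X (opapply D X (opadd D X A B) v)
      \<le> vnorm D X (opapply D X A v) + vnorm D X (opapply D X B v)"
    using vnorm_add_le[of D X "opapply D X A v" "opapply D X B v"]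
    by (simp add: opapply_opadd cong: vnorm_cong)
  then show "vnorm D X (opapply D X (opadd D X A B) v) \<le> (opnorm D X A + opnorm D X B) * vnorm D X v"
    using vnorm_opapply_le[OF assms, of D A v] vnorm_opapply_le[OF assms, of D B v]
    by (simp add: distrib_right)
qed (simp add: opnorm_nonneg assms)

lemma opnorm_opscale_le:
  assumes "finite X"
  shows "opnorm D X (opscale D X c A) \<le> cmod c * opnorm D X A"
proof (rule opnorm_leI)
  fix v
  have "vnorm D X (opapply D X (opscale D X c A) v) = cmod c * vnorm D X (opapply D X A v)"
    by (simp add: opapply_opscale vnorm_scale cong: vnorm_cong)
  then show "vnorm D X (opapply D X (opscale D X c A) v) \<le> cmod c * opnorm D X A * vnorm D X v"
    using mult_left_mono[OF vnorm_opapply_le[OF assms, of D A v], of "cmod c"] by (simp add: mult.assoc)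
qed (simp add: opnorm_nonneg assms)

lemma opnorm_opmult_le:
  assumes "finite X"
  shows "opnorm D X (opmult D X A B) \<le> opnorm D X A * opnorm D X B"
proof (rule opnorm_leI)
  fix v
  have "vnorm D X (opapply D X (opmult D X A B) v) = vnorm D X (opapply D X A (opapply D X B v))"
    by (simp add: opapply_opmult cong: vnorm_cong)
  also have "\<dots> \<le> opnorm D X A * vnorm D X (opapply D X B v)"
    by (rule vnorm_opapply_le[OF assms])
  also have "\<dots> \<le> opnorm D X A * (opnorm D X B * vnorm D X v)"
    by (intro mult_left_mono vnorm_opapply_le opnorm_nonneg assms)
  finally show "vnorm D X (opapply D X (opmult D X A B) v) \<le> opnorm D X A * opnorm D X B * vnorm D X v"
    by (simp add: mult.assoc)
qed (simp add: opnorm_nonneg assms)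

definition basis_vect :: "'g cfg \<Rightarrow> 'g vect" where
  "basis_vect \<tau> = (\<lambda>\<sigma>. if \<sigma> = \<tau> then 1 else 0)"

lemma vnorm_basis_vect:
  assumes "finite X" "\<tau> \<in> conf D X"
  shows "vnorm D X (basis_vect \<tau>) = 1"
  using assms by (simp add: vnorm_def basis_vect_def if_distrib[of cmod]
    if_distrib[of "\<lambda>x. x\<^sup>2"] cong: if_cong)

lemma opapply_basis_vect:
  assumes "finite X" "\<tau> \<in> conf D X"
  shows "opapply D X A (basis_vect \<tau>) \<sigma> = A \<sigma> \<tau>"
  using assms by (simp add: opapply_def basis_vect_def if_distrib[of "\<lambda>x. _ * x"] cong: if_cong)

lemma cmod_entry_le_opnorm:
  assumes "finite X" "\<sigma> \<in> conf D X" "\<tau> \<in> conf D X"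
  shows "cmod (A \<sigma> \<tau>) \<le> opnorm D X A"
  using cmod_le_vnorm[OF assms(1,2), of "opapply D X A (basis_vect \<tau>)"]
    vnorm_opapply_le[OF assms(1), of D A "basis_vect \<tau>"] assms
  by (simp add: vnorm_basis_vect opapply_basis_vect)

lemma opnorm_idop:
  assumes "finite X" "D > 0"
  shows "opnorm D X (idop D X) = 1"
proof (rule antisym)
  show "opnorm D X (idop D X) \<le> 1"
    by (rule opnorm_leI) (simp_all add: opapply_idop assms cong: vnorm_cong)
  obtain \<sigma> where "\<sigma> \<in> conf D X" using conf_nonempty[OF assms(2)] by blast
  then show "1 \<le> opnorm D X (idop D X)"
    using cmod_entry_le_opnorm[OF assms(1), of \<sigma> D \<sigma> "idop D X"] by (simp add: idop_def)
qed

lemma opnorm_le_if_entries_tendsto: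
  assumes "finite X" "c \<ge> 0"
    and lim: "\<And>\<sigma> \<tau>. (\<lambda>n. A n \<sigma> \<tau>) \<longlonglongrightarrow> B \<sigma> \<tau>"
    and le: "\<forall>\<^sub>F n in sequentially. opnorm D X (A n) \<le> c"
  shows "opnorm D X B \<le> c"
proof (rule opnorm_leI[OF assms(2)])
  fix v
  have "(\<lambda>n. vnorm D X (opapply D X (A n) v)) \<longlonglongrightarrow> vnorm D X (opapply D X B v)"
    unfolding vnorm_def opapply_def by (intro tendsto_intros lim)
  moreover have "\<forall>\<^sub>F n in sequentially. vnorm D X (opapply D X (A n) v) \<le> c * vnorm D X v"
    using le by eventually_elim
      (meson assms(1) mult_right_mono order_trans vnorm_nonneg vnorm_opapply_le)
  ultimately show "vnorm D X (opapply D X B v) \<le> c * vnorm D X v"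
    by (rule tendsto_upperbound) simp
qed

lemma canon_eqI:
  assumes "canon D X A" "canon D X B" "op_eq D X A B"
  shows "A = B"
  using assms unfolding canon_def op_eq_def by (intro ext) metis

lemma canon_idop [simp]: "canon D X (idop D X)"
  by (auto simp: canon_def idop_def)

lemma canon_opadd [simp]: "canon D X (opadd D X A B)"
  by (auto simp: canon_def opadd_def)

lemma canon_opsub [simp]: "canon D X (opsub D X A B)"
  by (auto simp: canon_def opsub_def)

lemma canon_opscale [simp]: "canon D X (opscale D X c A)"
  by (auto simp: canon_def opscale_def)

lemma canon_opmult [simp]: "canon D X (opmult D X A B)"
  by (auto simp: canon_def opmult_def)

lemma opmult_assoc: "opmult D X (opmult D X A B) C = opmult D X A (opmult D X B C)"
proof (intro ext)
  fix \<sigma> \<tau>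
  have "(\<Sum>\<rho>\<in>conf D X. (\<Sum>\<omega>\<in>conf D X. A \<sigma> \<omega> * B \<omega> \<rho>) * C \<rho> \<tau>)
      = (\<Sum>\<omega>\<in>conf D X. \<Sum>\<rho>\<in>conf D X. A \<sigma> \<omega> * B \<omega> \<rho> * C \<rho> \<tau>)"
    unfolding sum_distrib_right by (rule sum.swap)
  also have "\<dots> = (\<Sum>\<omega>\<in>conf D X. A \<sigma> \<omega> * (\<Sum>\<rho>\<in>conf D X. B \<omega> \<rho> * C \<rho> \<tau>))"
    by (simp add: sum_distrib_left mult.assoc)
  finally show "opmult D X (opmult D X A B) C \<sigma> \<tau> = opmult D X A (opmult D X B C) \<sigma> \<tau>"
    by (simp add: opmult_def)
qed

lemma opmult_idop_left:
  assumes "finite X" "canon D X A"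
  shows "opmult D X (idop D X) A = A"
  by (rule canon_eqI[OF canon_opmult assms(2)])
    (use assms(1) in \<open>simp add: op_eq_def opmult_def idop_def if_distrib[of "\<lambda>x. x * _"] cong: if_cong\<close>)

lemma opmult_idop_right:
  assumes "finite X" "canon D X A"
  shows "opmult D X A (idop D X) = A"
  by (rule canon_eqI[OF canon_opmult assms(2)])
    (use assms(1) in \<open>simp add: op_eq_def opmult_def idop_def if_distrib[of "\<lambda>x. _ * x"] cong: if_cong\<close>)

lemma opmult_opscale_left: "opmult D X (opscale D X c A) B = opscale D X c (opmult D X A B)"
  by (auto simp: opmult_def opscale_def fun_eq_iff sum_distrib_left mult.assoc)

lemma opmult_opscale_right: "opmult D X A (opscale D X c B) = opscale D X c (opmult D X A B)"
  by (auto simp: opmult_def opscale_def fun_eq_iff sum_distrib_left mult_ac)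

lemma opmult_opsub_left: "opmult D X (opsub D X A B) C = opsub D X (opmult D X A C) (opmult D X B C)"
  by (auto simp: opmult_def opsub_def fun_eq_iff left_diff_distrib sum_subtractf)

lemma opmult_opsub_right: "opmult D X A (opsub D X B C) = opsub D X (opmult D X A B) (opmult D X A C)"
  by (auto simp: opmult_def opsub_def fun_eq_iff right_diff_distrib sum_subtractf)

section \<open>A Banach algebra containing all local operator algebras\<close>

text \<open>The bounded families indexed by all local dimensions and all finite regions form one Banach
  algebra type, so that the exponential function of the library applies to every region at once.\<close>

definition bounded_family :: "(nat \<Rightarrow> 'g::finite site set \<Rightarrow> 'g op) \<Rightarrow> bool" where
  "bounded_family F \<longleftrightarrow>
     (\<forall>D X \<sigma> \<tau>. F D X \<sigma> \<tau> \<noteq> 0 \<longrightarrow> D > 0 \<and> finite X \<and> \<sigma> \<in> conf D X \<and> \<tau> \<in> conf D X) \<and>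
     (\<exists>c. \<forall>D X. D > 0 \<longrightarrow> finite X \<longrightarrow> opnorm D X (F D X) \<le> c)"

lemma bounded_familyI:
  assumes "\<And>D X \<sigma> \<tau>. F D X \<sigma> \<tau> \<noteq> 0 \<Longrightarrow> D > 0 \<and> finite X \<and> \<sigma> \<in> conf D X \<and> \<tau> \<in> conf D X"
    and "\<And>D X. D > 0 \<Longrightarrow> finite X \<Longrightarrow> opnorm D X (F D X) \<le> c"
  shows "bounded_family F"
  unfolding bounded_family_def using assms by blast

lemma bounded_family_nonzeroD:
  assumes "bounded_family F" "F D X \<sigma> \<tau> \<noteq> 0"
  shows "D > 0" "finite X" "\<sigma> \<in> conf D X" "\<tau> \<in> conf D X"
  using assms unfolding bounded_family_def by blast+

lemma bounded_family_boundE: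
  assumes "bounded_family F"
  obtains c where "c \<ge> 0" "\<And>D X. D > 0 \<Longrightarrow> finite X \<Longrightarrow> opnorm D X (F D X) \<le> c"
proof -
  obtain c where c: "\<forall>D X. D > 0 \<longrightarrow> finite X \<longrightarrow> opnorm D X (F D X) \<le> c"
    using assms unfolding bounded_family_def by (elim conjE exE)
  have "0 \<le> opnorm 1 {} (F 1 {})" by (simp add: opnorm_nonneg)
  also have "\<dots> \<le> c" by (simp add: c)
  finally show thesis using c by (intro that[of c]) auto
qed

lemma bounded_family_zero: "bounded_family (\<lambda>_ _ _ _. 0)"
  by (rule bounded_familyI[of _ 0]) (auto intro!: opnorm_leI simp: opapply_def)

typedef 'g qalg = "{F :: nat \<Rightarrow> 'g::finite site set \<Rightarrow> 'g op. bounded_family F}"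
  morphisms component Abs_qalg
  using bounded_family_zero by blast

setup_lifting type_definition_qalg

lemma bounded_family_component: "bounded_family (component F)"
  using component[of F] by simp

lemma component_nonzeroD:
  assumes "component F D X \<sigma> \<tau> \<noteq> 0"
  shows "D > 0" "finite X" "\<sigma> \<in> conf D X" "\<tau> \<in> conf D X"
  using bounded_family_nonzeroD[OF bounded_family_component assms] by blast+

lemma canon_component [simp]: "canon D X (component F D X)"
  unfolding canon_def by (metis component_nonzeroD(3,4))

lemma qalg_eqI:
  assumes "\<And>D X \<sigma> \<tau>. D > 0 \<Longrightarrow> finite X \<Longrightarrow> \<sigma> \<in> conf D X \<Longrightarrow> \<tau> \<in> conf D X
    \<Longrightarrow> component F D X \<sigma> \<tau> = component G D X \<sigma> \<tau>"
  shows "F = G"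
proof -
  have "component F = component G"
    by (intro ext) (metis assms component_nonzeroD)
  then show ?thesis by (simp add: component_inject)
qed

instantiation qalg :: (finite) real_vector
begin

lift_definition zero_qalg :: "'a qalg" is "\<lambda>_ _ _ _. 0"
  by (rule bounded_family_zero)

lift_definition plus_qalg :: "'a qalg \<Rightarrow> 'a qalg \<Rightarrow> 'a qalg" is
  "\<lambda>F G D X. opadd D X (F D X) (G D X)"
proof -
  fix F G :: "nat \<Rightarrow> 'a site set \<Rightarrow> 'a op"
  assume F: "bounded_family F" and G: "bounded_family G"
  obtain a where a: "a \<ge> 0" "\<And>D X. D > 0 \<Longrightarrow> finite X \<Longrightarrow> opnorm D X (F D X) \<le> a"
    by (rule bounded_family_boundE[OF F], rule that)
  obtain b where b: "b \<ge> 0" "\<And>D X. D > 0 \<Longrightarrow> finite X \<Longrightarrow> opnorm D X (G D X) \<le> b"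
    by (rule bounded_family_boundE[OF G], rule that)
  have "opnorm D X (opadd D X (F D X) (G D X)) \<le> a + b" if "D > 0" "finite X" for D X
    using that a b opnorm_opadd_le[of X D "F D X" "G D X"] by (meson add_mono order_trans)
  moreover have "D > 0 \<and> finite X \<and> \<sigma> \<in> conf D X \<and> \<tau> \<in> conf D X"
    if "opadd D X (F D X) (G D X) \<sigma> \<tau> \<noteq> 0" for D X \<sigma> \<tau>
  proof -
    have "F D X \<sigma> \<tau> \<noteq> 0 \<or> G D X \<sigma> \<tau> \<noteq> 0" using that by (auto simp: opadd_def split: if_splits)
    then show ?thesis
      using bounded_family_nonzeroD[OF F, of D X \<sigma> \<tau>] bounded_family_nonzeroD[OF G, of D X \<sigma> \<tau>] by blast
  qed
  ultimately show "bounded_family (\<lambda>D X. opadd D X (F D X) (G D X))"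
    by (rule bounded_familyI[rotated])
qed

lift_definition scaleR_qalg :: "real \<Rightarrow> 'a qalg \<Rightarrow> 'a qalg" is
  "\<lambda>r F D X. opscale D X (complex_of_real r) (F D X)"
proof -
  fix r :: real and F :: "nat \<Rightarrow> 'a site set \<Rightarrow> 'a op"
  assume F: "bounded_family F"
  obtain a where "a \<ge> 0" "\<And>D X. D > 0 \<Longrightarrow> finite X \<Longrightarrow> opnorm D X (F D X) \<le> a"
    by (rule bounded_family_boundE[OF F], rule that)
  then have "opnorm D X (opscale D X (complex_of_real r) (F D X)) \<le> cmod (complex_of_real r) * a"
    if "D > 0" "finite X" for D X
    using that opnorm_opscale_le[of X D _ "F D X"] by (meson mult_left_mono norm_ge_zero order_trans)
  moreover have "D > 0 \<and> finite X \<and> \<sigma> \<in> conf D X \<and> \<tau> \<in> conf D X"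
    if "opscale D X (complex_of_real r) (F D X) \<sigma> \<tau> \<noteq> 0" for D X \<sigma> \<tau>
  proof -
    have "F D X \<sigma> \<tau> \<noteq> 0" using that by (auto simp: opscale_def split: if_splits)
    then show ?thesis using bounded_family_nonzeroD[OF F, of D X \<sigma> \<tau>] by blast
  qed
  ultimately show "bounded_family (\<lambda>D X. opscale D X (complex_of_real r) (F D X))"
    by (rule bounded_familyI[rotated])
qed

definition uminus_qalg :: "'a qalg \<Rightarrow> 'a qalg" where
  "uminus_qalg F = (- 1) *\<^sub>R F"

definition minus_qalg :: "'a qalg \<Rightarrow> 'a qalg \<Rightarrow> 'a qalg" where
  "minus_qalg F G = F + (- G)"

instance
proof
  note rep = plus_qalg.rep_eq scaleR_qalg.rep_eq zero_qalg.rep_eq opadd_def opscale_def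
  fix F G H :: "'a qalg" and r t :: real
  show "F + G + H = F + (G + H)" by (rule qalg_eqI) (simp add: rep)
  show "F + G = G + F" by (rule qalg_eqI) (simp add: rep)
  show "0 + F = F" by (rule qalg_eqI) (simp add: rep)
  show "- F + F = 0" by (rule qalg_eqI) (simp add: uminus_qalg_def rep)
  show "F - G = F + - G" by (rule minus_qalg_def)
  show "r *\<^sub>R (F + G) = r *\<^sub>R F + r *\<^sub>R G" by (rule qalg_eqI) (simp add: rep distrib_left)
  show "(r + t) *\<^sub>R F = r *\<^sub>R F + t *\<^sub>R F" by (rule qalg_eqI) (simp add: rep distrib_right)
  show "r *\<^sub>R t *\<^sub>R F = (r * t) *\<^sub>R F" by (rule qalg_eqI) (simp add: rep)
  show "1 *\<^sub>R F = F" by (rule qalg_eqI) (simp add: rep)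
qed

end

lemma component_plus: "component (F + G) D X = opadd D X (component F D X) (component G D X)"
  by (simp add: plus_qalg.rep_eq)

lemma component_scaleR: "component (r *\<^sub>R F) D X = opscale D X (complex_of_real r) (component F D X)"
  by (simp add: scaleR_qalg.rep_eq)

lemma component_minus: "component (F - G) D X = opsub D X (component F D X) (component G D X)"
  unfolding minus_qalg_def uminus_qalg_def component_plus component_scaleR
  by (simp add: opadd_def opscale_def opsub_def fun_eq_iff)

instantiation qalg :: (finite) real_normed_vector
begin

definition norm_qalg :: "'a qalg \<Rightarrow> real" where
  "norm_qalg F = (SUP (D, X)\<in>{(D, X). D > 0 \<and> finite X}. opnorm D X (component F D X))"

definition sgn_qalg :: "'a qalg \<Rightarrow> 'a qalg" where
  "sgn_qalg F = F /\<^sub>R norm F"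

definition dist_qalg :: "'a qalg \<Rightarrow> 'a qalg \<Rightarrow> real" where
  "dist_qalg F G = norm (F - G)"

definition uniformity_qalg :: "('a qalg \<times> 'a qalg) filter" where
  "uniformity_qalg = (INF e\<in>{0<..}. principal {(x, y). dist x y < e})"

definition open_qalg :: "'a qalg set \<Rightarrow> bool" where
  "open_qalg U = (\<forall>x\<in>U. eventually (\<lambda>(x', y). x' = x \<longrightarrow> y \<in> U) uniformity)"

lemma opnorm_component_le_norm:
  assumes "D > 0" "finite X"
  shows "opnorm D X (component F D X) \<le> norm F"
proof -
  obtain c where "c \<ge> 0" "\<And>D X. D > 0 \<Longrightarrow> finite X \<Longrightarrow> opnorm D X (component F D X) \<le> c"
    by (rule bounded_family_boundE[OF bounded_family_component], rule that)
  then have "bdd_above ((\<lambda>(D, X). opnorm D X (component F D X)) ` {(D, X). D > 0 \<and> finite X})"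
    by (intro bdd_aboveI[of _ c]) auto
  from cSUP_upper[OF _ this, of "(D, X)"] show ?thesis
    using assms by (simp add: norm_qalg_def)
qed

lemma norm_qalg_leI:
  assumes "\<And>D X. D > 0 \<Longrightarrow> finite X \<Longrightarrow> opnorm D X (component F D X) \<le> c"
  shows "norm F \<le> c"
  unfolding norm_qalg_def
proof (rule cSUP_least)
  have "(1, {}) \<in> {(D :: nat, X :: 'a site set). D > 0 \<and> finite X}" by simp
  then show "{(D :: nat, X :: 'a site set). D > 0 \<and> finite X} \<noteq> {}" by blast
qed (use assms in auto)

lemma norm_qalg_nonneg: "norm (F :: 'a qalg) \<ge> 0"
  using opnorm_component_le_norm[of 1 "{}" F] opnorm_nonneg[of "{}" 1 "component F 1 {}"] by simp

lemma cmod_component_le_norm: "cmod (component F D X \<sigma> \<tau>) \<le> norm F"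
proof (cases "component F D X \<sigma> \<tau> = 0")
  case True
  then show ?thesis by (simp add: norm_qalg_nonneg)
next
  case False
  note index = component_nonzeroD[OF False]
  show ?thesis
    using cmod_entry_le_opnorm[OF index(2-4)] opnorm_component_le_norm[OF index(1,2)]
    by (rule order_trans)
qed

lemma norm_scaleR_qalg_le: "norm (r *\<^sub>R F) \<le> \<bar>r\<bar> * norm (F :: 'a qalg)"
proof (rule norm_qalg_leI)
  fix D :: nat and X :: "'a site set" assume "D > 0" "finite X"
  then show "opnorm D X (component (r *\<^sub>R F) D X) \<le> \<bar>r\<bar> * norm F"
    unfolding component_scaleR
    by (intro order_trans[OF opnorm_opscale_le]) (auto intro!: mult_left_mono opnorm_component_le_norm)
qed

instance
proof
  fix F G :: "'a qalg" and r :: real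
  show "norm F = 0 \<longleftrightarrow> F = 0"
  proof
    assume "norm F = 0"
    then show "F = 0"
      using cmod_component_le_norm[of F] by (auto intro!: qalg_eqI simp: zero_qalg.rep_eq)
  next
    assume "F = 0"
    then show "norm F = 0"
      by (intro antisym norm_qalg_nonneg norm_qalg_leI opnorm_leI)
        (auto simp: zero_qalg.rep_eq opapply_def)
  qed
  show "norm (F + G) \<le> norm F + norm G"
    unfolding component_plus
    by (rule norm_qalg_leI)
      (auto simp: component_plus intro!: order_trans[OF opnorm_opadd_le] add_mono
        opnorm_component_le_norm)
  show "norm (r *\<^sub>R F) = \<bar>r\<bar> * norm F"
  proof (cases "r = 0")
    case True
    then show ?thesis using norm_scaleR_qalg_le[of r F] norm_qalg_nonneg[of "r *\<^sub>R F"] by simp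
  next
    case False
    then have "norm F \<le> \<bar>inverse r\<bar> * norm (r *\<^sub>R F)"
      using norm_scaleR_qalg_le[of "inverse r" "r *\<^sub>R F"] by simp
    then show ?thesis using False norm_scaleR_qalg_le[of r F] by (simp add: field_simps)
  qed
qed (simp_all add: sgn_qalg_def dist_qalg_def uniformity_qalg_def open_qalg_def)

end

lemma bounded_linear_component: "bounded_linear (\<lambda>F. component F D X \<sigma> \<tau>)"
proof (rule bounded_linear_intro[of _ 1])
  fix F G :: "'a qalg" and r
  show "component (F + G) D X \<sigma> \<tau> = component F D X \<sigma> \<tau> + component G D X \<sigma> \<tau>"
    "component (r *\<^sub>R F) D X \<sigma> \<tau> = r *\<^sub>R component F D X \<sigma> \<tau>"
    using canon_component[of D X F] canon_component[of D X G]
    by (auto simp: component_plus component_scaleR opadd_def opscale_def canon_def scaleR_conv_of_real)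
qed (simp add: cmod_component_le_norm)

lemma Cauchy_entrywise_limit:
  fixes F :: "nat \<Rightarrow> 'g::finite qalg"
  assumes "Cauchy F"
  obtains G where "\<And>D X \<sigma> \<tau>. (\<lambda>n. component (F n) D X \<sigma> \<tau>) \<longlonglongrightarrow> component G D X \<sigma> \<tau>"
proof -
  define L where "L D X \<sigma> \<tau> = lim (\<lambda>n. component (F n) D X \<sigma> \<tau>)" for D X \<sigma> \<tau>
  have "Cauchy (\<lambda>n. component (F n) D X \<sigma> \<tau>)" for D X \<sigma> \<tau>
    by (rule bounded_linear.Cauchy[OF bounded_linear_component assms])
  then have L: "(\<lambda>n. component (F n) D X \<sigma> \<tau>) \<longlonglongrightarrow> L D X \<sigma> \<tau>" for D X \<sigma> \<tau>
    unfolding L_def by (simp add: Cauchy_convergent_iff convergent_LIMSEQ_iff)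
  obtain c where c: "\<And>n. norm (F n) \<le> c"
    using Cauchy_Bseq[OF assms] by (meson BseqE)
  have "bounded_family L"
  proof (rule bounded_familyI)
    fix D X \<sigma> \<tau> assume "L D X \<sigma> \<tau> \<noteq> 0"
    then obtain n where "component (F n) D X \<sigma> \<tau> \<noteq> 0"
      using LIMSEQ_unique[OF L[of D X \<sigma> \<tau>], of 0] by fastforce
    then show "D > 0 \<and> finite X \<and> \<sigma> \<in> conf D X \<and> \<tau> \<in> conf D X" by (simp add: component_nonzeroD)
  next
    fix D :: nat and X :: "'g site set" assume "D > 0" "finite X"
    then have "opnorm D X (component (F n) D X) \<le> c" for n
      using opnorm_component_le_norm[of D X "F n"] c[of n] by linarith
    moreover have "c \<ge> 0" using c[of 0] norm_ge_zero[of "F 0"] by linarith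
    ultimately show "opnorm D X (L D X) \<le> c"
      using \<open>finite X\<close> by (intro opnorm_le_if_entries_tendsto[OF _ _ L]) auto
  qed
  then have "component (Abs_qalg L) = L" by (simp add: Abs_qalg_inverse)
  then show thesis using L by (intro that[of "Abs_qalg L"]) simp
qed

lemma norm_le_if_entries_tendsto:
  fixes F :: "nat \<Rightarrow> 'g::finite qalg"
  assumes lim: "\<And>D X \<sigma> \<tau>. (\<lambda>n. component (F n) D X \<sigma> \<tau>) \<longlonglongrightarrow> component G D X \<sigma> \<tau>"
    and le: "\<forall>\<^sub>F n in sequentially. norm (F n) \<le> c"
  shows "norm G \<le> c"
proof (rule norm_qalg_leI)
  fix D :: nat and X :: "'g site set" assume X: "D > 0" "finite X"
  obtain n where "norm (F n) \<le> c"
    using eventually_happens'[OF _ le] by auto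
  then have "c \<ge> 0" using norm_ge_zero[of "F n"] by linarith
  show "opnorm D X (component G D X) \<le> c"
  proof (rule opnorm_le_if_entries_tendsto[OF X(2) \<open>c \<ge> 0\<close> lim])
    show "\<forall>\<^sub>F n in sequentially. opnorm D X (component (F n) D X) \<le> c"
      using le by eventually_elim (rule order_trans[OF opnorm_component_le_norm[OF X]])
  qed
qed

instance qalg :: (finite) banach
proof
  fix F :: "nat \<Rightarrow> 'a qalg" assume "Cauchy F"
  then obtain G where G: "\<And>D X \<sigma> \<tau>. (\<lambda>n. component (F n) D X \<sigma> \<tau>) \<longlonglongrightarrow> component G D X \<sigma> \<tau>"
    using Cauchy_entrywise_limit by blast
  have "F \<longlonglongrightarrow> G"
  proof (rule LIMSEQ_I)
    fix r :: real assume "r > 0"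
    then obtain N where N: "\<And>m n. m \<ge> N \<Longrightarrow> n \<ge> N \<Longrightarrow> norm (F m - F n) < r / 2"
      using \<open>Cauchy F\<close>[unfolded Cauchy_iff, rule_format, of "r / 2"] by auto
    have "norm (F n - G) \<le> r / 2" if "n \<ge> N" for n
    proof (rule norm_le_if_entries_tendsto)
      show "(\<lambda>m. component (F n - F m) D X \<sigma> \<tau>) \<longlonglongrightarrow> component (F n - G) D X \<sigma> \<tau>" for D X \<sigma> \<tau>
        unfolding linear_diff[OF bounded_linear.linear[OF bounded_linear_component]]
        by (intro tendsto_intros G)
      show "\<forall>\<^sub>F m in sequentially. norm (F n - F m) \<le> r / 2"
        using eventually_ge_at_top[of N] by eventually_elim (rule less_imp_le[OF N[OF that]])
    qed
    then show "\<exists>N. \<forall>n\<ge>N. norm (F n - G) < r"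
      using \<open>r > 0\<close> by (intro exI[of _ N]) fastforce
  qed
  then show "convergent F" by (rule convergentI)
qed

instantiation qalg :: (finite) real_normed_algebra_1
begin

lift_definition one_qalg :: "'a qalg" is
  "\<lambda>D X. if D > 0 \<and> finite X then idop D X else (\<lambda>_ _. 0)"
proof (rule bounded_familyI)
  show "opnorm D X (if D > 0 \<and> finite X then idop D X else (\<lambda>_ _. 0)) \<le> 1"
    if "D > 0" "finite X" for D and X :: "'a site set"
    using that by (simp add: opnorm_idop)
qed (auto simp: idop_def split: if_splits)

lift_definition times_qalg :: "'a qalg \<Rightarrow> 'a qalg \<Rightarrow> 'a qalg" is
  "\<lambda>F G D X. opmult D X (F D X) (G D X)"
proof -
  fix F G :: "nat \<Rightarrow> 'a site set \<Rightarrow> 'a op"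
  assume F: "bounded_family F" and G: "bounded_family G"
  obtain a where a: "a \<ge> 0" "\<And>D X. D > 0 \<Longrightarrow> finite X \<Longrightarrow> opnorm D X (F D X) \<le> a"
    by (rule bounded_family_boundE[OF F], rule that)
  obtain b where b: "b \<ge> 0" "\<And>D X. D > 0 \<Longrightarrow> finite X \<Longrightarrow> opnorm D X (G D X) \<le> b"
    by (rule bounded_family_boundE[OF G], rule that)
  show "bounded_family (\<lambda>D X. opmult D X (F D X) (G D X))"
  proof (rule bounded_familyI)
    fix D X \<sigma> \<tau> assume "opmult D X (F D X) (G D X) \<sigma> \<tau> \<noteq> 0"
    then have "(\<Sum>\<rho>\<in>conf D X. F D X \<sigma> \<rho> * G D X \<rho> \<tau>) \<noteq> 0"
      by (auto simp: opmult_def split: if_splits)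
    then obtain \<rho> where "F D X \<sigma> \<rho> * G D X \<rho> \<tau> \<noteq> 0"
      by (rule sum.not_neutral_contains_not_neutral)
    then show "D > 0 \<and> finite X \<and> \<sigma> \<in> conf D X \<and> \<tau> \<in> conf D X"
      using bounded_family_nonzeroD[OF F, of D X \<sigma> \<rho>] bounded_family_nonzeroD[OF G, of D X \<rho> \<tau>] by auto
  next
    fix D :: nat and X :: "'a site set" assume "D > 0" "finite X"
    then show "opnorm D X (opmult D X (F D X) (G D X)) \<le> a * b"
      using a b by (intro order_trans[OF opnorm_opmult_le] mult_mono opnorm_nonneg)
  qed
qed

instance
proof
  fix F G H :: "'a qalg" and r :: real
  show "F * G * H = F * (G * H)"
    by (rule qalg_eqI) (simp add: times_qalg.rep_eq opmult_assoc)
  show "(F + G) * H = F * H + G * H"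
    by (rule qalg_eqI) (simp add: times_qalg.rep_eq component_plus
        opmult_def opadd_def distrib_right sum.distrib)
  show "F * (G + H) = F * G + F * H"
    by (rule qalg_eqI) (simp add: times_qalg.rep_eq component_plus
        opmult_def opadd_def distrib_left sum.distrib)
  show "1 * F = F" "F * 1 = F"
    by (rule qalg_eqI, simp add: times_qalg.rep_eq one_qalg.rep_eq opmult_idop_left opmult_idop_right)+
  show "r *\<^sub>R F * G = r *\<^sub>R (F * G)" "F * r *\<^sub>R G = r *\<^sub>R (F * G)"
    by (rule qalg_eqI, simp add: times_qalg.rep_eq component_scaleR
        opmult_def opscale_def sum_distrib_left mult_ac)+
  show norm_one: "norm (1 :: 'a qalg) = 1"
    using opnorm_component_le_norm[of 1 "{}" "1 :: 'a qalg"]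
    by (intro antisym norm_qalg_leI) (auto simp: one_qalg.rep_eq opnorm_idop)
  show "(0 :: 'a qalg) \<noteq> 1" using norm_one by (metis norm_zero zero_neq_one)
  show "norm (F * G) \<le> norm F * norm G"
    by (rule norm_qalg_leI)
      (auto simp: times_qalg.rep_eq intro!: order_trans[OF opnorm_opmult_le] mult_mono
        opnorm_component_le_norm opnorm_nonneg)
qed

end

lemma component_times: "component (F * G) D X = opmult D X (component F D X) (component G D X)"
  by (simp add: times_qalg.rep_eq)

lemma component_one: "D > 0 \<Longrightarrow> finite X \<Longrightarrow> component 1 D X = idop D X"
  by (simp add: one_qalg.rep_eq)

lemma component_power:
  "D > 0 \<Longrightarrow> finite X \<Longrightarrow> component (F ^ n) D X = oppow D X (component F D X) n"
  by (induction n) (simp_all add: component_one component_times)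

lemma component_entry_scaleR: "component (r *\<^sub>R F) D X \<sigma> \<tau> = complex_of_real r * component F D X \<sigma> \<tau>"
  by (simp add: linear_scale[OF bounded_linear.linear[OF bounded_linear_component]]
      scaleR_conv_of_real[where 'a = complex])

lift_definition of_op :: "nat \<Rightarrow> 'g::finite site set \<Rightarrow> 'g op \<Rightarrow> 'g qalg" is
  "\<lambda>D X A D' X' \<sigma> \<tau>. if D' = D \<and> X' = X \<and> D > 0 \<and> finite X \<and> \<sigma> \<in> conf D X \<and> \<tau> \<in> conf D X
     then A \<sigma> \<tau> else 0"
proof -
  fix D and X :: "'g site set" and A :: "'g op"
  define F where "F = (\<lambda>D' X' \<sigma> \<tau>. if D' = D \<and> X' = X \<and> D > 0 \<and> finite X \<and> \<sigma> \<in> conf D X \<and> \<tau> \<in> conf D X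
     then A \<sigma> \<tau> else 0)"
  have "opnorm D' X' (F D' X') \<le> max 0 (opnorm D X (F D X))" for D' X'
  proof (cases "D' = D \<and> X' = X")
    case False
    then have "F D' X' = (\<lambda>_ _. 0)" by (auto simp: F_def fun_eq_iff)
    then show ?thesis by (auto intro!: opnorm_leI simp: opapply_def)
  qed auto
  then show "bounded_family F"
    by (rule bounded_familyI[rotated]) (auto simp: F_def split: if_splits)
qed

lemma component_of_op:
  "D > 0 \<Longrightarrow> finite X \<Longrightarrow> canon D X A \<Longrightarrow> component (of_op D X A) D X = A"
  by (rule canon_eqI[OF canon_component]) (auto simp: op_eq_def of_op.rep_eq)

lemma of_op_cong: "op_eq D X A B \<Longrightarrow> of_op D X A = of_op D X B"
  by (rule qalg_eqI) (simp add: of_op.rep_eq op_eq_def)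

lemma of_op_opadd: "of_op D X (opadd D X A B) = of_op D X A + of_op D X B"
  by (rule qalg_eqI) (simp add: of_op.rep_eq component_plus opadd_def)

lemma of_op_opscale: "of_op D X (opscale D X (complex_of_real r) A) = r *\<^sub>R of_op D X A"
  by (rule qalg_eqI) (simp add: of_op.rep_eq component_scaleR opscale_def)

lemma of_op_opmult: "of_op D X (opmult D X A B) = of_op D X A * of_op D X B"
proof (rule qalg_eqI)
  fix D' and X' :: "'a site set" and \<sigma> \<tau>
  assume "D' > 0" "finite X'" "\<sigma> \<in> conf D' X'" "\<tau> \<in> conf D' X'"
  then show "component (of_op D X (opmult D X A B)) D' X' \<sigma> \<tau>
      = component (of_op D X A * of_op D X B) D' X' \<sigma> \<tau>"
    by (cases "D' = D"; cases "X' = X") (simp_all add: component_times of_op.rep_eq opmult_def)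
qed

lemma of_op_sum: "of_op D X (\<lambda>\<sigma> \<tau>. \<Sum>i\<in>I. A i \<sigma> \<tau>) = (\<Sum>i\<in>I. of_op D X (A i))"
proof (induction I rule: infinite_finite_induct)
  case (insert x I)
  have "of_op D X (\<lambda>\<sigma> \<tau>. \<Sum>i\<in>insert x I. A i \<sigma> \<tau>) = of_op D X (opadd D X (A x) (\<lambda>\<sigma> \<tau>. \<Sum>i\<in>I. A i \<sigma> \<tau>))"
    by (rule of_op_cong) (use insert.hyps in \<open>simp add: op_eq_def opadd_def\<close>)
  then show ?case using insert by (simp add: of_op_opadd)
qed (rule qalg_eqI, simp add: of_op.rep_eq zero_qalg.rep_eq)+

lemma norm_of_op_le:
  assumes "finite X"
  shows "norm (of_op D X A) \<le> opnorm D X A"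
proof (rule norm_qalg_leI)
  fix D' :: nat and X' :: "'a site set" assume index: "D' > 0" "finite X'"
  show "opnorm D' X' (component (of_op D X A) D' X') \<le> opnorm D X A"
  proof (cases "D' = D \<and> X' = X")
    case True
    then have "op_eq D X (component (of_op D X A) D X) A"
      using index by (auto simp: op_eq_def of_op.rep_eq)
    then show ?thesis using True opnorm_cong by fastforce
  next
    case False
    then have "component (of_op D X A) D' X' = (\<lambda>_ _. 0)" by (auto simp: of_op.rep_eq fun_eq_iff)
    then show ?thesis by (auto intro!: opnorm_leI simp: opapply_def opnorm_nonneg assms)
  qed
qed

section \<open>Exponentials of local operators\<close>

lemma oppow_cong: "op_eq D X A B \<Longrightarrow> oppow D X A n = oppow D X B n"
  by (induction n) (auto simp: opmult_def op_eq_def fun_eq_iff)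

lemma mexp_cong: "op_eq D X A B \<Longrightarrow> mexp D X A = mexp D X B"
  by (simp add: mexp_def oppow_cong)

lemma component_exp:
  fixes F :: "'g::finite qalg"
  assumes "D > 0" "finite X"
  shows "component (exp F) D X = mexp D X (component F D X)"
proof (intro ext)
  fix \<sigma> \<tau>
  have "component (F ^ n /\<^sub>R fact n) D X \<sigma> \<tau>
      = oppow D X (component F D X) n \<sigma> \<tau> / of_nat (fact n)" for n
    by (simp add: component_entry_scaleR component_power assms divide_inverse mult.commute)
  moreover have "(\<lambda>n. component (F ^ n /\<^sub>R fact n) D X \<sigma> \<tau>) sums component (exp F) D X \<sigma> \<tau>"
    by (rule bounded_linear.sums[OF bounded_linear_component exp_converges])
  ultimately show "component (exp F) D X \<sigma> \<tau> = mexp D X (component F D X) \<sigma> \<tau>"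
    by (simp add: mexp_def sums_iff)
qed

lemma mexp_eq_component:
  fixes A :: "'g::finite op"
  assumes "D > 0" "finite X"
  shows "mexp D X A = component (exp (of_op D X A)) D X"
  unfolding component_exp[OF assms]
  by (rule mexp_cong) (simp add: op_eq_def of_op.rep_eq assms)

lemma canon_mexp: "D > 0 \<Longrightarrow> finite X \<Longrightarrow> canon D X (mexp D X A)" for A :: "'g::finite op"
  by (simp add: mexp_eq_component)

lemma mexp_opadd_commuting:
  fixes A :: "'g::finite op"
  assumes "D > 0" "finite X" "opmult D X A B = opmult D X B A"
  shows "mexp D X (opadd D X A B) = opmult D X (mexp D X A) (mexp D X B)"
proof -
  have "of_op D X A * of_op D X B = of_op D X B * of_op D X A"
    by (simp add: assms(3) flip: of_op_opmult)
  then show ?thesis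
    by (simp add: mexp_eq_component assms of_op_opadd exp_add_commuting component_times)
qed

lemma mexp_opadd_scalar:
  fixes A :: "'g::finite op"
  assumes "D > 0" "finite X"
  shows "mexp D X (opadd D X A (opscale D X (complex_of_real c) (idop D X)))
    = opscale D X (complex_of_real (exp c)) (mexp D X A)"
proof -
  have "op_eq D X (opadd D X A (opscale D X (complex_of_real c) (idop D X)))
      (component (of_op D X A + c *\<^sub>R 1) D X)"
    by (simp add: op_eq_def component_plus component_scaleR component_one of_op.rep_eq opadd_def
        opscale_def assms)
  then have "mexp D X (opadd D X A (opscale D X (complex_of_real c) (idop D X)))
      = component (exp (of_op D X A + c *\<^sub>R 1)) D X"
    unfolding component_exp[OF assms] by (rule mexp_cong)
  then show ?thesis by (simp add: exp_add_scaleR_one component_scaleR mexp_eq_component assms)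
qed

lemma mexp_inverse:
  fixes A :: "'g::finite op"
  assumes "D > 0" "finite X"
  shows "opmult D X (mexp D X A) (mexp D X (opscale D X (- 1) A)) = idop D X"
    and "opmult D X (mexp D X (opscale D X (- 1) A)) (mexp D X A) = idop D X"
proof -
  have "of_op D X (opscale D X (- 1) A) = - of_op D X A"
    using of_op_opscale[of D X "- 1" A] by simp
  then have neg: "mexp D X (opscale D X (- 1) A) = component (exp (- of_op D X A)) D X"
    by (simp add: mexp_eq_component assms)
  show "opmult D X (mexp D X A) (mexp D X (opscale D X (- 1) A)) = idop D X"
    using exp_minus_inverse[of "of_op D X A"]
    by (simp add: neg mexp_eq_component assms flip: component_times component_one)
  show "opmult D X (mexp D X (opscale D X (- 1) A)) (mexp D X A) = idop D X"
    using exp_minus_inverse[of "- of_op D X A"]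
    by (simp add: neg mexp_eq_component assms flip: component_times component_one)
qed

lemma selfadjD: "selfadj D X A \<Longrightarrow> \<sigma> \<in> conf D X \<Longrightarrow> \<tau> \<in> conf D X \<Longrightarrow> A \<sigma> \<tau> = cnj (A \<tau> \<sigma>)"
  unfolding selfadj_def by blast

lemma selfadjI: "(\<And>\<sigma> \<tau>. \<sigma> \<in> conf D X \<Longrightarrow> \<tau> \<in> conf D X \<Longrightarrow> A \<sigma> \<tau> = cnj (A \<tau> \<sigma>)) \<Longrightarrow> selfadj D X A"
  unfolding selfadj_def by blast

lemma selfadj_cong: "op_eq D X A B \<Longrightarrow> selfadj D X A \<longleftrightarrow> selfadj D X B"
  by (simp add: selfadj_def op_eq_def)

lemma selfadj_idop: "selfadj D X (idop D X)"
  by (simp add: selfadj_def idop_def)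

lemma selfadj_opadd: "selfadj D X A \<Longrightarrow> selfadj D X B \<Longrightarrow> selfadj D X (opadd D X A B)"
  by (rule selfadjI) (simp add: opadd_def flip: selfadjD)

lemma selfadj_opsub: "selfadj D X A \<Longrightarrow> selfadj D X B \<Longrightarrow> selfadj D X (opsub D X A B)"
  by (rule selfadjI) (simp add: opsub_def flip: selfadjD)

lemma selfadj_opscale: "selfadj D X A \<Longrightarrow> selfadj D X (opscale D X (complex_of_real r) A)"
  by (rule selfadjI) (simp add: opscale_def flip: selfadjD)

lemma selfadj_opmult_commuting:
  assumes "selfadj D X A" "selfadj D X B" "opmult D X A B = opmult D X B A"
  shows "selfadj D X (opmult D X A B)"
proof (rule selfadjI)
  fix \<sigma> \<tau> assume conf: "\<sigma> \<in> conf D X" "\<tau> \<in> conf D X"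
  have "opmult D X A B \<sigma> \<tau> = (\<Sum>\<rho>\<in>conf D X. cnj (B \<tau> \<rho> * A \<rho> \<sigma>))"
    using conf by (simp add: opmult_def mult.commute flip: assms(1,2)[THEN selfadjD])
  also have "\<dots> = cnj (opmult D X B A \<tau> \<sigma>)" using conf by (simp add: opmult_def)
  finally show "opmult D X A B \<sigma> \<tau> = cnj (opmult D X A B \<tau> \<sigma>)" by (simp add: assms(3))
qed

lemma selfadj_component_power:
  assumes "D > 0" "finite X" "selfadj D X (component F D X)"
  shows "selfadj D X (component (F ^ n) D X)"
proof (induction n)
  case 0
  then show ?case using assms by (simp add: component_one selfadj_idop)
next
  case (Suc n)
  have "opmult D X (component F D X) (component (F ^ n) D X)
      = opmult D X (component (F ^ n) D X) (component F D X)"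
    by (simp add: power_commutes flip: component_times)
  then show ?case by (simp add: component_times selfadj_opmult_commuting assms Suc)
qed

lemma selfadj_component_sums:
  assumes sums: "f sums F" and selfadj: "\<And>n. selfadj D X (component (f n) D X)"
  shows "selfadj D X (component F D X)"
proof (rule selfadjI)
  fix \<sigma> \<tau> assume conf: "\<sigma> \<in> conf D X" "\<tau> \<in> conf D X"
  have "(\<lambda>n. cnj (component (f n) D X \<tau> \<sigma>)) sums cnj (component F D X \<tau> \<sigma>)"
    using bounded_linear.sums[OF bounded_linear_component sums] by (simp only: sums_cnj)
  then have "(\<lambda>n. component (f n) D X \<sigma> \<tau>) sums cnj (component F D X \<tau> \<sigma>)"
    by (simp flip: selfadjD[OF selfadj conf])
  then show "component F D X \<sigma> \<tau> = cnj (component F D X \<tau> \<sigma>)"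
    using bounded_linear.sums[OF bounded_linear_component sums] by (rule sums_unique2[rotated])
qed

lemma selfadj_component_of_op:
  "D > 0 \<Longrightarrow> finite X \<Longrightarrow> selfadj D X A \<Longrightarrow> selfadj D X (component (of_op D X A) D X)"
  by (subst selfadj_cong[of _ _ _ A]) (simp_all add: op_eq_def of_op.rep_eq)

lemma selfadj_mexp:
  fixes A :: "'g::finite op"
  assumes "D > 0" "finite X" "selfadj D X A"
  shows "selfadj D X (mexp D X A)"
  unfolding mexp_eq_component[OF assms(1,2)]
proof (rule selfadj_component_sums[OF exp_converges])
  show "selfadj D X (component (of_op D X A ^ n /\<^sub>R fact n) D X)" for n
    unfolding component_scaleR
    by (intro selfadj_opscale selfadj_component_power selfadj_component_of_op assms)
qed

lemma selfadj_opmult_self_diag: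
  assumes "selfadj D X A" "\<sigma> \<in> conf D X"
  shows "opmult D X A A \<sigma> \<sigma> = complex_of_real (\<Sum>\<tau>\<in>conf D X. (cmod (A \<sigma> \<tau>))\<^sup>2)"
proof -
  have "opmult D X A A \<sigma> \<sigma> = (\<Sum>\<tau>\<in>conf D X. A \<sigma> \<tau> * cnj (A \<sigma> \<tau>))"
    unfolding opmult_def using assms
    by (auto intro!: sum.cong simp: selfadjD[OF assms(1) _ assms(2)])
  then show ?thesis unfolding complex_norm_square[symmetric] by simp
qed

text \<open>The diagonal entries of \<open>cosh S\<close> are series with nonnegative terms, the second of which is half
  the squared norm of a row of \<open>S\<close>.\<close>

lemma selfadj_mexp_eq_idop:
  fixes S :: "'g::finite op"
  assumes D: "D > 0" "finite X" and S: "canon D X S" "selfadj D X S" and exp_S: "mexp D X S = idop D X"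
    and conf: "\<sigma> \<in> conf D X" "\<tau> \<in> conf D X"
  shows "S \<sigma> \<tau> = 0"
proof -
  define F where "F = of_op D X S"
  define a where "a n = Re (component (if even n then F ^ n /\<^sub>R fact n else 0) D X \<sigma> \<sigma>)" for n
  have F: "component F D X = S" using component_of_op[OF D S(1)] by (simp add: F_def)
  have exp_F: "component (exp F) D X = idop D X" by (simp add: component_exp D F exp_S)
  have "component (exp (- F)) D X = component (exp F * exp (- F)) D X"
    by (simp add: component_times exp_F opmult_idop_left D)
  then have "component (exp (- F)) D X = idop D X" by (simp add: exp_minus_inverse component_one D)
  then have "component (cosh F) D X \<sigma> \<sigma> = 1"
    using conf by (simp add: cosh_def component_scaleR component_plus exp_F
        opscale_def opadd_def idop_def)
  then have a_sums: "a sums 1"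
    using sums_Re[OF bounded_linear.sums[OF bounded_linear_component cosh_converges[of F]], of D X \<sigma> \<sigma>]
    by (simp add: a_def[abs_def])
  have even_power: "component (F ^ (2 * k)) D X \<sigma> \<sigma>
      = complex_of_real (\<Sum>\<rho>\<in>conf D X. (cmod (component (F ^ k) D X \<sigma> \<rho>))\<^sup>2)" for k
    using selfadj_opmult_self_diag[OF selfadj_component_power[OF D] conf(1)] S(2)
    by (simp add: F mult_2 power_add component_times)
  have a_even: "a (2 * k) = inverse (fact (2 * k)) *
      (\<Sum>\<rho>\<in>conf D X. (cmod (component (F ^ k) D X \<sigma> \<rho>))\<^sup>2)"
    for k
    by (simp only: a_def even_power component_entry_scaleR dvd_triv_left if_True Re_complex_of_real
        flip: of_real_mult)
  have "a n \<ge> 0" for n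
    using a_even[of "n div 2"] by (cases "even n") (auto simp: a_def zero_qalg.rep_eq sum_nonneg)
  then have "(\<Sum>n\<in>{0, 2}. a n) \<le> 1"
    using sum_le_suminf[OF sums_summable[OF a_sums], of "{0, 2}"] a_sums by (simp add: sums_iff)
  moreover have "a 0 = 1" using conf by (simp add: a_def component_one D idop_def)
  moreover have "a 2 = (\<Sum>\<rho>\<in>conf D X. (cmod (S \<sigma> \<rho>))\<^sup>2) / 2" using a_even[of 1] by (simp add: F)
  ultimately have "(\<Sum>\<rho>\<in>conf D X. (cmod (S \<sigma> \<rho>))\<^sup>2) \<le> 0" by simp
  moreover have "(cmod (S \<sigma> \<tau>))\<^sup>2 \<le> (\<Sum>\<rho>\<in>conf D X. (cmod (S \<sigma> \<rho>))\<^sup>2)"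
    using conf D by (intro member_le_sum) auto
  ultimately show ?thesis by (smt (verit) norm_eq_zero power2_less_eq_zero_iff)
qed

section \<open>Embeddings of local algebras\<close>

definition join :: "'g site set \<Rightarrow> 'g cfg \<Rightarrow> 'g cfg \<Rightarrow> 'g cfg" where
  "join X \<sigma> \<rho> = (\<lambda>v. if v \<in> X then \<sigma> v else \<rho> v)"

lemma join_in_conf: "X \<subseteq> Y \<Longrightarrow> \<sigma> \<in> conf D X \<Longrightarrow> \<rho> \<in> conf D (Y - X) \<Longrightarrow> join X \<sigma> \<rho> \<in> conf D Y"
  by (auto simp: join_def conf_def)

lemma restr_join: "\<sigma> \<in> conf D X \<Longrightarrow> restr X (join X \<sigma> \<rho>) = \<sigma>"
  by (auto simp: join_def restr_def conf_def)

lemma restr_join_compl: "\<rho> \<in> conf D (Y - X) \<Longrightarrow> restr (Y - X) (join X \<sigma> \<rho>) = \<rho>"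
  by (auto simp: join_def restr_def conf_def)

lemma join_restr: "X \<subseteq> Y \<Longrightarrow> \<sigma> \<in> conf D Y \<Longrightarrow> join X (restr X \<sigma>) (restr (Y - X) \<sigma>) = \<sigma>"
  by (auto simp: join_def restr_def conf_def)

lemma join_inject:
  assumes "\<sigma> \<in> conf D X" "\<sigma>' \<in> conf D X" "\<rho> \<in> conf D (Y - X)" "\<rho>' \<in> conf D (Y - X)"
  shows "join X \<sigma> \<rho> = join X \<sigma>' \<rho>' \<longleftrightarrow> \<sigma> = \<sigma>' \<and> \<rho> = \<rho>'"
  using assms by (metis restr_join restr_join_compl)

lemma restr_in_conf: "X \<subseteq> Y \<Longrightarrow> \<sigma> \<in> conf D Y \<Longrightarrow> restr X \<sigma> \<in> conf D X"
  by (auto simp: restr_def conf_def)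

lemma restr_restr: "X \<subseteq> Y \<Longrightarrow> restr X (restr Y \<sigma>) = restr X \<sigma>"
  by (auto simp: restr_def fun_eq_iff)

lemma restr_eq_iff: "restr S \<sigma> = restr S \<tau> \<longleftrightarrow> (\<forall>v\<in>S. \<sigma> v = \<tau> v)"
  unfolding restr_def fun_eq_iff by meson

lemma conf_joinE:
  assumes "X \<subseteq> Y" "\<sigma> \<in> conf D Y"
  obtains \<sigma>' \<rho> where "\<sigma>' \<in> conf D X" "\<rho> \<in> conf D (Y - X)" "\<sigma> = join X \<sigma>' \<rho>"
  using that[of "restr X \<sigma>" "restr (Y - X) \<sigma>"] assms
  by (metis Diff_subset join_restr restr_in_conf)

lemma sum_conf_join:
  assumes "X \<subseteq> Y"
  shows "(\<Sum>\<tau>\<in>conf D Y. F \<tau>) = (\<Sum>\<sigma>\<in>conf D X. \<Sum>\<rho>\<in>conf D (Y - X). F (join X \<sigma> \<rho>))"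
proof -
  have "(\<Sum>\<tau>\<in>conf D Y. F \<tau>) = (\<Sum>(\<sigma>, \<rho>)\<in>conf D X \<times> conf D (Y - X). F (join X \<sigma> \<rho>))"
    using assms
    by (intro sum.reindex_bij_witness[of _ "\<lambda>(\<sigma>, \<rho>). join X \<sigma> \<rho>" "\<lambda>\<sigma>. (restr X \<sigma>, restr (Y - X) \<sigma>)"])
       (auto simp: join_restr restr_join restr_join_compl join_in_conf intro: restr_in_conf)
  then show ?thesis by (simp add: sum.cartesian_product)
qed

lemma canon_emb [simp]: "canon D Y (emb D X Y A)"
  by (auto simp: canon_def emb_def)

lemma emb_entry:
  "\<sigma> \<in> conf D Y \<Longrightarrow> \<tau> \<in> conf D Y \<Longrightarrow>
    emb D X Y A \<sigma> \<tau> = (if \<forall>v\<in>Y - X. \<sigma> v = \<tau> v then A (restr X \<sigma>) (restr X \<tau>) else 0)"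
  unfolding emb_def restr_eq_iff by simp

lemma emb_join:
  assumes "X \<subseteq> Y" "\<sigma> \<in> conf D X" "\<sigma>' \<in> conf D X" "\<rho> \<in> conf D (Y - X)" "\<rho>' \<in> conf D (Y - X)"
  shows "emb D X Y A (join X \<sigma> \<rho>) (join X \<sigma>' \<rho>') = (if \<rho> = \<rho>' then A \<sigma> \<sigma>' else 0)"
  unfolding emb_def using assms by (simp add: restr_join restr_join_compl join_in_conf)

lemma emb_eqI:
  assumes "X \<subseteq> Y" "canon D Y B"
    "\<And>\<sigma> \<sigma>' \<rho> \<rho>'. \<sigma> \<in> conf D X \<Longrightarrow> \<sigma>' \<in> conf D X \<Longrightarrow> \<rho> \<in> conf D (Y - X) \<Longrightarrow> \<rho>' \<in> conf D (Y - X) \<Longrightarrow>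
       B (join X \<sigma> \<rho>) (join X \<sigma>' \<rho>') = (if \<rho> = \<rho>' then A \<sigma> \<sigma>' else 0)"
  shows "emb D X Y A = B"
proof (rule canon_eqI[OF canon_emb assms(2)])
  have "emb D X Y A \<sigma> \<tau> = B \<sigma> \<tau>" if \<sigma>: "\<sigma> \<in> conf D Y" and \<tau>: "\<tau> \<in> conf D Y" for \<sigma> \<tau>
    by (rule conf_joinE[OF assms(1) \<sigma>], rule conf_joinE[OF assms(1) \<tau>])
      (use assms in \<open>simp add: emb_join\<close>)
  then show "op_eq D Y (emb D X Y A) B" by (simp add: op_eq_def)
qed

lemma emb_cong: "X \<subseteq> Y \<Longrightarrow> op_eq D X A B \<Longrightarrow> emb D X Y A = emb D X Y B"
  by (rule emb_eqI) (auto simp: emb_join op_eq_def)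

lemma emb_idop: "X \<subseteq> Y \<Longrightarrow> emb D X Y (idop D X) = idop D Y"
  by (rule emb_eqI[OF _ canon_idop]) (auto simp: idop_def join_in_conf join_inject)

lemma emb_opadd: "X \<subseteq> Y \<Longrightarrow> emb D X Y (opadd D X A B) = opadd D Y (emb D X Y A) (emb D X Y B)"
  by (rule emb_eqI[OF _ canon_opadd]) (auto simp: opadd_def emb_join join_in_conf)

lemma emb_opsub: "X \<subseteq> Y \<Longrightarrow> emb D X Y (opsub D X A B) = opsub D Y (emb D X Y A) (emb D X Y B)"
  by (rule emb_eqI[OF _ canon_opsub]) (auto simp: opsub_def emb_join join_in_conf)

lemma emb_opscale: "X \<subseteq> Y \<Longrightarrow> emb D X Y (opscale D X c A) = opscale D Y c (emb D X Y A)"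
  by (rule emb_eqI[OF _ canon_opscale]) (auto simp: opscale_def emb_join join_in_conf)

lemma emb_opmult:
  assumes "X \<subseteq> Y" "finite Y"
  shows "emb D X Y (opmult D X A B) = opmult D Y (emb D X Y A) (emb D X Y B)"
proof (rule emb_eqI[OF assms(1)])
  fix \<sigma> \<sigma>' \<rho> \<rho>'
  assume conf: "\<sigma> \<in> conf D X" "\<sigma>' \<in> conf D X" "\<rho> \<in> conf D (Y - X)" "\<rho>' \<in> conf D (Y - X)"
  have "opmult D Y (emb D X Y A) (emb D X Y B) (join X \<sigma> \<rho>) (join X \<sigma>' \<rho>')
     = (\<Sum>t\<in>conf D X. \<Sum>r\<in>conf D (Y - X).
         emb D X Y A (join X \<sigma> \<rho>) (join X t r) * emb D X Y B (join X t r) (join X \<sigma>' \<rho>'))"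
    unfolding opmult_def using conf assms(1) by (simp add: join_in_conf sum_conf_join[OF assms(1)])
  also have "\<dots> = (\<Sum>t\<in>conf D X. \<Sum>r\<in>conf D (Y - X).
      if r = \<rho> then (if \<rho> = \<rho>' then A \<sigma> t * B t \<sigma>' else 0) else 0)"
    using conf assms(1) by (intro sum.cong refl) (auto simp: emb_join)
  also have "\<dots> = (if \<rho> = \<rho>' then opmult D X A B \<sigma> \<sigma>' else 0)"
    using conf assms(2) by (simp add: opmult_def)
  finally show "opmult D Y (emb D X Y A) (emb D X Y B) (join X \<sigma> \<rho>) (join X \<sigma>' \<rho>')
    = (if \<rho> = \<rho>' then opmult D X A B \<sigma> \<sigma>' else 0)" .
qed simp

lemma emb_oppow:
  assumes "X \<subseteq> Y" "finite Y"
  shows "emb D X Y (oppow D X A n) = oppow D Y (emb D X Y A) n"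
  by (induction n) (simp_all add: emb_idop emb_opmult assms)

lemma emb_mexp:
  assumes "X \<subseteq> Y" "finite Y"
  shows "emb D X Y (mexp D X A) = mexp D Y (emb D X Y A)"
proof (intro ext)
  fix \<sigma> \<tau>
  show "emb D X Y (mexp D X A) \<sigma> \<tau> = mexp D Y (emb D X Y A) \<sigma> \<tau>"
    unfolding mexp_def emb_oppow[OF assms, symmetric]
    unfolding emb_def by (cases "\<sigma> \<in> conf D Y \<and> \<tau> \<in> conf D Y \<and> restr (Y - X) \<sigma> = restr (Y - X) \<tau>")
       (simp_all only: if_True if_False simp_thms, simp)
qed

lemma emb_emb:
  assumes "X \<subseteq> Y" "Y \<subseteq> Z"
  shows "emb D Y Z (emb D X Y A) = emb D X Z A"
proof (rule canon_eqI)
  have "emb D Y Z (emb D X Y A) \<sigma> \<tau> = emb D X Z A \<sigma> \<tau>" if "\<sigma> \<in> conf D Z" "\<tau> \<in> conf D Z" for \<sigma> \<tau>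
  proof -
    have "(\<forall>v\<in>Z - X. \<sigma> v = \<tau> v) \<longleftrightarrow>
        (\<forall>v\<in>Z - Y. \<sigma> v = \<tau> v) \<and> (\<forall>v\<in>Y - X. restr Y \<sigma> v = restr Y \<tau> v)"
      using assms by (auto simp: restr_def)
    then show ?thesis
      using that assms by (simp add: emb_entry restr_in_conf restr_restr)
  qed
  then show "op_eq D Z (emb D Y Z (emb D X Y A)) (emb D X Z A)" by (simp add: op_eq_def)
qed simp_all

lemma selfadj_emb:
  assumes "X \<subseteq> Y" "selfadj D X A"
  shows "selfadj D Y (emb D X Y A)"
proof (rule selfadjI)
  fix \<sigma> \<tau> assume conf: "\<sigma> \<in> conf D Y" "\<tau> \<in> conf D Y"
  then have "A (restr X \<sigma>) (restr X \<tau>) = cnj (A (restr X \<tau>) (restr X \<sigma>))"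
    using assms by (intro selfadjD[OF assms(2)] restr_in_conf)
  then show "emb D X Y A \<sigma> \<tau> = cnj (emb D X Y A \<tau> \<sigma>)"
    using conf by (auto simp: emb_entry)
qed

text \<open>Of the intermediate configurations in the product only the one that agrees with \<open>\<tau>\<close> on \<open>X\<close> and with
  \<open>\<sigma>\<close> elsewhere contributes.\<close>

lemma opmult_emb_disjoint:
  assumes "X \<subseteq> Z" "Y \<subseteq> Z" "X \<inter> Y = {}" "finite Z" and conf: "\<sigma> \<in> conf D Z" "\<tau> \<in> conf D Z"
  shows "opmult D Z (emb D X Z A) (emb D Y Z B) \<sigma> \<tau>
    = (if \<forall>v\<in>Z - (X \<union> Y). \<sigma> v = \<tau> v then A (restr X \<sigma>) (restr X \<tau>) * B (restr Y \<sigma>) (restr Y \<tau>) else 0)"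
proof -
  define \<omega> where "\<omega> = join X \<tau> \<sigma>"
  have \<omega>: "\<omega> \<in> conf D Z" using assms by (auto simp: \<omega>_def join_def conf_def)
  have "emb D X Z A \<sigma> \<eta> * emb D Y Z B \<eta> \<tau> = 0" if \<eta>: "\<eta> \<in> conf D Z" "\<eta> \<noteq> \<omega>" for \<eta>
  proof -
    obtain v where v: "\<eta> v \<noteq> \<omega> v" using \<eta>(2) by blast
    then have "v \<in> Z" using \<eta>(1) \<omega> by (metis (mono_tags, lifting) conf_def mem_Collect_eq)
    then have "v \<in> Z - Y \<and> \<eta> v \<noteq> \<tau> v \<or> v \<in> Z - X \<and> \<sigma> v \<noteq> \<eta> v"
      using v assms(3) by (auto simp: \<omega>_def join_def split: if_splits)
    then show ?thesis using conf \<eta>(1) by (auto simp: emb_entry)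
  qed
  then have "(\<Sum>\<eta>\<in>conf D Z. emb D X Z A \<sigma> \<eta> * emb D Y Z B \<eta> \<tau>)
      = (\<Sum>\<eta>\<in>{\<omega>}. emb D X Z A \<sigma> \<eta> * emb D Y Z B \<eta> \<tau>)"
    using \<omega> assms(4) by (intro sum.mono_neutral_right) auto
  then have "opmult D Z (emb D X Z A) (emb D Y Z B) \<sigma> \<tau> = emb D X Z A \<sigma> \<omega> * emb D Y Z B \<omega> \<tau>"
    using conf by (simp add: opmult_def)
  also have "emb D X Z A \<sigma> \<omega> = A (restr X \<sigma>) (restr X \<tau>)"
    using conf \<omega> by (auto simp: emb_entry \<omega>_def join_def restr_def intro!: arg_cong2[of _ _ _ _ A])
  also have "emb D Y Z B \<omega> \<tau> = (if \<forall>v\<in>Z - (X \<union> Y). \<sigma> v = \<tau> v then B (restr Y \<sigma>) (restr Y \<tau>) else 0)"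
  proof -
    have "restr Y \<omega> = restr Y \<sigma>"
      using assms(3) by (auto simp: restr_eq_iff \<omega>_def join_def)
    moreover have "(\<forall>v\<in>Z - Y. \<omega> v = \<tau> v) \<longleftrightarrow> (\<forall>v\<in>Z - (X \<union> Y). \<sigma> v = \<tau> v)"
      by (auto simp: \<omega>_def join_def)
    ultimately show ?thesis using conf \<omega> by (simp add: emb_entry)
  qed
  finally show ?thesis by simp
qed

lemma emb_commute_disjoint:
  assumes "X \<subseteq> Z" "Y \<subseteq> Z" "X \<inter> Y = {}" "finite Z"
  shows "opmult D Z (emb D X Z A) (emb D Y Z B) = opmult D Z (emb D Y Z B) (emb D X Z A)"
proof (rule canon_eqI)
  show "op_eq D Z (opmult D Z (emb D X Z A) (emb D Y Z B)) (opmult D Z (emb D Y Z B) (emb D X Z A))"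
    using assms opmult_emb_disjoint[OF assms] opmult_emb_disjoint[OF assms(2,1) _ assms(4)]
    by (auto simp: op_eq_def Int_commute Un_commute)
qed simp_all

lemma optrace_emb_disjoint:
  assumes "X \<inter> Y = {}" "finite X" "finite Y"
  shows "optrace D (X \<union> Y) (opmult D (X \<union> Y) (emb D X (X \<union> Y) A) (emb D Y (X \<union> Y) B))
    = optrace D X A * optrace D Y B"
proof -
  have compl: "X \<union> Y - X = Y" using assms by blast
  have "optrace D (X \<union> Y) (opmult D (X \<union> Y) (emb D X (X \<union> Y) A) (emb D Y (X \<union> Y) B))
      = (\<Sum>\<sigma>\<in>conf D (X \<union> Y). A (restr X \<sigma>) (restr X \<sigma>) * B (restr Y \<sigma>) (restr Y \<sigma>))"
    unfolding optrace_def using assms by (intro sum.cong refl) (simp add: opmult_emb_disjoint)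
  also have "\<dots> = (\<Sum>\<sigma>\<in>conf D X. \<Sum>\<rho>\<in>conf D Y. A \<sigma> \<sigma> * B \<rho> \<rho>)"
    using restr_join[of _ D X] restr_join_compl[of _ D "X \<union> Y" X]
    by (subst sum_conf_join[of X]) (auto simp: compl intro!: sum.cong)
  finally show ?thesis by (simp add: optrace_def sum_product)
qed

lemma vnorm_split:
  assumes "X \<subseteq> Y"
  shows "(vnorm D Y v)\<^sup>2 = (\<Sum>\<rho>\<in>conf D (Y - X). (vnorm D X (\<lambda>\<sigma>. v (join X \<sigma> \<rho>)))\<^sup>2)"
  unfolding vnorm_power2 sum_conf_join[OF assms] by (rule sum.swap)

lemma opapply_emb_join:
  assumes "X \<subseteq> Y" "finite Y" "\<sigma> \<in> conf D X" "\<rho> \<in> conf D (Y - X)"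
  shows "opapply D Y (emb D X Y A) v (join X \<sigma> \<rho>) = opapply D X A (\<lambda>\<tau>. v (join X \<tau> \<rho>)) \<sigma>"
proof -
  have "opapply D Y (emb D X Y A) v (join X \<sigma> \<rho>)
      = (\<Sum>\<tau>\<in>conf D X. \<Sum>r\<in>conf D (Y - X). if r = \<rho> then A \<sigma> \<tau> * v (join X \<tau> \<rho>) else 0)"
    unfolding opapply_def sum_conf_join[OF assms(1)] using assms
    by (intro sum.cong refl) (auto simp: emb_join)
  then show ?thesis using assms by (simp add: opapply_def)
qed

lemma opnorm_emb_le:
  assumes "X \<subseteq> Y" "finite Y"
  shows "opnorm D Y (emb D X Y A) \<le> opnorm D X A"
proof (rule opnorm_leI)
  have "finite X" using assms finite_subset by blast
  then show nonneg: "0 \<le> opnorm D X A" by (rule opnorm_nonneg)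
  fix v
  have "(vnorm D Y (opapply D Y (emb D X Y A) v))\<^sup>2
      = (\<Sum>\<rho>\<in>conf D (Y - X). (vnorm D X (opapply D X A (\<lambda>\<tau>. v (join X \<tau> \<rho>))))\<^sup>2)"
    unfolding vnorm_split[OF assms(1)]
    by (intro sum.cong refl arg_cong[of _ _ "\<lambda>x. x\<^sup>2"] vnorm_cong opapply_emb_join assms)
  also have "\<dots> \<le> (\<Sum>\<rho>\<in>conf D (Y - X). (opnorm D X A * vnorm D X (\<lambda>\<tau>. v (join X \<tau> \<rho>)))\<^sup>2)"
    by (intro sum_mono power_mono vnorm_opapply_le \<open>finite X\<close>) simp
  also have "\<dots> = (opnorm D X A * vnorm D Y v)\<^sup>2"
    unfolding power_mult_distrib vnorm_split[OF assms(1), of D v] sum_distrib_left ..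
  finally show "vnorm D Y (opapply D Y (emb D X Y A) v) \<le> opnorm D X A * vnorm D Y v"
    by (rule power2_le_imp_le) (simp add: nonneg)
qed

definition tensor_basis :: "'g site set \<Rightarrow> 'g site set \<Rightarrow> 'g vect \<Rightarrow> 'g cfg \<Rightarrow> 'g vect" where
  "tensor_basis X Y v \<rho> = (\<lambda>\<tau>. if restr (Y - X) \<tau> = \<rho> then v (restr X \<tau>) else 0)"

lemma tensor_basis_join:
  assumes "\<sigma> \<in> conf D X" "\<rho>' \<in> conf D (Y - X)"
  shows "tensor_basis X Y v \<rho> (join X \<sigma> \<rho>') = (if \<rho>' = \<rho> then v \<sigma> else 0)"
  using assms by (simp add: tensor_basis_def restr_join restr_join_compl)

lemma vnorm_tensor_basis:
  assumes "X \<subseteq> Y" "finite Y" "\<rho> \<in> conf D (Y - X)"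
  shows "vnorm D Y (tensor_basis X Y v \<rho>) = vnorm D X v"
proof -
  have "(vnorm D Y (tensor_basis X Y v \<rho>))\<^sup>2
      = (\<Sum>\<sigma>\<in>conf D X. \<Sum>\<rho>'\<in>conf D (Y - X). if \<rho>' = \<rho> then (cmod (v \<sigma>))\<^sup>2 else 0)"
    unfolding vnorm_power2 sum_conf_join[OF assms(1)]
    by (intro sum.cong refl) (simp add: tensor_basis_join)
  also have "\<dots> = (vnorm D X v)\<^sup>2" using assms by (simp add: vnorm_power2)
  finally show ?thesis using power2_eq_iff_nonneg vnorm_nonneg by blast
qed

lemma opapply_emb_tensor_basis:
  assumes "X \<subseteq> Y" "finite Y" "\<tau> \<in> conf D Y"
  shows "opapply D Y (emb D X Y A) (tensor_basis X Y v \<rho>) \<tau> = tensor_basis X Y (opapply D X A v) \<rho> \<tau>"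
proof (rule conf_joinE[OF assms(1,3)])
  fix \<sigma> \<rho>' assume join: "\<sigma> \<in> conf D X" "\<rho>' \<in> conf D (Y - X)" "\<tau> = join X \<sigma> \<rho>'"
  then show ?thesis
    using assms(1,2) by (simp add: opapply_emb_join tensor_basis_join)
      (auto simp: opapply_def tensor_basis_join)
qed

lemma opnorm_le_emb:
  assumes "X \<subseteq> Y" "finite Y" "D > 0"
  shows "opnorm D X A \<le> opnorm D Y (emb D X Y A)"
proof (rule opnorm_leI)
  show "0 \<le> opnorm D Y (emb D X Y A)" by (rule opnorm_nonneg[OF assms(2)])
  fix v
  obtain \<rho> where \<rho>: "\<rho> \<in> conf D (Y - X)" using conf_nonempty[OF assms(3)] by blast
  have "vnorm D X (opapply D X A v) = vnorm D Y (opapply D Y (emb D X Y A) (tensor_basis X Y v \<rho>))"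
    using assms \<rho> by (simp add: opapply_emb_tensor_basis vnorm_tensor_basis cong: vnorm_cong)
  also have "\<dots> \<le> opnorm D Y (emb D X Y A) * vnorm D X v"
    using vnorm_opapply_le[OF assms(2), of D _ "tensor_basis X Y v \<rho>"] assms \<rho>
    by (simp add: vnorm_tensor_basis)
  finally show "vnorm D X (opapply D X A v) \<le> opnorm D Y (emb D X Y A) * vnorm D X v" .
qed

section \<open>Positive definite operators and their logarithms\<close>

definition qform :: "nat \<Rightarrow> 'g site set \<Rightarrow> 'g op \<Rightarrow> 'g vect \<Rightarrow> complex" where
  "qform D X M v = (\<Sum>\<sigma>\<in>conf D X. cnj (v \<sigma>) * opapply D X M v \<sigma>)"

lemma cmod_qform_le:
  assumes "finite X"
  shows "cmod (qform D X M v) \<le> opnorm D X M * (vnorm D X v)\<^sup>2"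
proof -
  have "cmod (qform D X M v) \<le> (\<Sum>\<sigma>\<in>conf D X. \<bar>cmod (v \<sigma>)\<bar> * \<bar>cmod (opapply D X M v \<sigma>)\<bar>)"
    unfolding qform_def by (rule order_trans[OF norm_sum]) (simp add: norm_mult)
  also have "\<dots> \<le> vnorm D X v * vnorm D X (opapply D X M v)"
    unfolding vnorm_eq_L2_set by (rule L2_set_mult_ineq)
  also have "\<dots> \<le> vnorm D X v * (opnorm D X M * vnorm D X v)"
    by (intro mult_left_mono vnorm_opapply_le assms) simp
  finally show ?thesis by (simp add: power2_eq_square mult_ac)
qed

lemma qform_basis_vect:
  assumes "finite X" "\<sigma> \<in> conf D X"
  shows "qform D X M (basis_vect \<sigma>) = M \<sigma> \<sigma>"
  using assms unfolding qform_def
  by (simp add: opapply_basis_vect) (simp add: basis_vect_def if_distrib[of cnj] if_distrib[of "\<lambda>x. x * _"] cong: if_cong)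

lemma sum_cnj_opapply_selfadj:
  assumes "selfadj D X Q"
  shows "(\<Sum>\<sigma>\<in>conf D X. cnj (v \<sigma>) * opapply D X Q w \<sigma>) = (\<Sum>\<sigma>\<in>conf D X. cnj (opapply D X Q v \<sigma>) * w \<sigma>)"
proof -
  have "(\<Sum>\<sigma>\<in>conf D X. cnj (v \<sigma>) * opapply D X Q w \<sigma>)
      = (\<Sum>\<sigma>\<in>conf D X. \<Sum>\<tau>\<in>conf D X. cnj (v \<sigma>) * (Q \<sigma> \<tau> * w \<tau>))"
    by (simp add: opapply_def sum_distrib_left)
  also have "\<dots> = (\<Sum>\<tau>\<in>conf D X. \<Sum>\<sigma>\<in>conf D X. cnj (v \<sigma>) * (Q \<sigma> \<tau> * w \<tau>))"
    by (rule sum.swap)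
  also have "\<dots> = (\<Sum>\<tau>\<in>conf D X. \<Sum>\<sigma>\<in>conf D X. cnj (Q \<tau> \<sigma> * v \<sigma>) * w \<tau>)"
    by (intro sum.cong refl) (simp add: mult_ac flip: selfadjD[OF assms])
  finally show ?thesis by (simp add: opapply_def sum_distrib_right)
qed

lemma qform_selfadj_sandwich:
  assumes "selfadj D X Q"
  shows "qform D X (opmult D X Q (opmult D X V Q)) v = qform D X V (opapply D X Q v)"
proof -
  have "opapply D X (opmult D X Q (opmult D X V Q)) v \<sigma>
      = opapply D X Q (opapply D X V (opapply D X Q v)) \<sigma>"
    if "\<sigma> \<in> conf D X" for \<sigma>
    using that by (simp add: opapply_opmult) (simp add: opapply_def[of D X Q] opapply_opmult)
  then show ?thesis
    by (simp add: qform_def sum_cnj_opapply_selfadj[OF assms])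
qed

lemma qform_selfadj_square:
  assumes "finite X" "selfadj D X Q" "canon D X Q"
  shows "qform D X (opmult D X Q Q) v = complex_of_real ((vnorm D X (opapply D X Q v))\<^sup>2)"
proof -
  have "qform D X (opmult D X Q Q) v = qform D X (idop D X) (opapply D X Q v)"
    using qform_selfadj_sandwich[OF assms(2), of "idop D X"] assms by (simp add: opmult_idop_left)
  also have "\<dots> = complex_of_real ((vnorm D X (opapply D X Q v))\<^sup>2)"
    using assms(1) by (simp add: qform_def opapply_idop vnorm_power2 complex_norm_square mult.commute
        del: of_real_power)
  finally show ?thesis .
qed

definition posdef :: "nat \<Rightarrow> 'g site set \<Rightarrow> 'g op \<Rightarrow> bool" where
  "posdef D X M \<longleftrightarrow> canon D X M \<and> selfadj D X M \<and>
     (\<exists>\<delta>>0. \<forall>v. \<delta> * (vnorm D X v)\<^sup>2 \<le> Re (qform D X M v))"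

lemma selfadj_mexpE:
  fixes A :: "'g::finite op"
  assumes "D > 0" "finite X" "selfadj D X A"
  obtains Q Q' where "canon D X Q" "selfadj D X Q"
    "mexp D X A = opmult D X Q Q" "opmult D X Q' Q = idop D X"
proof
  define Q where "Q = mexp D X (opscale D X (complex_of_real (1 / 2)) A)"
  show "canon D X Q" "selfadj D X Q"
    unfolding Q_def by (intro canon_mexp selfadj_mexp selfadj_opscale assms)+
  have "mexp D X A = mexp D X (opadd D X (opscale D X (complex_of_real (1 / 2)) A) (opscale D X (complex_of_real (1 / 2)) A))"
    by (rule mexp_cong) (simp add: op_eq_def opadd_def opscale_def)
  then show "mexp D X A = opmult D X Q Q"
    unfolding Q_def by (simp add: mexp_opadd_commuting assms)
  show "opmult D X (mexp D X (opscale D X (- 1) (opscale D X (complex_of_real (1 / 2)) A))) Q = idop D X"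
    unfolding Q_def by (rule mexp_inverse(2)[OF assms(1,2)])
qed

lemma posdef_mexp:
  fixes A :: "'g::finite op"
  assumes "D > 0" "finite X" "selfadj D X A"
  shows "posdef D X (mexp D X A)"
proof -
  obtain Q Q' where Q: "canon D X Q" "selfadj D X Q"
    "mexp D X A = opmult D X Q Q" "opmult D X Q' Q = idop D X"
    using selfadj_mexpE[OF assms] .
  define N where "N = opnorm D X Q' + 1"
  have N: "N > 0" "opnorm D X Q' \<le> N" using opnorm_nonneg[OF assms(2), of D Q'] by (auto simp: N_def)
  have "1 / N\<^sup>2 * (vnorm D X v)\<^sup>2 \<le> Re (qform D X (mexp D X A) v)" for v
  proof -
    have "vnorm D X v = vnorm D X (opapply D X Q' (opapply D X Q v))"
      using assms(2) by (intro vnorm_cong) (simp add: Q(4) opapply_idop flip: opapply_opmult)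
    also have "\<dots> \<le> N * vnorm D X (opapply D X Q v)"
      using vnorm_opapply_le[OF assms(2)] N(2) by (meson mult_right_mono order_trans vnorm_nonneg)
    finally have "(vnorm D X v)\<^sup>2 \<le> N\<^sup>2 * (vnorm D X (opapply D X Q v))\<^sup>2"
      by (metis power_mono power_mult_distrib vnorm_nonneg)
    then show ?thesis
      using N(1) by (simp add: Q(3) qform_selfadj_square[OF assms(2) Q(2,1)] field_simps)
  qed
  moreover have "1 / N\<^sup>2 > 0" using N(1) by simp
  ultimately show ?thesis
    unfolding posdef_def using canon_mexp selfadj_mexp assms by blast
qed

lemma optrace_commute: "optrace D X (opmult D X A B) = optrace D X (opmult D X B A)"
  unfolding optrace_def opmult_def by (simp add: mult.commute) (rule sum.swap)

lemma cmod_optrace_mult_mexp_le: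
  fixes A :: "'g::finite op"
  assumes "D > 0" "finite X" "selfadj D X A"
  shows "cmod (optrace D X (opmult D X V (mexp D X A))) \<le> opnorm D X V * Re (optrace D X (mexp D X A))"
proof -
  obtain Q Q' where Q: "canon D X Q" "selfadj D X Q" "mexp D X A = opmult D X Q Q"
    using selfadj_mexpE[OF assms] by metis
  have row: "opmult D X Q (opmult D X V Q) \<sigma> \<sigma> = qform D X V (opapply D X Q (basis_vect \<sigma>))"
    "mexp D X A \<sigma> \<sigma> = complex_of_real ((vnorm D X (opapply D X Q (basis_vect \<sigma>)))\<^sup>2)"
    if "\<sigma> \<in> conf D X" for \<sigma>
    using that assms(2) Q(1,2)
    by (simp_all add: Q(3) qform_selfadj_sandwich qform_selfadj_square flip: qform_basis_vect)
  have "optrace D X (opmult D X V (mexp D X A)) = optrace D X (opmult D X Q (opmult D X V Q))"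
    unfolding Q(3) by (metis optrace_commute opmult_assoc)
  then have "cmod (optrace D X (opmult D X V (mexp D X A)))
      \<le> (\<Sum>\<sigma>\<in>conf D X. cmod (qform D X V (opapply D X Q (basis_vect \<sigma>))))"
    by (simp add: optrace_def row sum_norm_le)
  also have "\<dots> \<le> (\<Sum>\<sigma>\<in>conf D X. opnorm D X V * (vnorm D X (opapply D X Q (basis_vect \<sigma>)))\<^sup>2)"
    by (intro sum_mono cmod_qform_le assms)
  also have "\<dots> = opnorm D X V * Re (optrace D X (mexp D X A))"
    by (simp add: optrace_def row sum_distrib_left)
  finally show ?thesis .
qed

lemma posdef_optrace:
  assumes "D > 0" "finite X" "posdef D X M"
  shows "Re (optrace D X M) > 0" "optrace D X M = complex_of_real (Re (optrace D X M))"
proof -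
  obtain \<delta> where \<delta>: "\<delta> > 0" "\<And>v. \<delta> * (vnorm D X v)\<^sup>2 \<le> Re (qform D X M v)"
    using assms(3) unfolding posdef_def by blast
  have "Re (M \<sigma> \<sigma>) > 0" if "\<sigma> \<in> conf D X" for \<sigma>
    using \<delta>(1) \<delta>(2)[of "basis_vect \<sigma>"] that assms(2) by (simp add: vnorm_basis_vect qform_basis_vect)
  then show "Re (optrace D X M) > 0"
    using assms conf_nonempty[of D X] by (simp add: optrace_def sum_pos)
  have "M \<sigma> \<sigma> = complex_of_real (Re (M \<sigma> \<sigma>))" if "\<sigma> \<in> conf D X" for \<sigma>
    using selfadjD[of D X M \<sigma> \<sigma>] assms(3) that by (simp add: posdef_def complex_eq_iff)
  then show "optrace D X M = complex_of_real (Re (optrace D X M))"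
    by (simp add: optrace_def)
qed

lemma vnorm_diff_scale_power2:
  fixes t :: real
  shows "(vnorm D X (\<lambda>\<sigma>. v \<sigma> - complex_of_real t * w \<sigma>))\<^sup>2
    = (vnorm D X v)\<^sup>2 - 2 * t * Re (\<Sum>\<sigma>\<in>conf D X. cnj (v \<sigma>) * w \<sigma>) + t\<^sup>2 * (vnorm D X w)\<^sup>2"
proof -
  have "(cmod (x - complex_of_real t * y))\<^sup>2 = (cmod x)\<^sup>2 - 2 * t * Re (cnj x * y) + t\<^sup>2 * (cmod y)\<^sup>2"
    for x y :: complex
    by (simp only: cmod_power2) (simp add: power2_eq_square algebra_simps)
  then show ?thesis
    by (simp only: vnorm_power2 Re_sum sum.distrib sum_subtractf sum_distrib_left)
qed

lemma posdef_opnorm_idop_diff: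
  assumes "finite X" "posdef D X M"
  obtains t where "t > 0" "opnorm D X (opsub D X (idop D X) (opscale D X (complex_of_real t) M)) < 1"
proof -
  obtain \<delta> where \<delta>: "\<delta> > 0" "\<And>v. \<delta> * (vnorm D X v)\<^sup>2 \<le> Re (qform D X M v)"
    using assms(2) unfolding posdef_def by blast
  define m where "m = opnorm D X M + 1"
  have m: "m > 0" "opnorm D X M \<le> m" using opnorm_nonneg[OF assms(1), of D M] by (auto simp: m_def)
  define t where "t = \<delta> / m\<^sup>2"
  have t: "t > 0" using \<delta> m by (simp add: t_def)
  define q where "q = sqrt (max 0 (1 - \<delta>\<^sup>2 / m\<^sup>2))"
  have q: "q \<ge> 0" "q < 1" using \<delta> m by (auto simp: q_def)
  have "opnorm D X (opsub D X (idop D X) (opscale D X (complex_of_real t) M)) \<le> q"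
  proof (rule opnorm_leI[OF q(1)])
    fix v
    have "(vnorm D X (opapply D X (opsub D X (idop D X) (opscale D X (complex_of_real t) M)) v))\<^sup>2
        = (vnorm D X (\<lambda>\<sigma>. v \<sigma> - complex_of_real t * opapply D X M v \<sigma>))\<^sup>2"
      using assms(1) by (simp add: opapply_opsub opapply_opscale opapply_idop cong: vnorm_cong)
    also have "\<dots> = (vnorm D X v)\<^sup>2 - 2 * t * Re (qform D X M v) + t\<^sup>2 * (vnorm D X (opapply D X M v))\<^sup>2"
      by (simp only: vnorm_diff_scale_power2 qform_def)
    also have "\<dots> \<le> (vnorm D X v)\<^sup>2 - 2 * t * (\<delta> * (vnorm D X v)\<^sup>2) + t\<^sup>2 * (m * vnorm D X v)\<^sup>2"
    proof -
      have "vnorm D X (opapply D X M v) \<le> m * vnorm D X v"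
        using vnorm_opapply_le[OF assms(1)] m(2) by (meson mult_right_mono order_trans vnorm_nonneg)
      then show ?thesis
        using \<delta>(2)[of v] t by (intro add_mono diff_mono mult_left_mono power_mono) auto
    qed
    also have "\<dots> = (1 - \<delta>\<^sup>2 / m\<^sup>2) * (vnorm D X v)\<^sup>2"
      using m by (simp add: t_def power2_eq_square field_simps)
    also have "\<dots> \<le> (q * vnorm D X v)\<^sup>2"
      by (simp add: q_def power_mult_distrib mult_right_mono)
    finally show "vnorm D X (opapply D X (opsub D X (idop D X) (opscale D X (complex_of_real t) M)) v)
        \<le> q * vnorm D X v"
      by (rule power2_le_imp_le) (use q in simp)
  qed
  then show thesis using that t q(2) by force
qed

lemma opmult_idop_diff_commute:
  assumes "finite X" "canon D X B" "opmult D X M B = opmult D X B M"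
  shows "opmult D X (opsub D X (idop D X) (opscale D X c M)) B
    = opmult D X B (opsub D X (idop D X) (opscale D X c M))"
  by (simp add: opmult_opsub_left opmult_opsub_right opmult_opscale_left opmult_opscale_right
      opmult_idop_left opmult_idop_right assms)

lemma selfadj_log_series:
  assumes "D > 0" "finite X" "norm F < 1" "selfadj D X (component F D X)"
  shows "selfadj D X (component (log_series F) D X)"
proof (rule selfadj_component_sums[OF log_series_sums[OF assms(3)]])
  show "selfadj D X (component (F ^ Suc n /\<^sub>R real (Suc n)) D X)" for n
    unfolding component_scaleR by (intro selfadj_opscale selfadj_component_power assms)
qed

text \<open>For small \<open>t\<close> the operator \<open>1 - t M\<close> has norm less than 1, so the logarithm series converges.\<close>

lemma posdef_logE:
  fixes M :: "'g::finite op"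
  assumes D: "D > 0" "finite X" and M: "posdef D X M"
  obtains K where "canon D X K" "selfadj D X K" "mexp D X K = M"
    "\<And>B. canon D X B \<Longrightarrow> opmult D X M B = opmult D X B M \<Longrightarrow> opmult D X K B = opmult D X B K"
proof -
  have M_props: "canon D X M" "selfadj D X M" using M by (auto simp: posdef_def)
  obtain t where t: "t > 0" "opnorm D X (opsub D X (idop D X) (opscale D X (complex_of_real t) M)) < 1"
    using posdef_opnorm_idop_diff[OF D(2) M] .
  define R where "R = opsub D X (idop D X) (opscale D X (complex_of_real t) M)"
  define F where "F = of_op D X R"
  define L where "L = (- 1) *\<^sub>R log_series F + (- ln t) *\<^sub>R 1"
  have F: "component F D X = R"
    unfolding F_def by (rule component_of_op) (simp_all add: D R_def)
  have norm_F: "norm F < 1"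
    using norm_of_op_le[OF D(2)] t(2)[folded R_def] unfolding F_def by (rule order.strict_trans1)
  have "selfadj D X R"
    unfolding R_def by (intro selfadj_opsub selfadj_idop selfadj_opscale M_props)
  then have "selfadj D X (component L D X)"
    unfolding L_def component_plus component_scaleR component_one[OF D]
    by (intro selfadj_opadd selfadj_opscale selfadj_idop selfadj_log_series D norm_F) (simp add: F)
  moreover have "mexp D X (component L D X) = M"
  proof (rule canon_eqI[OF _ M_props(1)])
    have "exp L = (1 / t) *\<^sub>R (1 - F)"
      using t(1) unfolding L_def exp_add_scaleR_one
      by (simp add: exp_log_series[OF norm_F] exp_minus divide_inverse)
    then show "op_eq D X (mexp D X (component L D X)) M"
      using t(1) by (simp add: op_eq_def component_scaleR component_minus component_one F D R_def
          opscale_def opsub_def flip: component_exp)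
  qed (simp add: canon_mexp D)
  moreover have "opmult D X (component L D X) B = opmult D X B (component L D X)"
    if B: "canon D X B" "opmult D X M B = opmult D X B M" for B
  proof -
    have "F * of_op D X B = of_op D X B * F"
      unfolding F_def R_def of_op_opmult[symmetric] opmult_idop_diff_commute[OF D(2) B] ..
    then have "log_series F * of_op D X B = of_op D X B * log_series F"
      by (rule log_series_commutes[OF norm_F])
    then have "component (L * of_op D X B) D X = component (of_op D X B * L) D X"
      unfolding L_def by (simp add: algebra_simps)
    then show ?thesis by (simp add: component_times component_of_op D B(1))
  qed
  ultimately show thesis by (intro that[of "component L D X"]) auto
qed

lemma mexp_commutes:
  fixes A :: "'g::finite op"
  assumes "D > 0" "finite X" "canon D X A"
  shows "opmult D X (mexp D X A) A = opmult D X A (mexp D X A)"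
proof -
  have "component (exp (of_op D X A) * of_op D X A) D X
      = component (of_op D X A * exp (of_op D X A)) D X"
    by (simp add: exp_times_arg_commute)
  then show ?thesis by (simp add: component_times component_of_op mexp_eq_component assms)
qed

lemma mexp_inject_selfadj_commuting:
  fixes A :: "'g::finite op"
  assumes D: "D > 0" "finite X" and A: "canon D X A" "selfadj D X A"
    and B: "canon D X B" "selfadj D X B"
    and commute: "opmult D X A B = opmult D X B A" and eq: "mexp D X A = mexp D X B"
  shows "A = B"
proof (rule canon_eqI[OF A(1) B(1)])
  define S where "S = opadd D X A (opscale D X (- 1) B)"
  have "opmult D X A (opscale D X (- 1) B) = opmult D X (opscale D X (- 1) B) A"
    by (simp only: opmult_opscale_left opmult_opscale_right commute)
  then have "mexp D X S = opmult D X (mexp D X A) (mexp D X (opscale D X (- 1) B))"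
    unfolding S_def by (rule mexp_opadd_commuting[OF D])
  also have "\<dots> = idop D X" unfolding eq by (rule mexp_inverse(1)[OF D])
  finally have "mexp D X S = idop D X" .
  moreover have "selfadj D X S"
    unfolding S_def using A(2) B(2) selfadj_opscale[of D X B "- 1"] by (intro selfadj_opadd) simp_all
  ultimately have "S \<sigma> \<tau> = 0" if "\<sigma> \<in> conf D X" "\<tau> \<in> conf D X" for \<sigma> \<tau>
    using that by (intro selfadj_mexp_eq_idop[OF D]) (simp_all add: S_def)
  then show "op_eq D X A B" by (simp add: op_eq_def S_def opadd_def opscale_def)
qed

lemma posdef_ex1_log:
  fixes M :: "'g::finite op"
  assumes D: "D > 0" "finite X" and M: "posdef D X M"
  shows "\<exists>!K. canon D X K \<and> selfadj D X K \<and> op_eq D X (mexp D X K) M"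
proof -
  obtain K where K: "canon D X K" "selfadj D X K" "mexp D X K = M"
    "\<And>B. canon D X B \<Longrightarrow> opmult D X M B = opmult D X B M \<Longrightarrow> opmult D X K B = opmult D X B K"
    by (rule posdef_logE[OF assms], rule that)
  show ?thesis
  proof (rule ex1I[of _ K])
    show "canon D X K \<and> selfadj D X K \<and> op_eq D X (mexp D X K) M"
      using K by (simp add: op_eq_def)
  next
    fix K' assume K': "canon D X K' \<and> selfadj D X K' \<and> op_eq D X (mexp D X K') M"
    then have exp_K': "mexp D X K' = M"
      using M by (intro canon_eqI[OF canon_mexp[OF D]]) (auto simp: posdef_def)
    then have "opmult D X K K' = opmult D X K' K"
      using K' mexp_commutes[OF D, of K'] by (intro K(4)) auto
    then show "K' = K"
      using K(1-3) K' exp_K' mexp_inject_selfadj_commuting[OF D, of K K'] by simp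
  qed
qed

lemma oplog_posdef:
  fixes M :: "'g::finite op"
  assumes D: "D > 0" "finite X" and M: "posdef D X M"
  shows "canon D X (oplog D X M)" "selfadj D X (oplog D X M)" "mexp D X (oplog D X M) = M"
proof -
  have "canon D X (oplog D X M) \<and> selfadj D X (oplog D X M) \<and> op_eq D X (mexp D X (oplog D X M)) M"
    unfolding oplog_def by (rule theI'[OF posdef_ex1_log[OF assms]])
  then show "canon D X (oplog D X M)" "selfadj D X (oplog D X M)" "mexp D X (oplog D X M) = M"
    using canon_eqI[OF canon_mexp[OF D]] M by (auto simp: posdef_def)
qed

lemma opinv_mexp:
  fixes A :: "'g::finite op"
  assumes D: "D > 0" "finite X"
  shows "opinv D X (mexp D X A) = mexp D X (opscale D X (- 1) A)"
  unfolding opinv_def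
proof (rule the_equality)
  let ?E = "mexp D X A" and ?E' = "mexp D X (opscale D X (- 1) A)"
  show "canon D X ?E' \<and> op_eq D X (opmult D X ?E ?E') (idop D X)"
    using canon_mexp[OF D] mexp_inverse(1)[OF D] by (simp add: op_eq_def)
  fix B assume B: "canon D X B \<and> op_eq D X (opmult D X ?E B) (idop D X)"
  then have "opmult D X ?E B = idop D X" by (intro canon_eqI) auto
  then have "opmult D X (opmult D X ?E' ?E) B = opmult D X ?E' (idop D X)" by (simp only: opmult_assoc)
  then show "B = ?E'"
    using B by (simp add: mexp_inverse(2) opmult_idop_left opmult_idop_right canon_mexp D)
qed

section \<open>Partial traces\<close>

lemma ptrace_entry:
  assumes "L \<subseteq> Lam" "\<sigma> \<in> conf D L" "\<tau> \<in> conf D L"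
  shows "ptrace D Lam L M \<sigma> \<tau> = (\<Sum>\<rho>\<in>conf D (Lam - L). M (join L \<sigma> \<rho>) (join L \<tau> \<rho>))"
  using assms by (simp add: ptrace_def join_def Int_absorb1)

lemma canon_ptrace: "L \<subseteq> Lam \<Longrightarrow> canon D L (ptrace D Lam L M)"
  by (auto simp: canon_def ptrace_def Int_absorb1)

lemma ptrace_opscale:
  assumes "L \<subseteq> Lam"
  shows "ptrace D Lam L (opscale D Lam c M) = opscale D L c (ptrace D Lam L M)"
  by (rule canon_eqI[OF canon_ptrace[OF assms] canon_opscale])
    (simp add: op_eq_def ptrace_entry assms opscale_def join_in_conf sum_distrib_left)

lemma optrace_ptrace:
  assumes "L \<subseteq> Lam"
  shows "optrace D L (ptrace D Lam L M) = optrace D Lam M"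
  unfolding optrace_def sum_conf_join[OF assms] by (simp add: ptrace_entry assms)

lemma selfadj_ptrace:
  assumes "L \<subseteq> Lam" "selfadj D Lam M"
  shows "selfadj D L (ptrace D Lam L M)"
  using assms by (intro selfadjI) (simp add: ptrace_entry join_in_conf flip: selfadjD[OF assms(2)])

lemma qform_tensor_basis:
  assumes "L \<subseteq> Lam" "finite Lam" "\<rho> \<in> conf D (Lam - L)"
  shows "qform D Lam M (tensor_basis L Lam v \<rho>)
    = (\<Sum>\<sigma>\<in>conf D L. cnj (v \<sigma>) * (\<Sum>\<tau>\<in>conf D L. M (join L \<sigma> \<rho>) (join L \<tau> \<rho>) * v \<tau>))"
proof -
  have collapse: "(\<Sum>\<tau>\<in>conf D Lam. F \<tau> * tensor_basis L Lam v \<rho> \<tau>) = (\<Sum>\<tau>\<in>conf D L. F (join L \<tau> \<rho>) * v \<tau>)"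
    "(\<Sum>\<tau>\<in>conf D Lam. cnj (tensor_basis L Lam v \<rho> \<tau>) * F \<tau>) = (\<Sum>\<tau>\<in>conf D L. cnj (v \<tau>) * F (join L \<tau> \<rho>))"
    for F :: "'a cfg \<Rightarrow> complex"
    unfolding sum_conf_join[OF assms(1)] using assms(2,3)
    by (simp_all add: tensor_basis_join if_distrib[of "\<lambda>x. _ * x"]
        if_distrib[of "\<lambda>x. cnj x * _"] cong: if_cong)
  show ?thesis unfolding qform_def opapply_def collapse ..
qed

lemma qform_ptrace:
  assumes "L \<subseteq> Lam" "finite Lam"
  shows "qform D L (ptrace D Lam L M) v = (\<Sum>\<rho>\<in>conf D (Lam - L). qform D Lam M (tensor_basis L Lam v \<rho>))"
proof -
  have "qform D L (ptrace D Lam L M) v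
      = (\<Sum>\<sigma>\<in>conf D L. \<Sum>\<tau>\<in>conf D L. \<Sum>\<rho>\<in>conf D (Lam - L). cnj (v \<sigma>) * (M (join L \<sigma> \<rho>) (join L \<tau> \<rho>) * v \<tau>))"
    using assms by (simp add: qform_def opapply_def ptrace_entry sum_distrib_left sum_distrib_right)
  also have "\<dots> = (\<Sum>\<sigma>\<in>conf D L. \<Sum>\<rho>\<in>conf D (Lam - L).
      \<Sum>\<tau>\<in>conf D L. cnj (v \<sigma>) * (M (join L \<sigma> \<rho>) (join L \<tau> \<rho>) * v \<tau>))"
    by (intro sum.cong refl sum.swap)
  also have "\<dots> = (\<Sum>\<rho>\<in>conf D (Lam - L). \<Sum>\<sigma>\<in>conf D L.
      \<Sum>\<tau>\<in>conf D L. cnj (v \<sigma>) * (M (join L \<sigma> \<rho>) (join L \<tau> \<rho>) * v \<tau>))"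
    by (rule sum.swap)
  finally show ?thesis using assms by (simp add: qform_tensor_basis sum_distrib_left)
qed

lemma posdef_ptrace:
  assumes "D > 0" "L \<subseteq> Lam" "finite Lam" "posdef D Lam M"
  shows "posdef D L (ptrace D Lam L M)"
proof -
  obtain \<delta> where \<delta>: "\<delta> > 0" "\<And>v. \<delta> * (vnorm D Lam v)\<^sup>2 \<le> Re (qform D Lam M v)"
    using assms(4) unfolding posdef_def by blast
  obtain \<rho> where \<rho>: "\<rho> \<in> conf D (Lam - L)" using conf_nonempty[OF assms(1)] by blast
  have "\<delta> * (vnorm D L v)\<^sup>2 \<le> Re (qform D L (ptrace D Lam L M) v)" for v
  proof -
    have "\<delta> * (vnorm D L v)\<^sup>2 \<le> (\<Sum>\<rho>\<in>conf D (Lam - L). \<delta> * (vnorm D L v)\<^sup>2)"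
      using \<delta>(1) \<rho> assms(3) by (intro member_le_sum[of \<rho> _ "\<lambda>_. \<delta> * (vnorm D L v)\<^sup>2"]) auto
    also have "\<dots> \<le> (\<Sum>\<rho>\<in>conf D (Lam - L). Re (qform D Lam M (tensor_basis L Lam v \<rho>)))"
      using \<delta>(2) assms(2,3) by (intro sum_mono) (metis vnorm_tensor_basis)
    finally show ?thesis by (simp add: qform_ptrace assms(2,3))
  qed
  then show ?thesis
    using assms \<delta>(1) canon_ptrace selfadj_ptrace unfolding posdef_def by blast
qed

section \<open>Decay of interactions across the boundary\<close>

lemma ex_boundary_in_box:
  fixes x c :: "'g::finite site"
  assumes "x \<in> A" "c \<notin> A"
  obtains y where "y \<in> bdry A" "\<And>i. min (x $ i) (c $ i) \<le> y $ i \<and> y $ i \<le> max (x $ i) (c $ i)"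
proof -
  define box where "box y \<longleftrightarrow> (\<forall>i. min (x $ i) (c $ i) \<le> y $ i \<and> y $ i \<le> max (x $ i) (c $ i))" for y
  define len where "len y = nat (\<Sum>i\<in>UNIV. \<bar>c $ i - y $ i\<bar>)" for y
  have "x \<in> A \<and> box x" using assms by (simp add: box_def)
  then obtain y where y: "y \<in> A" "box y" and minimal: "\<And>z. z \<in> A \<Longrightarrow> box z \<Longrightarrow> len y \<le> len z"
    using ex_has_least_nat[of "\<lambda>y. y \<in> A \<and> box y" x len] by blast
  have "y \<noteq> c" using y assms by auto
  then obtain j where j: "y $ j \<noteq> c $ j" by (auto simp: vec_eq_iff)
  define z where "z = (\<chi> i. if i = j then y $ j + sgn (c $ j - y $ j) else y $ i)"
  have z_nth: "z $ i = (if i = j then y $ j + sgn (c $ j - y $ j) else y $ i)" for i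
    by (simp add: z_def)
  have "box z"
    unfolding box_def
  proof
    fix i
    show "min (x $ i) (c $ i) \<le> z $ i \<and> z $ i \<le> max (x $ i) (c $ i)"
      using y(2)[unfolded box_def, rule_format, of i] j by (auto simp: z_nth sgn_if)
  qed
  moreover have "len z < len y"
  proof -
    have "(\<Sum>i\<in>UNIV. \<bar>c $ i - z $ i\<bar>) < (\<Sum>i\<in>UNIV. \<bar>c $ i - y $ i\<bar>)"
      using j by (intro sum_strict_mono_ex1) (auto simp: z_nth sgn_if)
    moreover have "(\<Sum>i\<in>UNIV. \<bar>c $ i - z $ i\<bar>) \<ge> 0" by (simp add: sum_nonneg)
    ultimately show ?thesis unfolding len_def by linarith
  qed
  ultimately have "z \<notin> A" using minimal[of z] by fastforce
  moreover have "rv z - rv y = real_of_int (sgn (c $ j - y $ j)) *\<^sub>R axis j 1"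
    by (auto simp: rv_def vec_eq_iff z_nth axis_def)
  then have "dist (rv y) (rv z) \<le> 1"
    by (simp add: dist_norm norm_minus_commute[of "rv y"] norm_axis_1 sgn_if)
  ultimately have "y \<in> bdry A" using y(1) by (auto simp: bdry_def)
  then show thesis using y(2) that by (simp add: box_def)
qed

lemma ex_boundary_closer:
  fixes x c :: "'g::finite site"
  assumes "x \<in> A" "c \<notin> A"
  obtains y where "y \<in> bdry A" "dist (rv x) (rv y) \<le> dist (rv x) (rv c)"
proof (rule ex_boundary_in_box[OF assms])
  fix y assume y: "y \<in> bdry A" "\<And>i. min (x $ i) (c $ i) \<le> y $ i \<and> y $ i \<le> max (x $ i) (c $ i)"
  have "norm (rv x - rv y) \<le> norm (rv x - rv c)"
  proof (rule norm_le_componentwise_cart)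
    fix i
    have "\<bar>x $ i - y $ i\<bar> \<le> \<bar>x $ i - c $ i\<bar>" using y(2)[of i] by linarith
    then have "real_of_int \<bar>x $ i - y $ i\<bar> \<le> real_of_int \<bar>x $ i - c $ i\<bar>" by (simp only: of_int_le_iff)
    then show "norm ((rv x - rv y) $ i) \<le> norm ((rv x - rv c) $ i)" by (simp add: rv_def)
  qed
  then show thesis using that[OF y(1)] by (simp add: dist_norm)
qed

lemma sum_exp_abs_int_le:
  fixes a :: real
  assumes "a > 0" "finite T"
  shows "(\<Sum>k\<in>T. exp (- a * \<bar>real_of_int k\<bar>)) \<le> 2 / (1 - exp (- a))"
proof -
  have half: "(\<Sum>k\<in>S. exp (- a * \<bar>real_of_int k\<bar>)) \<le> 1 / (1 - exp (- a))"
    if "finite S" "inj_on (\<lambda>k. nat \<bar>k\<bar>) S" for S :: "int set"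
  proof -
    have "exp (- a * \<bar>real_of_int k\<bar>) = exp (- a) ^ nat \<bar>k\<bar>" for k
      by (simp add: exp_of_nat_mult[symmetric] mult.commute)
    then have "(\<Sum>k\<in>S. exp (- a * \<bar>real_of_int k\<bar>)) = (\<Sum>n\<in>(\<lambda>k. nat \<bar>k\<bar>) ` S. exp (- a) ^ n)"
      by (simp add: sum.reindex[OF that(2)])
    also have "\<dots> \<le> (\<Sum>n. exp (- a) ^ n)"
      using assms(1) that(1) by (intro sum_le_suminf summable_geometric) auto
    also have "\<dots> = 1 / (1 - exp (- a))" using assms(1) by (simp add: suminf_geometric)
    finally show ?thesis .
  qed
  have "(\<Sum>k\<in>T. exp (- a * \<bar>real_of_int k\<bar>))
      = (\<Sum>k\<in>T \<inter> {0..}. exp (- a * \<bar>real_of_int k\<bar>)) + (\<Sum>k\<in>T - {0..}. exp (- a * \<bar>real_of_int k\<bar>))"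
    by (rule sum.Int_Diff[OF assms(2)])
  also have "\<dots> \<le> 1 / (1 - exp (- a)) + 1 / (1 - exp (- a))"
    using assms(2) by (intro add_mono half) (auto simp: inj_on_def)
  finally show ?thesis by simp
qed

definition lattice_sum_bound :: "'g::finite itself \<Rightarrow> real \<Rightarrow> real" where
  "lattice_sum_bound _ a = (2 / (1 - exp (- (a / CARD('g))))) ^ CARD('g)"

lemma lattice_sum_bound_pos: "a > 0 \<Longrightarrow> lattice_sum_bound TYPE('g::finite) a > 0"
  by (simp add: lattice_sum_bound_def)

lemma exp_dist_le_prod:
  fixes x y :: "'g::finite site"
  assumes "a > 0"
  shows "exp (- a * dist (rv x) (rv y)) \<le>
    (\<Prod>i\<in>UNIV. exp (- (a / CARD('g)) * \<bar>real_of_int (x $ i - y $ i)\<bar>))"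
proof -
  have "\<bar>real_of_int (x $ i - y $ i)\<bar> \<le> dist (rv x) (rv y)" for i
    using component_le_norm_cart[of "rv x - rv y" i] by (simp add: dist_norm rv_def)
  then have "(\<Sum>i\<in>(UNIV::'g set). \<bar>real_of_int (x $ i - y $ i)\<bar>) \<le> CARD('g) * dist (rv x) (rv y)"
    using sum_bounded_above[of UNIV "\<lambda>i. \<bar>real_of_int (x $ i - y $ i)\<bar>"] by simp
  then have "a / CARD('g) * (\<Sum>i\<in>(UNIV::'g set). \<bar>real_of_int (x $ i - y $ i)\<bar>)
      \<le> a / CARD('g) * (CARD('g) * dist (rv x) (rv y))"
    using assms by (intro mult_left_mono) auto
  then have "- a * dist (rv x) (rv y) \<le> (\<Sum>i\<in>UNIV. - (a / CARD('g)) * \<bar>real_of_int (x $ i - y $ i)\<bar>)"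
    by (simp add: sum_distrib_left sum_negf)
  then show ?thesis by (simp flip: exp_sum)
qed

lemma sum_exp_dist_le:
  fixes y :: "'g::finite site"
  assumes "a > 0" "finite S"
  shows "(\<Sum>x\<in>S. exp (- a * dist (rv x) (rv y))) \<le> lattice_sum_bound TYPE('g) a"
proof -
  define a' where "a' = a / CARD('g)"
  have a': "a' > 0" using assms(1) by (simp add: a'_def)
  define \<phi> where "\<phi> x = (\<lambda>i. x $ i - y $ i)" for x :: "'g site"
  define T where "T = (\<lambda>(x, i). \<phi> x i) ` (S \<times> UNIV)"
  have T: "finite T" "\<phi> ` S \<subseteq> (\<Pi>\<^sub>E i\<in>UNIV. T)"
    using assms(2) by (auto simp: T_def)
  have inj: "inj_on \<phi> S" by (auto simp: inj_on_def \<phi>_def fun_eq_iff vec_eq_iff)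
  have "(\<Sum>x\<in>S. exp (- a * dist (rv x) (rv y))) \<le> (\<Sum>x\<in>S. \<Prod>i\<in>UNIV. exp (- a' * \<bar>real_of_int (\<phi> x i)\<bar>))"
    unfolding a'_def \<phi>_def by (intro sum_mono exp_dist_le_prod assms)
  also have "\<dots> = (\<Sum>z\<in>\<phi> ` S. \<Prod>i\<in>UNIV. exp (- a' * \<bar>real_of_int (z i)\<bar>))"
    by (simp add: sum.reindex[OF inj])
  also have "\<dots> \<le> (\<Sum>z\<in>(\<Pi>\<^sub>E i\<in>(UNIV::'g set). T). \<Prod>i\<in>UNIV. exp (- a' * \<bar>real_of_int (z i)\<bar>))"
    by (intro sum_mono2 finite_PiE T finite prod_nonneg) auto
  also have "\<dots> = (\<Prod>i\<in>(UNIV::'g set). \<Sum>k\<in>T. exp (- a' * \<bar>real_of_int k\<bar>))"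
    by (rule prod_sum_PiE[symmetric]) (simp_all add: T)
  also have "\<dots> \<le> (\<Prod>i\<in>(UNIV::'g set). 2 / (1 - exp (- a')))"
    by (intro prod_mono conjI sum_exp_abs_int_le a' T sum_nonneg) auto
  finally show ?thesis by (simp add: lattice_sum_bound_def a'_def)
qed

definition decay_weight :: "nat \<Rightarrow> ('g::finite site set \<Rightarrow> 'g op) \<Rightarrow> real \<Rightarrow> real \<Rightarrow>
    'g site set \<Rightarrow> real" where
  "decay_weight D Psi lam mu X = opnorm D X (Psi X) * exp (lam * card X + mu * sdiam X)"

lemma decay_weight_nonneg: "finite X \<Longrightarrow> decay_weight D Psi lam mu X \<ge> 0"
  by (simp add: decay_weight_def opnorm_nonneg)

lemma sum_decay_weight_le:
  assumes "decay_bound D Psi lam mu Delta" "finite I" "\<And>X. X \<in> I \<Longrightarrow> finite X"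
  shows "(\<Sum>X\<in>{X\<in>I. x \<in> X}. decay_weight D Psi lam mu X) \<le> Delta"
proof -
  have bound: "decay_weight D Psi lam mu summable_on {X. finite X \<and> x \<in> X}"
    "infsum (decay_weight D Psi lam mu) {X. finite X \<and> x \<in> X} \<le> Delta"
    using assms(1) unfolding decay_bound_def decay_weight_def[abs_def] by auto
  have "(\<Sum>X\<in>{X\<in>I. x \<in> X}. decay_weight D Psi lam mu X)
      \<le> infsum (decay_weight D Psi lam mu) {X. finite X \<and> x \<in> X}"
    by (rule finite_sum_le_infsum[OF bound(1)]) (use assms in \<open>auto simp: decay_weight_nonneg\<close>)
  then show ?thesis using bound(2) by linarith
qed

lemma opnorm_exp_card_le_decay_weight:
  fixes lam mu :: real
  assumes "mu \<ge> 0" "finite X"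
  shows "opnorm D X (Psi X) * exp (lam * card X) \<le> decay_weight D Psi lam mu X"
proof -
  have "sdiam X \<ge> 0" unfolding sdiam_def using assms(2) by (intro diameter_ge_0 finite_imp_bounded) simp
  then show ?thesis
    unfolding decay_weight_def using assms by (intro mult_left_mono opnorm_nonneg) auto
qed

lemma exp_sdiam_le_boundary_sum:
  fixes A C X :: "'g::finite site set"
  assumes "mu \<ge> 0" "finite X" "finite A" "A \<inter> C = {}" and x: "x \<in> X" "x \<in> A" and meets: "X \<inter> C \<noteq> {}"
  shows "exp (- mu * sdiam X)
    \<le> exp (- (mu / 2) * sdist A C) * (\<Sum>y\<in>bdry A. exp (- (mu / 2) * dist (rv x) (rv y)))"
proof -
  obtain c where c: "c \<in> X" "c \<in> C" using meets by blast
  then have "c \<notin> A" using assms(4) by blast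
  obtain y where y: "y \<in> bdry A" "dist (rv x) (rv y) \<le> dist (rv x) (rv c)"
    using ex_boundary_closer[OF x(2) \<open>c \<notin> A\<close>] .
  have "sdist A C \<le> dist (rv x) (rv c)"
    unfolding sdist_def using x c by (intro setdist_le_dist) auto
  moreover have "dist (rv x) (rv c) \<le> sdiam X"
    unfolding sdiam_def using x c assms(2) by (intro diameter_bounded_bound finite_imp_bounded) auto
  ultimately have "sdist A C + dist (rv x) (rv y) \<le> 2 * sdiam X" using y(2) by linarith
  then have "mu / 2 * (sdist A C + dist (rv x) (rv y)) \<le> mu / 2 * (2 * sdiam X)"
    using assms(1) by (intro mult_left_mono) auto
  then have "exp (- mu * sdiam X)
      \<le> exp (- (mu / 2) * sdist A C) * exp (- (mu / 2) * dist (rv x) (rv y))"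
    by (simp add: algebra_simps flip: exp_add)
  also have "\<dots> \<le> exp (- (mu / 2) * sdist A C) * (\<Sum>y\<in>bdry A. exp (- (mu / 2) * dist (rv x) (rv y)))"
    using y(1) assms(3)
    by (intro mult_left_mono member_le_sum[of y _ "\<lambda>y. exp (- (mu / 2) * dist (rv x) (rv y))"])
      (auto simp: bdry_def)
  finally show ?thesis .
qed

lemma decay_across_boundary:
  fixes Psi :: "'g::finite site set \<Rightarrow> 'g op" and lam mu Delta :: real
  assumes decay: "decay_bound D Psi lam mu Delta" and "mu > 0" "Delta \<ge> 0"
    and Lam: "finite Lam" "A \<subseteq> Lam" and disjoint: "A \<inter> C = {}"
  shows "(\<Sum>X\<in>{X. X \<subseteq> Lam \<and> X \<inter> A \<noteq> {} \<and> X \<inter> C \<noteq> {}}. opnorm D X (Psi X) * exp (lam * card X))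
    \<le> Delta * lattice_sum_bound TYPE('g) (mu / 2) * card (bdry A) * exp (- (mu / 2) * sdist A C)"
proof -
  define I where "I = {X. X \<subseteq> Lam \<and> X \<inter> C \<noteq> {}}"
  define W where "W X = opnorm D X (Psi X) * exp (lam * card X)" for X
  define e where "e = exp (- (mu / 2) * sdist A C)"
  define E where "E x = (\<Sum>y\<in>bdry A. exp (- (mu / 2) * dist (rv x) (rv y)))" for x
  have "finite A" using Lam finite_subset by blast
  have I: "finite I" "\<And>X. X \<in> I \<Longrightarrow> finite X" using Lam(1) by (auto simp: I_def intro: finite_subset)
  have W_le: "W X \<le> decay_weight D Psi lam mu X * (e * E x)" if X: "X \<in> I" "x \<in> X" "x \<in> A" for X x
  proof -
    have "W X = decay_weight D Psi lam mu X * exp (- mu * sdiam X)"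
      by (simp add: W_def decay_weight_def flip: exp_add)
    also have "\<dots> \<le> decay_weight D Psi lam mu X * (e * E x)"
      unfolding e_def E_def using X I \<open>mu > 0\<close> \<open>finite A\<close> disjoint
      by (intro mult_left_mono exp_sdiam_le_boundary_sum decay_weight_nonneg) (auto simp: I_def)
    finally show ?thesis .
  qed
  have "(\<Sum>X\<in>{X\<in>I. X \<inter> A \<noteq> {}}. W X) \<le> (\<Sum>x\<in>A. \<Sum>X\<in>{X\<in>I. x \<in> X}. W X)"
    using I \<open>finite A\<close> by (intro sum_meeting_le) (auto simp: W_def opnorm_nonneg)
  also have "\<dots> \<le> (\<Sum>x\<in>A. (\<Sum>X\<in>{X\<in>I. x \<in> X}. decay_weight D Psi lam mu X) * (e * E x))"
    unfolding sum_distrib_right using W_le by (intro sum_mono) auto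
  also have "\<dots> \<le> (\<Sum>x\<in>A. Delta * (e * E x))"
    using sum_decay_weight_le[OF decay I] by (intro sum_mono mult_right_mono)
      (auto simp: e_def E_def sum_nonneg)
  also have "\<dots> = Delta * e * (\<Sum>x\<in>A. E x)"
    by (simp add: sum_distrib_left mult.assoc)
  also have "(\<Sum>x\<in>A. E x) = (\<Sum>y\<in>bdry A. \<Sum>x\<in>A. exp (- (mu / 2) * dist (rv x) (rv y)))"
    unfolding E_def by (rule sum.swap)
  also have "Delta * e * \<dots> \<le> Delta * e * (card (bdry A) * lattice_sum_bound TYPE('g) (mu / 2))"
    using \<open>mu > 0\<close> \<open>Delta \<ge> 0\<close> \<open>finite A\<close>
    by (intro mult_left_mono sum_bounded_above sum_exp_dist_le) (auto simp: e_def)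
  also have "{X\<in>I. X \<inter> A \<noteq> {}} = {X. X \<subseteq> Lam \<and> X \<inter> A \<noteq> {} \<and> X \<inter> C \<noteq> {}}" by (auto simp: I_def)
  finally show ?thesis by (simp add: W_def e_def mult_ac)
qed

section \<open>Marginals of Gibbs states\<close>

lemma selfadj_ham:
  assumes "local_interaction D Phi" "finite Lam"
  shows "selfadj D Lam (ham D Phi Lam)"
proof (rule selfadjI)
  fix \<sigma> \<tau> assume conf: "\<sigma> \<in> conf D Lam" "\<tau> \<in> conf D Lam"
  have "selfadj D Lam (emb D X Lam (Phi X))" if "X \<subseteq> Lam" for X
    using assms that by (intro selfadj_emb) (auto simp: local_interaction_def intro: finite_subset)
  then show "ham D Phi Lam \<sigma> \<tau> = cnj (ham D Phi Lam \<tau> \<sigma>)"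
    unfolding ham_def cnj_sum using conf by (intro sum.cong) (auto intro: selfadjD)
qed

lemma posdef_bexp:
  fixes Lam :: "'g::finite site set"
  assumes "D > 0" "local_interaction D Phi" "finite Lam"
  shows "posdef D Lam (bexp D Phi \<beta> Lam)"
  unfolding bexp_def using assms by (intro posdef_mexp selfadj_opscale selfadj_ham)

lemma Zpart_pos:
  fixes Lam :: "'g::finite site set"
  assumes "D > 0" "local_interaction D Phi" "finite Lam"
  shows "Zpart D Phi \<beta> Lam > 0"
  unfolding Zpart_def by (rule posdef_optrace(1)[OF assms(1,3) posdef_bexp[OF assms]])

lemma optrace_bexp:
  fixes Lam :: "'g::finite site set"
  assumes "D > 0" "local_interaction D Phi" "finite Lam"
  shows "optrace D Lam (bexp D Phi \<beta> Lam) = complex_of_real (Zpart D Phi \<beta> Lam)"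
  unfolding Zpart_def by (rule posdef_optrace(2)[OF assms(1,3) posdef_bexp[OF assms]])

lemma red_eq_opscale_ptrace:
  assumes "L \<subseteq> Lam"
  shows "red D Phi \<beta> Lam L
    = opscale D L (complex_of_real (1 / Zpart D Phi \<beta> Lam)) (ptrace D Lam L (bexp D Phi \<beta> Lam))"
  by (simp add: red_def gibbs_def ptrace_opscale assms)

lemma optrace_red:
  fixes Lam :: "'g::finite site set"
  assumes "D > 0" "local_interaction D Phi" "finite Lam" "L \<subseteq> Lam"
  shows "optrace D L (red D Phi \<beta> Lam L) = 1"
proof -
  have "optrace D L (red D Phi \<beta> Lam L)
      = complex_of_real (1 / Zpart D Phi \<beta> Lam) * optrace D Lam (bexp D Phi \<beta> Lam)"
    unfolding red_eq_opscale_ptrace[OF assms(4)] optrace_ptrace[OF assms(4), symmetric]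
    by (simp add: optrace_def opscale_def sum_distrib_left)
  then show ?thesis using Zpart_pos[OF assms(1-3), of \<beta>] by (simp add: optrace_bexp assms(1-3))
qed

definition marginal_ratio ::
  "nat \<Rightarrow> ('g::finite site set \<Rightarrow> 'g op) \<Rightarrow> real \<Rightarrow> 'g site set \<Rightarrow> 'g site set \<Rightarrow> 'g site set \<Rightarrow> 'g op" where
  "marginal_ratio D Phi \<beta> Lam A C = opmult D (A \<union> C) (red D Phi \<beta> Lam (A \<union> C))
     (opmult D (A \<union> C) (emb D A (A \<union> C) (opinv D A (red D Phi \<beta> Lam A)))
       (emb D C (A \<union> C) (opinv D C (red D Phi \<beta> Lam C))))"

lemma marginal_ratio_commute:
  assumes "A \<inter> C = {}" "finite A" "finite C"
  shows "marginal_ratio D Phi \<beta> Lam A C = marginal_ratio D Phi \<beta> Lam C A"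
  using emb_commute_disjoint[of A "A \<union> C" C D] assms by (simp add: marginal_ratio_def Un_commute)

lemma emb_mexp_product:
  fixes A C :: "'g::finite site set"
  assumes "D > 0" "finite A" "finite C" "A \<inter> C = {}"
  shows "opmult D (A \<union> C) (emb D A (A \<union> C) (mexp D A a)) (emb D C (A \<union> C) (mexp D C c))
    = mexp D (A \<union> C) (opadd D (A \<union> C) (emb D A (A \<union> C) a) (emb D C (A \<union> C) c))"
  using assms emb_commute_disjoint[of A "A \<union> C" C D a c] by (simp add: emb_mexp mexp_opadd_commuting)

lemma emb_mexp_component:
  fixes Lam :: "'g::finite site set"
  assumes "D > 0" "finite Lam" "S \<subseteq> Lam" "emb D S Lam G = component F D Lam"
  shows "emb D S Lam (mexp D S G) = component (exp F) D Lam"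
  using assms by (simp add: emb_mexp component_exp)

lemma emb_mexp_quotient:
  fixes Lam :: "'g::finite site set"
  assumes D: "D > 0" "finite Lam" "S \<subseteq> Lam"
    and G: "emb D S Lam G = component (F + c *\<^sub>R 1) D Lam"
    and G': "emb D S Lam G' = component (F' + c' *\<^sub>R 1) D Lam"
  shows "emb D S Lam (opmult D S (mexp D S G) (mexp D S (opscale D S (- 1) G')))
    = component (exp (c - c') *\<^sub>R (exp F * exp (- F'))) D Lam"
proof -
  have "emb D S Lam (opscale D S (- 1) G') = component (- F' + (- c') *\<^sub>R 1) D Lam"
    using component_scaleR[of "- 1" "F' + c' *\<^sub>R 1" D Lam] by (simp add: emb_opscale D G')
  then have "emb D S Lam (opmult D S (mexp D S G) (mexp D S (opscale D S (- 1) G')))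
      = component (exp (F + c *\<^sub>R 1) * exp (- F' + (- c') *\<^sub>R 1)) D Lam"
    by (simp only: emb_opmult[OF D(3,2)] emb_mexp_component[OF D] G component_times)
  also have "exp (F + c *\<^sub>R 1) * exp (- F' + (- c') *\<^sub>R 1) = exp (c - c') *\<^sub>R (exp F * exp (- F'))"
    unfolding exp_add_scaleR_one by (simp add: exp_diff exp_minus divide_inverse)
  finally show ?thesis .
qed

lemma opnorm_diff_idop_le:
  fixes Lam :: "'g::finite site set"
  assumes "D > 0" "finite Lam" "S \<subseteq> Lam" "emb D S Lam P = component p D Lam"
  shows "opnorm D S (opsub D S P (idop D S)) \<le> norm (p - 1)"
proof -
  have "opnorm D S (opsub D S P (idop D S)) \<le> opnorm D Lam (component (p - 1) D Lam)"
    using opnorm_le_emb[OF assms(3,2,1), of "opsub D S P (idop D S)"] assms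
    by (simp add: emb_opsub emb_idop component_minus component_one)
  also have "\<dots> \<le> norm (p - 1)" by (rule opnorm_component_le_norm[OF assms(1,2)])
  finally show ?thesis .
qed

locale weak_local_gibbs =
  fixes D :: nat and Phi :: "'g::finite site set \<Rightarrow> 'g op" and \<beta> :: real
    and PhiH :: "'g site set \<Rightarrow> 'g site set \<Rightarrow> 'g op" and lam mu Delta :: real
  assumes D_pos: "D > 0" and local_Phi: "local_interaction D Phi"
    and weak_eff_ham: "weak_local_eff_ham D Phi \<beta> PhiH"
    and lam_pos: "lam > 0" and mu_pos: "mu > 0" and Delta_pos: "Delta > 0"
    and beta_pos: "\<beta> > 0" and beta_small: "2 * Delta * \<beta> < lam"
    and eff_decay: "\<And>L. decay_bound D (PhiH L) lam mu Delta"
begin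

definition eff_term :: "'g site set \<Rightarrow> 'g site set \<Rightarrow> 'g site set \<Rightarrow> 'g qalg" where
  "eff_term Lam L X = of_op D Lam (emb D X Lam (PhiH L X))"

definition eff_ham :: "'g site set \<Rightarrow> 'g site set \<Rightarrow> 'g qalg" where
  "eff_ham Lam L = (\<Sum>X\<in>{X. X \<subseteq> Lam \<and> X \<inter> L \<noteq> {}}. eff_term Lam L X)"

lemma eff_term_cong:
  assumes "finite Lam" "X \<subseteq> Lam" "X \<inter> L' = X \<inter> L"
  shows "eff_term Lam L X = eff_term Lam L' X"
proof -
  have "finite X" using assms finite_subset by blast
  then have "op_eq D X (PhiH L X) (PhiH L' X)"
    using weak_eff_ham assms(3) unfolding weak_local_eff_ham_def by blast
  then show ?thesis unfolding eff_term_def by (metis emb_cong[OF assms(2)])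
qed

lemma norm_eff_term_le:
  assumes "finite Lam" "X \<subseteq> Lam"
  shows "norm (eff_term Lam L X) \<le> opnorm D X (PhiH L X)"
  unfolding eff_term_def using norm_of_op_le[OF assms(1)] opnorm_emb_le[OF assms(2,1)]
  by (rule order_trans)

lemma eff_term_commute:
  assumes "finite Lam" "X \<subseteq> Lam" "Y \<subseteq> Lam" "X \<inter> Y = {}"
  shows "eff_term Lam L X * eff_term Lam L' Y = eff_term Lam L' Y * eff_term Lam L X"
  unfolding eff_term_def of_op_opmult[symmetric]
    emb_commute_disjoint[OF assms(2-4,1), of D "PhiH L X"] ..

lemma local_hamiltonian_eff_term:
  assumes "finite Lam"
  shows "local_hamiltonian {X. X \<subseteq> Lam \<and> X \<inter> L \<noteq> {}} (eff_term Lam L) lam Delta"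
proof
  define I where "I = {X. X \<subseteq> Lam \<and> X \<inter> L \<noteq> {}}"
  have I: "finite I" "\<And>X. X \<in> I \<Longrightarrow> finite X" using assms by (auto simp: I_def intro: finite_subset)
  show "finite {X. X \<subseteq> Lam \<and> X \<inter> L \<noteq> {}}" using I(1) by (simp add: I_def)
  show "finite X" if "X \<in> {X. X \<subseteq> Lam \<and> X \<inter> L \<noteq> {}}" for X using that I(2) by (simp add: I_def)
  fix x
  have "(\<Sum>X\<in>{X\<in>I. x \<in> X}. norm (eff_term Lam L X) * exp (lam * card X))
      \<le> (\<Sum>X\<in>{X\<in>I. x \<in> X}. decay_weight D (PhiH L) lam mu X)"
  proof (rule sum_mono)
    fix X assume "X \<in> {X\<in>I. x \<in> X}"
    then have X: "X \<subseteq> Lam" "finite X" using I(2) by (auto simp: I_def)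
    have "norm (eff_term Lam L X) * exp (lam * card X) \<le> opnorm D X (PhiH L X) * exp (lam * card X)"
      by (intro mult_right_mono norm_eff_term_le assms X) simp
    also have "\<dots> \<le> decay_weight D (PhiH L) lam mu X"
      using mu_pos X opnorm_exp_card_le_decay_weight[of mu X D "PhiH L" lam] by simp
    finally show "norm (eff_term Lam L X) * exp (lam * card X) \<le> decay_weight D (PhiH L) lam mu X" .
  qed
  also have "\<dots> \<le> Delta" by (rule sum_decay_weight_le[OF eff_decay I])
  finally show "(\<Sum>X\<in>{X\<in>{X. X \<subseteq> Lam \<and> X \<inter> L \<noteq> {}}. x \<in> X}.
      norm (eff_term Lam L X) * exp (lam * card X)) \<le> Delta"
    by (simp only: I_def)
qed (use assms lam_pos Delta_pos in \<open>auto intro: eff_term_commute\<close>)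

definition crossing :: "'g site set \<Rightarrow> 'g site set \<Rightarrow> 'g site set \<Rightarrow> 'g site set set" where
  "crossing Lam A C = {X. X \<subseteq> Lam \<and> X \<inter> A \<noteq> {} \<and> X \<inter> C \<noteq> {}}"

definition crossing_term :: "'g site set \<Rightarrow> 'g site set \<Rightarrow> 'g site set \<Rightarrow> 'g site set \<Rightarrow> 'g qalg" where
  "crossing_term Lam A C X = eff_term Lam (A \<union> C) X - eff_term Lam A X - eff_term Lam C X"

lemma eff_ham_Un:
  assumes Lam: "finite Lam"
  shows "eff_ham Lam (A \<union> C) - (\<Sum>X\<in>crossing Lam A C. crossing_term Lam A C X)
    = eff_ham Lam A + eff_ham Lam C"
proof -
  have as_Pow: "sum F {X. X \<subseteq> Lam \<and> P X} = (\<Sum>X\<in>Pow Lam. if P X then F X else 0)"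
    for F :: "'g site set \<Rightarrow> 'g qalg" and P
    using Lam by (simp add: Pow_def flip: sum.inter_filter)
  have "(if X \<inter> (A \<union> C) \<noteq> {} then eff_term Lam (A \<union> C) X else 0)
      - (if X \<inter> A \<noteq> {} \<and> X \<inter> C \<noteq> {} then crossing_term Lam A C X else 0)
      = (if X \<inter> A \<noteq> {} then eff_term Lam A X else 0) + (if X \<inter> C \<noteq> {} then eff_term Lam C X else 0)"
    if "X \<in> Pow Lam" for X
  proof -
    have "eff_term Lam (A \<union> C) X = eff_term Lam A X" if "X \<inter> C = {}"
      using that \<open>X \<in> Pow Lam\<close> Lam by (intro eff_term_cong) auto
    moreover have "eff_term Lam (A \<union> C) X = eff_term Lam C X" if "X \<inter> A = {}"
      using that \<open>X \<in> Pow Lam\<close> Lam by (intro eff_term_cong) auto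
    ultimately show ?thesis by (auto simp: Int_Un_distrib crossing_term_def)
  qed
  then show ?thesis
    unfolding eff_ham_def crossing_def as_Pow by (simp flip: sum_subtractf sum.distrib)
qed

lemma sum_norm_crossing_term_le:
  assumes Lam: "finite Lam" "A \<subseteq> Lam" "A \<inter> C = {}"
  shows "(\<Sum>X\<in>crossing Lam A C. norm (crossing_term Lam A C X) * exp (lam * card X))
    \<le> 3 * Delta * lattice_sum_bound TYPE('g) (mu / 2) * card (bdry A) * exp (- (mu / 2) * sdist A C)"
proof -
  define N where "N L X = norm (eff_term Lam L X) * exp (lam * card X)" for L X
  have N_le: "(\<Sum>X\<in>crossing Lam A C. N L X)
      \<le> Delta * lattice_sum_bound TYPE('g) (mu / 2) * card (bdry A) * exp (- (mu / 2) * sdist A C)" for L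
  proof -
    have "(\<Sum>X\<in>crossing Lam A C. N L X)
        \<le> (\<Sum>X\<in>crossing Lam A C. opnorm D X (PhiH L X) * exp (lam * card X))"
      unfolding N_def by (intro sum_mono mult_right_mono norm_eff_term_le Lam) (auto simp: crossing_def)
    also have "\<dots> \<le> Delta * lattice_sum_bound TYPE('g) (mu / 2) * card (bdry A)
        * exp (- (mu / 2) * sdist A C)"
      unfolding crossing_def using mu_pos Delta_pos Lam
      by (intro decay_across_boundary[OF eff_decay]) auto
    finally show ?thesis .
  qed
  have "norm (crossing_term Lam A C X) * exp (lam * card X) \<le> N (A \<union> C) X + N A X + N C X" for X
  proof -
    have "norm (crossing_term Lam A C X)
        \<le> norm (eff_term Lam (A \<union> C) X) + norm (eff_term Lam A X) + norm (eff_term Lam C X)"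
      unfolding crossing_term_def by (meson add_right_mono norm_triangle_ineq4 order_trans)
    then show ?thesis unfolding N_def distrib_right[symmetric] by (rule mult_right_mono) simp
  qed
  then have "(\<Sum>X\<in>crossing Lam A C. norm (crossing_term Lam A C X) * exp (lam * card X))
      \<le> (\<Sum>X\<in>crossing Lam A C. N (A \<union> C) X + N A X + N C X)"
    by (rule sum_mono)
  then show ?thesis using N_le[of "A \<union> C"] N_le[of A] N_le[of C] by (simp add: sum.distrib)
qed

definition crossing_const :: real where
  "crossing_const = 3 * Delta * lattice_sum_bound TYPE('g) (mu / 2) / (1 - 2 * Delta * \<beta> / lam)"

lemma crossing_const_pos: "crossing_const > 0"
  using lattice_sum_bound_pos[of "mu / 2", where 'g = 'g] lam_pos mu_pos Delta_pos beta_small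
  by (simp add: crossing_const_def)

definition crossing_bound :: "'g site set \<Rightarrow> 'g site set \<Rightarrow> real" where
  "crossing_bound A C = crossing_const * card (bdry A) * exp (- (mu / 2) * sdist A C)"

lemma norm_eff_ham_perturbation:
  assumes Lam: "finite Lam" "A \<subseteq> Lam" "A \<inter> C = {}"
  shows "norm (exp (- (\<beta> *\<^sub>R eff_ham Lam (A \<union> C))) * exp (\<beta> *\<^sub>R (eff_ham Lam A + eff_ham Lam C)) - 1)
      \<le> exp (crossing_bound A C * \<beta>) - 1"
    and "norm (exp (- (\<beta> *\<^sub>R (eff_ham Lam A + eff_ham Lam C))) * exp (\<beta> *\<^sub>R eff_ham Lam (A \<union> C)) - 1)
      \<le> exp (crossing_bound A C * \<beta>) - 1"
proof -
  interpret local_hamiltonian "{X. X \<subseteq> Lam \<and> X \<inter> (A \<union> C) \<noteq> {}}" "eff_term Lam (A \<union> C)" lam Delta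
    by (rule local_hamiltonian_eff_term[OF Lam(1)])
  have supported: "supported X (crossing_term Lam A C X)" if "X \<in> crossing Lam A C" for X
    unfolding supported_def
  proof (intro ballI impI)
    fix Y assume Y: "Y \<in> {X. X \<subseteq> Lam \<and> X \<inter> (A \<union> C) \<noteq> {}}" "Y \<inter> X = {}"
    have "eff_term Lam (A \<union> C) Y * eff_term Lam L X = eff_term Lam L X * eff_term Lam (A \<union> C) Y" for L
      using that Y Lam(1) by (intro eff_term_commute) (auto simp: crossing_def)
    then show "eff_term Lam (A \<union> C) Y * crossing_term Lam A C X
        = crossing_term Lam A C X * eff_term Lam (A \<union> C) Y"
      by (simp add: crossing_term_def algebra_simps)
  qed
  have crossing: "finite (crossing Lam A C)" "\<And>X. X \<in> crossing Lam A C \<Longrightarrow> finite X"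
    using Lam(1) by (auto simp: crossing_def intro: finite_subset)
  have "(\<Sum>X\<in>crossing Lam A C. norm (crossing_term Lam A C X) * exp (lam * card X))
      / (1 - 2 * Delta * \<beta> / lam)
      \<le> 3 * Delta * lattice_sum_bound TYPE('g) (mu / 2) * card (bdry A) * exp (- (mu / 2) * sdist A C)
        / (1 - 2 * Delta * \<beta> / lam)"
    using beta_small lam_pos by (intro divide_right_mono sum_norm_crossing_term_le Lam) auto
  also have "\<dots> = crossing_bound A C" by (simp add: crossing_bound_def crossing_const_def)
  finally have sum_le: "(\<Sum>X\<in>crossing Lam A C. norm (crossing_term Lam A C X) * exp (lam * card X))
      / (1 - 2 * Delta * \<beta> / lam) \<le> crossing_bound A C" .
  show "norm (exp (- (\<beta> *\<^sub>R eff_ham Lam (A \<union> C))) * exp (\<beta> *\<^sub>R (eff_ham Lam A + eff_ham Lam C)) - 1)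
      \<le> exp (crossing_bound A C * \<beta>) - 1"
    and "norm (exp (- (\<beta> *\<^sub>R (eff_ham Lam A + eff_ham Lam C))) * exp (\<beta> *\<^sub>R eff_ham Lam (A \<union> C)) - 1)
      \<le> exp (crossing_bound A C * \<beta>) - 1"
    using norm_exp_local_perturbation[OF crossing supported less_imp_le[OF beta_pos] beta_small sum_le]
    unfolding eff_ham_def[symmetric] eff_ham_Un[OF Lam(1)] by (simp_all flip: scaleR_minus_right)
qed

lemma emb_log_ptrace:
  assumes Lam: "finite Lam" "L \<subseteq> Lam"
  shows "emb D L Lam (oplog D L (ptrace D Lam L (bexp D Phi \<beta> Lam)))
    = component ((- \<beta>) *\<^sub>R eff_ham Lam L + ln (Zpart D Phi \<beta> (Lam - L)) *\<^sub>R 1) D Lam"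
proof -
  define K where "K = emb D L Lam (oplog D L (ptrace D Lam L (bexp D Phi \<beta> Lam)))"
  define z where "z = ln (Zpart D Phi \<beta> (Lam - L))"
  define J where "J = opadd D Lam (opscale D Lam (complex_of_real (- 1 / \<beta>)) K)
      (opscale D Lam (complex_of_real (z / \<beta>)) (idop D Lam))"
  have "op_eq D Lam J (\<lambda>\<sigma> \<tau>. \<Sum>X\<in>{X. X \<subseteq> Lam \<and> X \<inter> L \<noteq> {}}. emb D X Lam (PhiH L X) \<sigma> \<tau>)"
    using weak_eff_ham[unfolded weak_local_eff_ham_def, THEN spec, of L, THEN conjunct2, THEN conjunct2,
        THEN conjunct2, THEN spec, THEN mp, OF Lam(1)] Lam(2)
    by (simp add: Int_absorb1 emb_opadd emb_opscale emb_idop J_def K_def z_def)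
  then have "of_op D Lam J = eff_ham Lam L"
    unfolding eff_ham_def eff_term_def of_op_sum[symmetric] by (rule of_op_cong)
  then have J: "component (eff_ham Lam L) D Lam = J"
    using component_of_op[OF D_pos Lam(1), of J] by (simp add: J_def)
  have "K = component ((- \<beta>) *\<^sub>R eff_ham Lam L + z *\<^sub>R 1) D Lam"
  proof (rule canon_eqI[OF _ canon_component])
    show "canon D Lam K" by (simp add: K_def)
    show "op_eq D Lam K (component ((- \<beta>) *\<^sub>R eff_ham Lam L + z *\<^sub>R 1) D Lam)"
      unfolding component_plus component_scaleR component_one[OF D_pos Lam(1)] J
      using beta_pos by (simp add: op_eq_def opadd_def opscale_def J_def field_simps)
  qed
  then show ?thesis by (simp add: K_def z_def)
qed

lemma red_eq_mexp:
  assumes Lam: "finite Lam" "L \<subseteq> Lam"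
  obtains G c where "selfadj D L G" "red D Phi \<beta> Lam L = mexp D L G"
    "emb D L Lam G = component ((- \<beta>) *\<^sub>R eff_ham Lam L + c *\<^sub>R 1) D Lam"
proof -
  have "finite L" using Lam finite_subset by blast
  define M where "M = ptrace D Lam L (bexp D Phi \<beta> Lam)"
  define Z where "Z = Zpart D Phi \<beta> Lam"
  have "Z > 0" unfolding Z_def by (rule Zpart_pos[OF D_pos local_Phi Lam(1)])
  have "posdef D L M"
    unfolding M_def by (intro posdef_ptrace posdef_bexp D_pos local_Phi Lam)
  note log_M = oplog_posdef[OF D_pos \<open>finite L\<close> this]
  define G where "G = opadd D L (oplog D L M) (opscale D L (complex_of_real (- ln Z)) (idop D L))"
  have "selfadj D L G"
    unfolding G_def by (intro selfadj_opadd selfadj_opscale selfadj_idop log_M)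
  moreover have "red D Phi \<beta> Lam L = mexp D L G"
    unfolding G_def mexp_opadd_scalar[OF D_pos \<open>finite L\<close>] log_M(3)
    using \<open>Z > 0\<close> by (simp add: red_eq_opscale_ptrace Lam(2) M_def Z_def exp_minus divide_inverse)
  moreover have "emb D L Lam G
      = component ((- \<beta>) *\<^sub>R eff_ham Lam L + (ln (Zpart D Phi \<beta> (Lam - L)) - ln Z) *\<^sub>R 1) D Lam"
  proof -
    have "emb D L Lam G
        = component (((- \<beta>) *\<^sub>R eff_ham Lam L + ln (Zpart D Phi \<beta> (Lam - L)) *\<^sub>R 1) + (- ln Z) *\<^sub>R 1) D Lam"
      unfolding G_def M_def component_plus[of "_ + _"] component_scaleR[of "- ln Z"]
        component_one[OF D_pos Lam(1)]
      by (simp only: emb_opadd emb_opscale emb_idop Lam(2) emb_log_ptrace[OF Lam])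
    then show ?thesis by (simp add: algebra_simps)
  qed
  ultimately show thesis by (rule that)
qed

lemma cmod_optrace_mult_red_le:
  assumes "finite Lam" "L \<subseteq> Lam"
  shows "cmod (optrace D L (opmult D L V (red D Phi \<beta> Lam L))) \<le> opnorm D L V"
proof -
  obtain G c where G: "selfadj D L G" "red D Phi \<beta> Lam L = mexp D L G"
    using red_eq_mexp[OF assms] by metis
  have "finite L" using assms finite_subset by blast
  then show ?thesis
    using cmod_optrace_mult_mexp_le[OF D_pos _ G(1), of V] optrace_red[OF D_pos local_Phi assms, of \<beta>]
    by (simp add: G(2))
qed

lemma marginal_ratio_eq_quotient:
  assumes Lam: "finite Lam" "A \<subseteq> Lam" "C \<subseteq> Lam" "A \<inter> C = {}"
  obtains G G' c c' where "red D Phi \<beta> Lam (A \<union> C) = mexp D (A \<union> C) G"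
    "marginal_ratio D Phi \<beta> Lam A C
      = opmult D (A \<union> C) (mexp D (A \<union> C) G) (mexp D (A \<union> C) (opscale D (A \<union> C) (- 1) G'))"
    "optrace D (A \<union> C) (mexp D (A \<union> C) G') = 1"
    "emb D (A \<union> C) Lam G = component (- (\<beta> *\<^sub>R eff_ham Lam (A \<union> C)) + c *\<^sub>R 1) D Lam"
    "emb D (A \<union> C) Lam G' = component (- (\<beta> *\<^sub>R (eff_ham Lam A + eff_ham Lam C)) + c' *\<^sub>R 1) D Lam"
proof -
  define S where "S = A \<union> C"
  have sub: "S \<subseteq> Lam" "A \<subseteq> S" "C \<subseteq> S" using Lam by (auto simp: S_def)
  have fin: "finite A" "finite C" using Lam by (auto intro: finite_subset)
  obtain G c where G: "red D Phi \<beta> Lam S = mexp D S G"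
    "emb D S Lam G = component ((- \<beta>) *\<^sub>R eff_ham Lam S + c *\<^sub>R 1) D Lam"
    using red_eq_mexp[OF Lam(1) sub(1)] by metis
  obtain GA cA where GA: "red D Phi \<beta> Lam A = mexp D A GA"
    "emb D A Lam GA = component ((- \<beta>) *\<^sub>R eff_ham Lam A + cA *\<^sub>R 1) D Lam"
    using red_eq_mexp[OF Lam(1,2)] by metis
  obtain GC cC where GC: "red D Phi \<beta> Lam C = mexp D C GC"
    "emb D C Lam GC = component ((- \<beta>) *\<^sub>R eff_ham Lam C + cC *\<^sub>R 1) D Lam"
    using red_eq_mexp[OF Lam(1,3)] by metis
  define G' where "G' = opadd D S (emb D A S GA) (emb D C S GC)"
  note product = emb_mexp_product[OF D_pos fin Lam(4), folded S_def]
  have "op_eq D S (opadd D S (emb D A S (opscale D A (- 1) GA)) (emb D C S (opscale D C (- 1) GC)))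
      (opscale D S (- 1) G')"
    unfolding emb_opscale[OF sub(2)] emb_opscale[OF sub(3)]
    by (simp add: op_eq_def G'_def opadd_def opscale_def)
  then have "marginal_ratio D Phi \<beta> Lam A C = opmult D S (mexp D S G) (mexp D S (opscale D S (- 1) G'))"
    unfolding marginal_ratio_def S_def[symmetric] G(1) GA(1) GC(1) opinv_mexp[OF D_pos fin(1)]
      opinv_mexp[OF D_pos fin(2)] product
    by (simp only: mexp_cong)
  moreover have "optrace D S (mexp D S G') = 1"
  proof -
    have "optrace D S (mexp D S G') = optrace D A (red D Phi \<beta> Lam A) * optrace D C (red D Phi \<beta> Lam C)"
      unfolding G'_def product[symmetric] GA(1) GC(1) unfolding S_def
      by (rule optrace_emb_disjoint[OF Lam(4) fin])
    then show ?thesis by (simp add: optrace_red D_pos local_Phi Lam)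
  qed
  moreover have "emb D S Lam G'
      = component (- (\<beta> *\<^sub>R (eff_ham Lam A + eff_ham Lam C)) + (cA + cC) *\<^sub>R 1) D Lam"
  proof -
    have "emb D S Lam G'
        = component (((- \<beta>) *\<^sub>R eff_ham Lam A + cA *\<^sub>R 1) + ((- \<beta>) *\<^sub>R eff_ham Lam C + cC *\<^sub>R 1)) D Lam"
      unfolding G'_def component_plus[of "_ + _" "_ + _"]
      by (simp only: emb_opadd emb_emb sub GA(2) GC(2))
    then show ?thesis by (simp add: algebra_simps)
  qed
  ultimately show thesis using G by (intro that[folded S_def]) auto
qed

text \<open>The inverse of the ratio has expectation 1 in the joint marginal; rescaling it to
  \<open>exp F' exp (- F)\<close> turns this expectation into \<open>exp (c - c')\<close>.\<close>

lemma abs_normalization_le: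
  assumes Lam: "finite Lam" "S \<subseteq> Lam"
    and G: "red D Phi \<beta> Lam S = mexp D S G" "emb D S Lam G = component (F + c *\<^sub>R 1) D Lam"
    and G': "optrace D S (mexp D S G') = 1" "emb D S Lam G' = component (F' + c' *\<^sub>R 1) D Lam"
  shows "\<bar>exp (c - c') - 1\<bar> \<le> norm (exp F' * exp (- F) - 1)"
proof -
  have "finite S" using Lam finite_subset by blast
  define \<kappa> where "\<kappa> = exp (c - c')"
  define V where "V = opscale D S (complex_of_real \<kappa>)
      (opmult D S (mexp D S G') (mexp D S (opscale D S (- 1) G)))"
  have "emb D S Lam V = component (\<kappa> *\<^sub>R (exp (c' - c) *\<^sub>R (exp F' * exp (- F)))) D Lam"
    unfolding V_def component_scaleR[of \<kappa>] emb_opscale[OF Lam(2)]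
    by (simp only: emb_mexp_quotient[OF D_pos Lam G'(2) G(2)])
  also have "\<kappa> *\<^sub>R (exp (c' - c) *\<^sub>R (exp F' * exp (- F))) = exp F' * exp (- F)"
    by (simp add: \<kappa>_def flip: exp_add)
  finally have V_le: "opnorm D S (opsub D S V (idop D S)) \<le> norm (exp F' * exp (- F) - 1)"
    by (rule opnorm_diff_idop_le[OF D_pos Lam])
  have "opmult D S V (red D Phi \<beta> Lam S) = opscale D S (complex_of_real \<kappa>) (mexp D S G')"
    by (simp add: V_def G(1) opmult_opscale_left opmult_assoc mexp_inverse opmult_idop_right canon_mexp
        D_pos \<open>finite S\<close>)
  then have "optrace D S (opmult D S V (red D Phi \<beta> Lam S)) = complex_of_real \<kappa>"
    using G'(1) by (simp add: optrace_def opscale_def flip: sum_distrib_left)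
  moreover have "optrace D S (opmult D S (idop D S) (red D Phi \<beta> Lam S)) = 1"
    using optrace_red[OF D_pos local_Phi Lam, of \<beta>]
    by (simp add: G(1) opmult_idop_left canon_mexp D_pos \<open>finite S\<close>)
  ultimately have "optrace D S (opmult D S (opsub D S V (idop D S)) (red D Phi \<beta> Lam S))
      = complex_of_real (\<kappa> - 1)"
    by (simp add: optrace_def opmult_def opsub_def left_diff_distrib sum_subtractf)
  then show ?thesis
    using cmod_optrace_mult_red_le[OF Lam, of "opsub D S V (idop D S)"] V_le unfolding \<kappa>_def
    by (metis norm_of_real order_trans)
qed

lemma opnorm_marginal_ratio_le:
  assumes Lam: "finite Lam" "A \<subseteq> Lam" "C \<subseteq> Lam" "A \<inter> C = {}"
  shows "opnorm D (A \<union> C) (opsub D (A \<union> C) (marginal_ratio D Phi \<beta> Lam A C) (idop D (A \<union> C)))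
    \<le> exp (2 * \<beta> * crossing_bound A C) - 1"
proof -
  define Y where "Y = eff_ham Lam A + eff_ham Lam C"
  define Z where "Z = eff_ham Lam (A \<union> C)"
  have sub: "A \<union> C \<subseteq> Lam" using Lam by blast
  obtain G G' c c' where G: "red D Phi \<beta> Lam (A \<union> C) = mexp D (A \<union> C) G"
    and ratio: "marginal_ratio D Phi \<beta> Lam A C
      = opmult D (A \<union> C) (mexp D (A \<union> C) G) (mexp D (A \<union> C) (opscale D (A \<union> C) (- 1) G'))"
    and G': "optrace D (A \<union> C) (mexp D (A \<union> C) G') = 1"
    and emb: "emb D (A \<union> C) Lam G = component (- (\<beta> *\<^sub>R Z) + c *\<^sub>R 1) D Lam"
      "emb D (A \<union> C) Lam G' = component (- (\<beta> *\<^sub>R Y) + c' *\<^sub>R 1) D Lam"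
    by (rule marginal_ratio_eq_quotient[OF Lam, folded Y_def Z_def], rule that)
  note perturbation = norm_eff_ham_perturbation[OF Lam(1,2,4), folded Y_def Z_def]
  have "\<bar>exp (c - c') - 1\<bar> \<le> exp (crossing_bound A C * \<beta>) - 1"
    using abs_normalization_le[OF Lam(1) sub G emb(1) G' emb(2)] perturbation(2) by simp
  then have "norm (exp (c - c') *\<^sub>R (exp (- (\<beta> *\<^sub>R Z)) * exp (\<beta> *\<^sub>R Y)) - 1)
      \<le> (1 + (exp (crossing_bound A C * \<beta>) - 1))\<^sup>2 - 1"
    using perturbation(1) by (rule norm_scaleR_diff_one_le)
  also have "\<dots> = exp (2 * \<beta> * crossing_bound A C) - 1"
    by (simp add: power2_eq_square mult_ac flip: exp_add)
  finally show ?thesis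
    using opnorm_diff_idop_le[OF D_pos Lam(1) sub emb_mexp_quotient[OF D_pos Lam(1) sub emb]]
    by (simp add: ratio)
qed

lemma opnorm_marginal_ratio_decay:
  fixes q K :: real
  assumes Lam: "finite Lam" "A \<subseteq> Lam" "C \<subseteq> Lam" "A \<inter> C = {}" and "q \<ge> 0"
  defines "K \<equiv> 2 * \<beta> * crossing_const"
  shows "opnorm D (A \<union> C) (opsub D (A \<union> C) (marginal_ratio D Phi \<beta> Lam A C) (idop D (A \<union> C)))
    \<le> K * (exp (K * card (bdry A)) * (card (bdry A) + q)) * exp (- (mu / 2) * sdist A C)"
proof -
  define p where "p = real (card (bdry A))"
  define e where "e = exp (- (mu / 2) * sdist A C)"
  have e: "0 \<le> e" "e \<le> 1" using mu_pos by (auto simp: e_def sdist_def setdist_pos_le)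
  have K: "K \<ge> 0" using crossing_const_pos beta_pos by (simp add: K_def)
  have "opnorm D (A \<union> C) (opsub D (A \<union> C) (marginal_ratio D Phi \<beta> Lam A C) (idop D (A \<union> C)))
      \<le> exp (K * p * e) - 1"
    using opnorm_marginal_ratio_le[OF Lam] by (simp add: crossing_bound_def K_def p_def e_def mult_ac)
  also have "\<dots> \<le> K * p * e * exp (K * p)"
    using K e by (intro exp_mult_diff_one_le) (auto simp: p_def)
  also have "\<dots> \<le> K * (p + q) * e * exp (K * p)"
    using K e \<open>q \<ge> 0\<close> by (intro mult_right_mono mult_left_mono) auto
  finally show ?thesis by (simp add: p_def e_def mult_ac)
qed

end

theorem theorem6p5:
  fixes D :: nat and Phi :: "'g::finite site set \<Rightarrow> 'g op"
    and lam mu Delta \<beta> :: real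
    and PhiH :: "'g site set \<Rightarrow> 'g site set \<Rightarrow> 'g op"
    and \<epsilon> :: "real \<Rightarrow> real" and b :: nat
    and gf :: "'g site set \<Rightarrow> real" and f :: "'g site set \<Rightarrow> 'g site set \<Rightarrow> real"
  assumes "D \<ge> 1"
    and "local_interaction D Phi"
    and "lam > 0" "mu > 0" "Delta > 0"
    and "decay_bound D Phi lam mu Delta"
    and "0 < \<beta>" "\<beta> < lam / (2 * Delta)"
    and "weak_local_eff_ham D Phi \<beta> PhiH"
    and "\<forall>L. decay_bound D (PhiH L) lam mu Delta"
    and "uniform_clustering D Phi \<beta> \<epsilon> b gf f"
    and "exp_decaying \<epsilon>"
  shows "\<exists>c' K1 K2. c' > 0 \<and> K1 > 0 \<and> K2 > 0 \<and>
     (\<forall>Lam A C. finite Lam \<and> A \<subseteq> Lam \<and> C \<subseteq> Lam \<and> A \<inter> C = {} \<and> A \<noteq> {} \<and> C \<noteq> {} \<longrightarrow>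
        opnorm D (A \<union> C)
          (opsub D (A \<union> C)
             (opmult D (A \<union> C) (red D Phi \<beta> Lam (A \<union> C))
                (opmult D (A \<union> C) (emb D A (A \<union> C) (opinv D A (red D Phi \<beta> Lam A)))
                                   (emb D C (A \<union> C) (opinv D C (red D Phi \<beta> Lam C)))))
             (idop D (A \<union> C)))
        \<le> K2 * min (exp (K1 * real (card (bdry A))) * (real (card (bdry A)) + real (card C) * gf A))
                   (exp (K1 * real (card (bdry C))) * (real (card (bdry C)) + real (card A) * gf C))
             * exp (- c' * sdist A C))"
proof -
  interpret weak_local_gibbs D Phi \<beta> PhiH lam mu Delta
    by unfold_locales (use assms in \<open>auto simp: field_simps\<close>)
  define K where "K = 2 * \<beta> * crossing_const"
  have "K > 0" using crossing_const_pos beta_pos by (simp add: K_def)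
  have gf_nonneg: "gf X \<ge> 0" if "finite X" for X
    using assms(11) that by (simp add: uniform_clustering_def)
  have "opnorm D (A \<union> C) (opsub D (A \<union> C) (marginal_ratio D Phi \<beta> Lam A C) (idop D (A \<union> C)))
      \<le> K * min (exp (K * card (bdry A)) * (card (bdry A) + card C * gf A))
          (exp (K * card (bdry C)) * (card (bdry C) + card A * gf C)) * exp (- (mu / 2) * sdist A C)"
    (is "?N \<le> K * min ?a ?c * ?e") if Lam: "finite Lam" "A \<subseteq> Lam" "C \<subseteq> Lam" "A \<inter> C = {}" for Lam A C
  proof -
    have fin: "finite A" "finite C" using Lam by (auto intro: finite_subset)
    have "?N \<le> K * ?a * ?e"
      using opnorm_marginal_ratio_decay[OF Lam] gf_nonneg fin by (simp add: K_def)
    moreover have "?N \<le> K * ?c * ?e"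
      using opnorm_marginal_ratio_decay[OF Lam(1,3,2)]
        marginal_ratio_commute[OF Lam(4) fin] Lam(4) gf_nonneg fin
      by (simp add: K_def Un_commute Int_commute sdist_def setdist_sym)
    ultimately show ?thesis by (simp only: min_def split: if_split) blast
  qed
  then show ?thesis
    using \<open>K > 0\<close> mu_pos unfolding marginal_ratio_def by (intro exI[of _ "mu / 2"] exI[of _ K]) auto
qed

end
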